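(* Let $N=2k+1\ge 3$ be odd and let $\phi$ be the functional on $C_n=C^{(N)}_{n,+}(q)$ given by $\phi(c)=\frac{1}{[N]^n}\mathrm{Tr}\big(\Phi(c)D^{\otimes n}\big)$. Then $\phi$ satisfies the Markov property $\phi(cg_{n-1})=\phi(c)\phi(g_{n-1})$ for all $c\in C_{n-1}$ (for $n\ge 2$), and the trace property $\phi(cd)=\phi(dc)$ for all $c,d\in C_n$. Hence there exists a trace $tr$ on the algebras $C_n$ satisfying $tr(cg_n)=tr(c)\,tr(g_n)$ for all $c\in C_n$.
   Context: $q$ is an indeterminate and the base field is $\mathbb{C}(q^{1/2})$ (extended by square roots as needed). $[m]=(q^m-q^{-m})/(q-q^{-1})$. Hecke algebra $H_n=H_n(q)$: generators $g_i$, $1\le i<n$, relations $g_ig_{i+1}g_i=g_{i+1}g_ig_{i+1}$, $g_ig_j=g_jg_i$ for $|i-j|\ne1$, $g_i^2=(q-q^{-1})g_i+1$; $u_i=q-g_i$. Algebra $C_n=C_{n,+}^{(N)}(q)$: unital algebra with generators $u_i$ ($1\le i<n$) and $e_{(r)}$ ($1\le r\le n$), $e_{(0)}=1$, $e=e_{(1)}$, and relations: (a) the $u_i$ satisfy the Hecke algebra relations and $eu_i=u_ie$ for $i\ge2$; (b) the $e_{(r)}$ are idempotents and $e_{(r+1)}=e_{(r)}u_re_{(r)}-\frac{q^{(N-2)/2}-q^{-(N-2)/2}}{q^{N/2}-q^{-N/2}}e_{(r)}$ for $1\le r<n$; (c) for $2\le j<r\le n$: $(u_{j-1}u_j-u_{j-1})e_{(r)}=(u_ju_{j-1}-u_j)e_{(r)}$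 and $e_{(r)}(u_ju_{j-1}-u_{j-1})=e_{(r)}(u_{j-1}u_j-u_j)$. Elements of $C_{n-1}$ are regarded as elements of $C_n$ via the map sending generators to the generators of the same name. Representation $\Phi:C_n\to\mathrm{End}(V^{\otimes n})$: $V$ has dimension $N$ with basis $v_1,\dots,v_N$. Put $\alpha_i=q^{(k+1-i)/2}/\big(\sum_{j=1}^Nq^{k+1-j}\big)^{1/2}$ and let $E=(\alpha_i\alpha_j)_{ij}\in\mathrm{End}(V)$. Let $U\in\mathrm{End}(V^{\otimes2})$ be given by $U(v_i\otimes v_i)=0$ and, for $i<j$, $U(v_i\otimes v_j)=q^{-1}v_i\otimes v_j+v_j\otimes v_i$, $U(v_j\otimes v_i)=v_i\otimes v_j+q\,v_j\otimes v_i$. Let $U_i$ be $U$ acting on the $i$-th and $(i+1)$-st tensor factors. Then $\Phi$ is the homomorphism with $\Phi(e)=E\otimes1_{n-1}$, $\Phi(u_i)=U_i$. Finally $D=\mathrm{diag}(q^{2i-N-1})_{1\le i\le N}$ and $\mathrm{Tr}$ is the usual trace. *)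

theory Defs
  imports
    "HOL-Library.Poly_Mapping"
    "HOL-Library.FuncSet"
    "HOL-Computational_Algebra.Polynomial"
    "HOL-Algebra.QuotRing"
    "Jordan_Normal_Form.Matrix"
begin

section \<open>The base field\<close>

text \<open>
  A field extension \<open>'a\<close> of \<open>\<complex>(q^(1/2))\<close>: \<open>\<iota>\<close> embeds the complex numbers and \<open>s\<close>, which plays the
  role of \<open>q^(1/2)\<close>, is transcendental over the image of \<open>\<iota>\<close>. So \<open>q\<close> is \<open>s\<^sup>2\<close> below.
\<close>

definition extends_C_sqrt_q :: "(complex \<Rightarrow> 'a::field) \<Rightarrow> 'a \<Rightarrow> bool" where
  "extends_C_sqrt_q \<iota> s \<longleftrightarrow>
     field_hom \<iota> \<and> (\<forall>p :: complex poly. p \<noteq> 0 \<longrightarrow> poly (map_poly \<iota> p) s \<noteq> 0)"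

definition qint :: "'a::field \<Rightarrow> int \<Rightarrow> 'a" where
  "qint q m = (q powi m - q powi (- m)) / (q - inverse q)"


section \<open>Free associative algebras\<close>

datatype 'g free_mon = Word (letters: "'g list")

text \<open>Words under concatenation, written additively because \<^typ>\<open>'m \<Rightarrow>\<^sub>0 'a\<close> is the monoid
  algebra of an additively written monoid \<open>'m\<close>, commutative or not.\<close>

instantiation free_mon :: (type) monoid_add
begin

definition zero_free_mon :: "'a free_mon" where
  "0 = Word []"

definition plus_free_mon :: "'a free_mon \<Rightarrow> 'a free_mon \<Rightarrow> 'a free_mon" where
  "v + w = Word (letters v @ letters w)"

instance
  by standard (simp_all add: zero_free_mon_def plus_free_mon_def)

end

type_synonym ('g, 'a) free_alg = "'g free_mon \<Rightarrow>\<^sub>0 'a"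

definition scalar :: "'a::zero \<Rightarrow> ('g, 'a) free_alg" where
  "scalar a = Poly_Mapping.single 0 a"

definition gen :: "'g \<Rightarrow> ('g, 'a::zero_neq_one) free_alg" where
  "gen x = Poly_Mapping.single (Word [x]) 1"

definition free_ring :: "'g set \<Rightarrow> ('g, 'a::field) free_alg ring" where
  "free_ring G =
     \<lparr>carrier = {p. \<forall>w \<in> Poly_Mapping.keys p. set (letters w) \<subseteq> G},
      monoid.mult = (*), one = 1, zero = 0, add = (+)\<rparr>"


section \<open>The algebras \<open>C_n\<close>\<close>

datatype C_letter = ULetter nat | ELetter nat

definition C_letters :: "nat \<Rightarrow> C_letter set" where
  "C_letters n = ULetter ` {1..<n} \<union> ELetter ` {1..n}"

definition u_el :: "nat \<Rightarrow> (C_letter, 'a::field) free_alg" where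
  "u_el i = gen (ULetter i)"

definition e_el :: "nat \<Rightarrow> (C_letter, 'a::field) free_alg" where
  "e_el r = (if r = 0 then 1 else gen (ELetter r))"

definition g_el :: "'a::field \<Rightarrow> nat \<Rightarrow> (C_letter, 'a) free_alg" where
  "g_el s i = scalar (s\<^sup>2) - u_el i"

text \<open>A relation \<open>l = r\<close> is recorded as the element \<open>l - r\<close>.\<close>

definition Hecke_rels :: "'a::field \<Rightarrow> nat \<Rightarrow> (C_letter, 'a) free_alg set" where
  "Hecke_rels s n =
     {g_el s i * g_el s (i+1) * g_el s i - g_el s (i+1) * g_el s i * g_el s (i+1) | i. 1 \<le> i \<and> i + 1 < n}
   \<union> {g_el s i * g_el s j - g_el s j * g_el s i | i j.
        i \<in> {1..<n} \<and> j \<in> {1..<n} \<and> i \<noteq> j + 1 \<and> j \<noteq> i + 1}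
   \<union> {g_el s i * g_el s i - (scalar (s\<^sup>2 - inverse (s\<^sup>2)) * g_el s i + 1) | i. i \<in> {1..<n}}"

definition C_rels :: "'a::field \<Rightarrow> nat \<Rightarrow> nat \<Rightarrow> (C_letter, 'a) free_alg set" where
  "C_rels s N n =
     Hecke_rels s n
   \<union> {e_el 1 * u_el i - u_el i * e_el 1 | i. 2 \<le> i \<and> i < n}
   \<union> {e_el r * e_el r - e_el r | r. 1 \<le> r \<and> r \<le> n}
   \<union> {e_el (r+1) - (e_el r * u_el r * e_el r
          - scalar ((s powi (int N - 2) - s powi (- (int N - 2)))
                    / (s powi (int N) - s powi (- int N))) * e_el r)
        | r. 1 \<le> r \<and> r < n}
   \<union> {(u_el (j-1) * u_el j - u_el (j-1)) * e_el r - (u_el j * u_el (j-1) - u_el j) * e_el r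
        | j r. 2 \<le> j \<and> j < r \<and> r \<le> n}
   \<union> {e_el r * (u_el j * u_el (j-1) - u_el (j-1)) - e_el r * (u_el (j-1) * u_el j - u_el j)
        | j r. 2 \<le> j \<and> j < r \<and> r \<le> n}"

definition C_ideal :: "'a::field \<Rightarrow> nat \<Rightarrow> nat \<Rightarrow> (C_letter, 'a) free_alg set" where
  "C_ideal s N n = genideal (free_ring (C_letters n)) (C_rels s N n)"

definition C_alg :: "'a::field \<Rightarrow> nat \<Rightarrow> nat \<Rightarrow> (C_letter, 'a) free_alg set ring" where
  "C_alg s N n = free_ring (C_letters n) Quot C_ideal s N n"

definition C_class ::
    "'a::field \<Rightarrow> nat \<Rightarrow> nat \<Rightarrow> (C_letter, 'a) free_alg \<Rightarrow> (C_letter, 'a) free_alg set" where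
  "C_class s N n p = C_ideal s N n +>\<^bsub>free_ring (C_letters n)\<^esub> p"

text \<open>For \<open>m \<le> n\<close>, the map \<open>C_m \<rightarrow> C_n\<close> sending generators to the generators of the same name: it
  enlarges the class of \<open>p\<close> modulo \<open>C_ideal s N m\<close> to the class of \<open>p\<close> modulo \<open>C_ideal s N n\<close>.\<close>

definition C_incl ::
    "'a::field \<Rightarrow> nat \<Rightarrow> nat \<Rightarrow> (C_letter, 'a) free_alg set \<Rightarrow> (C_letter, 'a) free_alg set" where
  "C_incl s N n X = C_ideal s N n <+>\<^bsub>free_ring (C_letters n)\<^esub> X"

definition linear_functional ::
    "'a::field \<Rightarrow> nat \<Rightarrow> nat \<Rightarrow> ((C_letter, 'a) free_alg set \<Rightarrow> 'a) \<Rightarrow> bool" where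
  "linear_functional s N n f \<longleftrightarrow>
     (\<forall>c \<in> carrier (C_alg s N n). \<forall>d \<in> carrier (C_alg s N n).
        f (c \<oplus>\<^bsub>C_alg s N n\<^esub> d) = f c + f d) \<and>
     (\<forall>a. \<forall>c \<in> carrier (C_alg s N n).
        f (C_class s N n (scalar a) \<otimes>\<^bsub>C_alg s N n\<^esub> c) = a * f c)"


section \<open>The representation on \<open>V\<^sup>\<otimes>\<^sup>n\<close>\<close>

text \<open>
  Endomorphisms of the \<open>n\<close>-th tensor power of \<open>V\<close> are matrices of size \<open>N^n\<close>. Matrix indices start
  at \<open>0\<close>, so \<open>v_i\<close> has index \<open>i - 1\<close>; tensor products of basis vectors are ordered
  lexicographically, so \<open>v_i \<otimes> v_j\<close> has index \<open>(i - 1) * N + (j - 1)\<close>, and the tensor product of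
  endomorphisms is the Kronecker product.
\<close>

definition kron :: "'a::times mat \<Rightarrow> 'a mat \<Rightarrow> 'a mat" where
  "kron A B = mat (dim_row A * dim_row B) (dim_col A * dim_col B)
     (\<lambda>(i, j). A $$ (i div dim_row B, j div dim_col B) * B $$ (i mod dim_row B, j mod dim_col B))"

primrec tensor_power :: "'a::semiring_1 mat \<Rightarrow> nat \<Rightarrow> 'a mat" where
  "tensor_power A 0 = 1\<^sub>m 1"
| "tensor_power A (Suc n) = kron A (tensor_power A n)"

definition mat_trace :: "'a::comm_monoid_add mat \<Rightarrow> 'a" where
  "mat_trace A = (\<Sum>i < dim_row A. A $$ (i, i))"

text \<open>\<open>w\<close> is a square root of \<open>\<Sum>j=1..N. q^(k+1-j)\<close>; the argument \<open>i\<close> of \<open>alpha\<close> runs from \<open>1\<close>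
  to \<open>N\<close>.\<close>

definition alpha :: "'a::field \<Rightarrow> 'a \<Rightarrow> nat \<Rightarrow> nat \<Rightarrow> 'a" where
  "alpha s w k i = s powi (int k + 1 - int i) / w"

definition E_mat :: "'a::field \<Rightarrow> 'a \<Rightarrow> nat \<Rightarrow> nat \<Rightarrow> 'a mat" where
  "E_mat s w k N = mat N N (\<lambda>(i, j). alpha s w k (i + 1) * alpha s w k (j + 1))"

text \<open>Column \<open>i * N + j\<close> holds the coordinates of \<open>U(v_(i+1) \<otimes> v_(j+1))\<close>.\<close>

definition U_mat :: "'a::field \<Rightarrow> nat \<Rightarrow> 'a mat" where
  "U_mat s N = mat (N * N) (N * N) (\<lambda>(row, col).
     let i = col div N; j = col mod N in
     if i = j then 0
     else if row = i * N + j then (if i < j then inverse (s\<^sup>2) else s\<^sup>2)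
     else if row = j * N + i then 1
     else 0)"

definition U_at :: "'a::field \<Rightarrow> nat \<Rightarrow> nat \<Rightarrow> nat \<Rightarrow> 'a mat" where
  "U_at s N n i = kron (1\<^sub>m (N ^ (i - 1))) (kron (U_mat s N) (1\<^sub>m (N ^ (n - i - 1))))"

definition D_mat :: "'a::field \<Rightarrow> nat \<Rightarrow> 'a mat" where
  "D_mat s N = mat_diag N (\<lambda>i. (s\<^sup>2) powi (2 * int (i + 1) - int N - 1))"

definition is_Phi ::
    "'a::field \<Rightarrow> 'a \<Rightarrow> nat \<Rightarrow> nat \<Rightarrow> nat \<Rightarrow> ((C_letter, 'a) free_alg set \<Rightarrow> 'a mat) \<Rightarrow> bool" where
  "is_Phi s w k N n f \<longleftrightarrow>
     f \<in> Ring.ring_hom (C_alg s N n) (ring_mat TYPE('a) (N ^ n) ()) \<and>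
     (\<forall>a. f (C_class s N n (scalar a)) = a \<cdot>\<^sub>m 1\<^sub>m (N ^ n)) \<and>
     f (C_class s N n (e_el 1)) = kron (E_mat s w k N) (1\<^sub>m (N ^ (n - 1))) \<and>
     (\<forall>i \<in> {1..<n}. f (C_class s N n (u_el i)) = U_at s N n i)"

text \<open>Extensionality only fixes the value outside the carrier, so that the homomorphism is unique as
  a HOL function.\<close>

definition Phi ::
    "'a::field \<Rightarrow> 'a \<Rightarrow> nat \<Rightarrow> nat \<Rightarrow> nat \<Rightarrow> (C_letter, 'a) free_alg set \<Rightarrow> 'a mat" where
  "Phi s w k N n = (THE f. f \<in> extensional (carrier (C_alg s N n)) \<and> is_Phi s w k N n f)"

definition phi ::
    "'a::field \<Rightarrow> 'a \<Rightarrow> nat \<Rightarrow> nat \<Rightarrow> nat \<Rightarrow> (C_letter, 'a) free_alg set \<Rightarrow> 'a" where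
  "phi s w k N n c =
     1 / qint (s\<^sup>2) (int N) ^ n * mat_trace (Phi s w k N n c * tensor_power (D_mat s N) n)"

text \<open>A normalised trace on the tower of the algebras \<open>C_n\<close>, \<open>n \<ge> 1\<close>: one functional for each \<open>n\<close>,
  compatible with the maps \<open>C_n \<rightarrow> C_(n+1)\<close>.\<close>

definition is_trace_on_tower ::
    "'a::field \<Rightarrow> nat \<Rightarrow> (nat \<Rightarrow> (C_letter, 'a) free_alg set \<Rightarrow> 'a) \<Rightarrow> bool" where
  "is_trace_on_tower s N tr \<longleftrightarrow>
     (\<forall>n \<ge> 1.
        linear_functional s N n (tr n) \<and>
        tr n \<one>\<^bsub>C_alg s N n\<^esub> = 1 \<and>
        (\<forall>c \<in> carrier (C_alg s N n). \<forall>d \<in> carrier (C_alg s N n).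
           tr n (c \<otimes>\<^bsub>C_alg s N n\<^esub> d) = tr n (d \<otimes>\<^bsub>C_alg s N n\<^esub> c)) \<and>
        (\<forall>c \<in> carrier (C_alg s N n). tr (n + 1) (C_incl s N (n + 1) c) = tr n c))"

end

theory Submission
  imports Defs
begin

text \<open>
  \<^bold>\<open>The representation.\<close> \<open>E\<close> is the projection onto the line of the unit vector \<open>\<alpha>\<close>. The
  coefficients of \<open>\<alpha>\<close> are such that \<open>(E \<otimes> 1) U (E \<otimes> 1) = E \<otimes> (E + c)\<close>, where \<open>c\<close> is the coefficient
  in the recursion for \<open>e_(r)\<close>. So \<open>e_(r)\<close> can only be sent to \<open>E\<close> on the first \<open>r\<close> tensor factors; these
  are idempotents, and the remaining relations concern two or three tensor factors and are checked
  on coordinates (lemmas \<open>\<epsilon>_U2_\<epsilon>\<close>, \<open>U2_braid\<close>, \<open>U2_slide_left\<close>, \<open>U2_slide_right\<close>). This gives existence and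
  uniqueness of \<open>\<Phi>\<close>.

  \<^bold>\<open>Why the trace property is not immediate.\<close> \<open>D \<otimes> ... \<otimes> D\<close> commutes with the \<open>U_i\<close>, so the \<open>u_i\<close> may be
  moved around under \<open>\<phi>\<close>. It does not commute with \<open>E \<otimes> 1\<close>, so for \<open>e\<close> another argument is needed.
  Let \<open>F\<close> be the partial trace over the last of \<open>n + 1\<close> tensor factors, weighted by \<open>D\<close>, and let \<open>A_n\<close>
  be the image of \<open>C_n\<close>. If \<open>F\<close> maps \<open>A_(n+1)\<close> into \<open>A_n\<close>, then \<open>\<phi>(e y)\<close> and \<open>\<phi>(y e)\<close> are, up to a
  factor, \<open>\<phi>(e F(y))\<close> and \<open>\<phi>(F(y) e)\<close>, and induction on \<open>n\<close> applies; it starts with the commutative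
  algebra \<open>A_1\<close>. The Markov property holds because \<open>F(u_n)\<close> and \<open>F(1)\<close> are scalars.

  \<^bold>\<open>Why \<open>F\<close> maps \<open>A_(n+1)\<close> into \<open>A_n\<close>.\<close> Let \<open>H_n\<close> be the algebra generated by \<open>u_1, ..., u_(n-1)\<close>.
  The relations show that \<open>A_n\<close> is spanned by \<open>H_n e_(r) H_n\<close> for \<open>r \<le> n\<close> (\<open>A_subset_HeH\<close>), that
  \<open>H_(n+1) = H_n + H_n u_n H_n\<close> (\<open>H_double_coset_right\<close>), and, with the relations (c), that
  \<open>H_(n+1) e_(n+1) = H_n e_(n+1) + H_n u_n e_(n+1)\<close> (\<open>H_e_top\<close>). As \<open>F\<close> is \<open>A_n\<close>-bilinear, only
  \<open>F(1)\<close>, \<open>F(u_n)\<close>, \<open>F(u_n x u_n)\<close> with \<open>x \<in> A_n\<close> and \<open>F(u_n e_(n+1) u_n)\<close> remain (\<open>F_A_subset\<close>). They are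
  computed in \<open>F_1\<close>, \<open>F_u\<close>, \<open>F_u_mid\<close> and \<open>F_U2_\<epsilon>\<epsilon>_U2\<close>: \<open>F(u_n x u_n)\<close> is a multiple of \<open>x\<close> plus the partial
  trace of \<open>x\<close> over the \<open>n\<close>-th factor, and \<open>F(u_n e_(n+1) u_n)\<close> is a combination of \<open>e_(n)\<close> and \<open>e_(n-1)\<close>
  because \<open>\<alpha>_i\<^sup>4 D_i\<close> does not depend on \<open>i\<close>. All coefficients come out constant because multiplication by
  \<open>q\<close> shifts the geometric sequences \<open>\<alpha>_i\<^sup>2\<close> and \<open>D_i\<close> (\<open>sum_shift\<close>).

  \<^bold>\<open>Encoding.\<close> The algebraic part is done with operators instead of matrices. A multi-index is a
  function \<open>a :: nat \<Rightarrow> nat\<close>, of which the entry \<open>a t\<close> belongs to tensor factor \<open>t\<close>, and \<open>u_i\<close>, \<open>e_(r)\<close> act on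
  functions of multi-indices. The operators do not depend on \<open>n\<close>, so the inclusions \<open>C_n \<rightarrow> C_(n+1)\<close>
  become invisible, and they are elements of a type of class \<^class>\<open>ring_1\<close>. Functions that depend on the first
  \<open>n\<close> entries only form the \<open>n\<close>-th tensor power, which leads back to matrices and to \<open>\<Phi>\<close>.
\<close>

section \<open>Linear operators as a ring\<close>

text \<open>Endomorphisms form a type of class \<^class>\<open>ring_1\<close>, so that computations with operators are
  plain calculations in a noncommutative ring.\<close>

typedef (overloaded) ('i, 'a::comm_ring_1) lin_op =
  "{T :: ('i \<Rightarrow> 'a) \<Rightarrow> ('i \<Rightarrow> 'a).
      (\<forall>f g. T (\<lambda>x. f x + g x) = (\<lambda>x. T f x + T g x)) \<and>
      (\<forall>c f. T (\<lambda>x. c * f x) = (\<lambda>x. c * T f x))}"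
  morphisms app Lin_op
  by (rule exI[of _ "\<lambda>f. f"]) simp

setup_lifting type_definition_lin_op

lemma lin_op_eqI: "(\<And>f a. app S f a = app T f a) \<Longrightarrow> S = T"
  by (metis app_inject ext)

lemma app_add: "app T (\<lambda>x. f x + g x) a = app T f a + app T g a"
  using app[of T] by (simp add: fun_eq_iff)

lemma app_mult: "app T (\<lambda>x. c * f x) a = c * app T f a"
  using app[of T] by (simp add: fun_eq_iff)

lemma app_0: "app T (\<lambda>x. 0) a = 0"
  using app_mult[of T 0 "\<lambda>x. 0"] by simp

lemma app_sum: "app T (\<lambda>x. \<Sum>k\<in>K. f k x) a = (\<Sum>k\<in>K. app T (f k) a)"
  by (induction K rule: infinite_finite_induct) (simp_all add: app_0 app_add)

instantiation lin_op :: (type, comm_ring_1) ring_1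
begin

lift_definition zero_lin_op :: "('a, 'b) lin_op" is "\<lambda>f x. 0" by simp
lift_definition one_lin_op :: "('a, 'b) lin_op" is "\<lambda>f. f" by simp
lift_definition plus_lin_op :: "('a, 'b) lin_op \<Rightarrow> ('a, 'b) lin_op \<Rightarrow> ('a, 'b) lin_op"
  is "\<lambda>S T f x. S f x + T f x" by (simp add: algebra_simps)
lift_definition minus_lin_op :: "('a, 'b) lin_op \<Rightarrow> ('a, 'b) lin_op \<Rightarrow> ('a, 'b) lin_op"
  is "\<lambda>S T f x. S f x - T f x" by (simp add: algebra_simps)
lift_definition uminus_lin_op :: "('a, 'b) lin_op \<Rightarrow> ('a, 'b) lin_op"
  is "\<lambda>S f x. - S f x" by (simp add: algebra_simps)
lift_definition times_lin_op :: "('a, 'b) lin_op \<Rightarrow> ('a, 'b) lin_op \<Rightarrow> ('a, 'b) lin_op"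
  is "\<lambda>S T f. S (T f)" by simp

instance
proof
  show "(0::('a,'b) lin_op) \<noteq> 1"
  proof
    assume "(0::('a,'b) lin_op) = 1"
    then have "app (0::('a,'b) lin_op) (\<lambda>_. 1) = app 1 (\<lambda>_. 1)" by simp
    then show False by (simp add: zero_lin_op.rep_eq one_lin_op.rep_eq fun_eq_iff)
  qed
qed (transfer; simp add: algebra_simps fun_eq_iff)+

end

lift_definition scal :: "'a::comm_ring_1 \<Rightarrow> ('i, 'a) lin_op"
  is "\<lambda>c f x. c * f x" by (simp add: algebra_simps)

lemma app_simps:
  "app 0 f a = 0" "app 1 f a = f a" "app (S + T) f a = app S f a + app T f a"
  "app (S - T) f a = app S f a - app T f a" "app (- S) f a = - app S f a"
  "app (S * T) f a = app S (app T f) a" "app (scal c) f a = c * f a"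
  by (transfer; simp)+

lemma app_sum_op: "app (\<Sum>k\<in>K. T k) f a = (\<Sum>k\<in>K. app (T k) f a)"
  by (induction K rule: infinite_finite_induct) (simp_all add: app_simps)

lemma scal_commute: "T * scal c = scal c * T"
  by (rule lin_op_eqI)
     (use app_mult[of T c] in \<open>simp add: app_simps scal.rep_eq[abs_def]\<close>)

lemma scal_left_commute: "T * (scal c * S) = scal c * (T * S)"
  by (metis mult.assoc scal_commute)

lemma scal_hom:
  "scal (c + d) = scal c + scal d" "scal (c * d) = scal c * scal d"
  "scal 0 = 0" "scal 1 = 1" "scal (- c) = - scal c" "scal (c - d) = scal c - scal d"
  by (rule lin_op_eqI; simp add: app_simps algebra_simps)+

lemma scal_sum: "scal (\<Sum>k\<in>K. c k) = (\<Sum>k\<in>K. scal (c k))"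
  by (induction K rule: infinite_finite_induct) (simp_all add: scal_hom)

section \<open>Subalgebras and spans\<close>

text \<open>All scalars are among the generators, so these are unital subalgebras, and the additive closure
  of a set that absorbs scalars is its linear span.\<close>

inductive_set generated :: "('i, 'a::comm_ring_1) lin_op set \<Rightarrow> ('i, 'a) lin_op set" for G where
  scal: "scal c \<in> generated G"
| gen: "x \<in> G \<Longrightarrow> x \<in> generated G"
| add: "x \<in> generated G \<Longrightarrow> y \<in> generated G \<Longrightarrow> x + y \<in> generated G"
| mult: "x \<in> generated G \<Longrightarrow> y \<in> generated G \<Longrightarrow> x * y \<in> generated G"

inductive_set add_span :: "('i, 'a::comm_ring_1) lin_op set \<Rightarrow> ('i, 'a) lin_op set" for S where
  zero: "0 \<in> add_span S"
| incl: "x \<in> S \<Longrightarrow> x \<in> add_span S"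
| add: "x \<in> add_span S \<Longrightarrow> y \<in> add_span S \<Longrightarrow> x + y \<in> add_span S"

lemma generated_1: "1 \<in> generated G"
  using generated.scal[of 1 G] by (simp add: scal_hom)

lemma generated_diff: "x \<in> generated G \<Longrightarrow> y \<in> generated G \<Longrightarrow> x - y \<in> generated G"
  using generated.add[OF _ generated.mult[OF generated.scal[of "-1"]], of x G y]
  by (simp add: scal_hom)

lemma generated_subset:
  assumes "G \<subseteq> generated G'" shows "generated G \<subseteq> generated G'"
proof
  fix x assume "x \<in> generated G"
  then show "x \<in> generated G'"
    by induction (use assms in \<open>auto intro: generated.intros\<close>)
qed

lemma generated_mono: "G \<subseteq> G' \<Longrightarrow> generated G \<subseteq> generated G'"
  by (rule generated_subset) (auto intro: generated.gen)

lemma generated_commute: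
  assumes "x \<in> generated G" "\<And>g. g \<in> G \<Longrightarrow> y * g = g * y"
  shows "y * x = x * y"
  using assms(1)
proof induction
  case (mult a b)
  then show ?case by (metis mult.assoc)
qed (use assms(2) in \<open>auto simp: scal_commute algebra_simps\<close>)

lemma add_span_image:
  fixes f :: "('i, 'a::comm_ring_1) lin_op \<Rightarrow> ('i, 'a) lin_op"
  assumes "x \<in> add_span S" "\<And>x. x \<in> S \<Longrightarrow> f x \<in> T" "0 \<in> T"
    "\<And>x y. f (x + y) = f x + f y" "\<And>x y. x \<in> T \<Longrightarrow> y \<in> T \<Longrightarrow> x + y \<in> T"
  shows "f x \<in> T"
  using assms(1)
proof induction
  case zero
  have "f 0 = 0" using assms(4)[of 0 0] by simp
  then show ?case using assms(3) by simp
qed (use assms in auto)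

text \<open>A left ideal of the generated algebra that contains \<open>1\<close> is everything.\<close>

lemma generated_subset_if_left_closed:
  assumes one: "1 \<in> X" and add: "\<And>x y. x \<in> X \<Longrightarrow> y \<in> X \<Longrightarrow> x + y \<in> X"
    and scal: "\<And>c x. x \<in> X \<Longrightarrow> scal c * x \<in> X"
    and gen: "\<And>g x. g \<in> G \<Longrightarrow> x \<in> X \<Longrightarrow> g * x \<in> X"
  shows "generated G \<subseteq> X"
proof
  fix a assume "a \<in> generated G"
  then have "\<forall>x\<in>X. a * x \<in> X"
    by induction (auto simp: scal gen add mult.assoc distrib_right)
  then show "a \<in> X" using one by fastforce
qed

text \<open>The elements in which \<open>w\<close> occurs at most linearly between elements of \<open>B\<close>.\<close>

definition linear_in :: "('i, 'a::comm_ring_1) lin_op set \<Rightarrow> ('i, 'a) lin_op \<Rightarrow> ('i, 'a) lin_op set" where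
  "linear_in B w = add_span (B \<union> {x * w * y | x y. x \<in> B \<and> y \<in> B})"

lemma linear_in_intros:
  "x \<in> B \<Longrightarrow> x \<in> linear_in B w" "x \<in> B \<Longrightarrow> y \<in> B \<Longrightarrow> x * w * y \<in> linear_in B w"
  "x \<in> linear_in B w \<Longrightarrow> y \<in> linear_in B w \<Longrightarrow> x + y \<in> linear_in B w" "0 \<in> linear_in B w"
  unfolding linear_in_def by (blast intro: add_span.intros)+

lemma linear_in_image:
  fixes f :: "('i, 'a::comm_ring_1) lin_op \<Rightarrow> ('i, 'a) lin_op"
  assumes "x \<in> linear_in B w" "\<And>x. x \<in> B \<Longrightarrow> f x \<in> T"
    "\<And>x y. x \<in> B \<Longrightarrow> y \<in> B \<Longrightarrow> f (x * w * y) \<in> T" "0 \<in> T"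
    "\<And>x y. f (x + y) = f x + f y" "\<And>x y. x \<in> T \<Longrightarrow> y \<in> T \<Longrightarrow> x + y \<in> T"
  shows "f x \<in> T"
  using assms(1) unfolding linear_in_def
  by (rule add_span_image) (use assms(2-6) in auto)

text \<open>Once two occurrences of \<open>w\<close> can be merged, the elements linear in \<open>w\<close> form a left module over
  the larger algebra, and they contain \<open>1\<close>.\<close>

lemma generated_insert_subset:
  assumes merge: "\<And>y. y \<in> generated G \<Longrightarrow> w * y * w \<in> linear_in (generated G) w"
  shows "generated (insert w G) \<subseteq> linear_in (generated G) w"
proof (rule generated_subset_if_left_closed)
  let ?B = "generated G"
  show "1 \<in> linear_in ?B w" by (intro linear_in_intros generated_1)
  show "x + y \<in> linear_in ?B w" if "x \<in> linear_in ?B w" "y \<in> linear_in ?B w" for x y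
    using that by (rule linear_in_intros)
  have left: "b * x \<in> linear_in ?B w" if b: "b \<in> ?B" and x: "x \<in> linear_in ?B w" for b x
    using x
  proof (rule linear_in_image)
    fix x y assume xy: "x \<in> ?B" "y \<in> ?B"
    show "b * x \<in> linear_in ?B w" using b xy by (intro linear_in_intros generated.mult)
    have "(b * x) * w * y \<in> linear_in ?B w" using b xy by (intro linear_in_intros generated.mult)
    then show "b * (x * w * y) \<in> linear_in ?B w" by (simp add: mult.assoc)
  qed (auto intro: linear_in_intros simp: distrib_left)
  have right: "x * b \<in> linear_in ?B w" if b: "b \<in> ?B" and x: "x \<in> linear_in ?B w" for b x
    using x
  proof (rule linear_in_image[where f = "\<lambda>x. x * b"])
    fix x y assume xy: "x \<in> ?B" "y \<in> ?B"
    show "x * b \<in> linear_in ?B w" using b xy by (intro linear_in_intros generated.mult)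
    have "x * w * (y * b) \<in> linear_in ?B w" using b xy by (intro linear_in_intros generated.mult)
    then show "x * w * y * b \<in> linear_in ?B w" by (simp add: mult.assoc)
  qed (auto intro: linear_in_intros simp: distrib_right)
  show "scal c * x \<in> linear_in ?B w" if "x \<in> linear_in ?B w" for c x
    using that by (intro left generated.scal)
  show "g * x \<in> linear_in ?B w" if g: "g \<in> insert w G" and x: "x \<in> linear_in ?B w" for g x
  proof (cases "g = w")
    case False
    then show ?thesis using g x by (intro left generated.gen) auto
  next
    case True
    show ?thesis using x
    proof (rule linear_in_image)
      fix x y assume xy: "x \<in> ?B" "y \<in> ?B"
      have "1 * w * x \<in> linear_in ?B w" using xy by (intro linear_in_intros generated_1)
      then show "g * x \<in> linear_in ?B w" by (simp add: True)
      show "g * (x * w * y) \<in> linear_in ?B w"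
        using right[OF xy(2) merge[OF xy(1)]] by (simp add: True mult.assoc)
    qed (auto intro: linear_in_intros simp: distrib_left)
  qed
qed

text \<open>Two occurrences of the last generator \<open>v m\<close> can be merged: what stands between them either
  commutes with \<open>v m\<close>, so that the quadratic relation applies, or contains \<open>v (m - 1)\<close> once, by
  induction, so that the braid relation does.\<close>

lemma Hecke_double_coset:
  fixes v :: "nat \<Rightarrow> ('i, 'a::comm_ring_1) lin_op"
  assumes quad: "\<And>i. i \<le> m \<Longrightarrow> v i * v i = scal t * v i"
    and braid: "\<And>i. Suc i \<le> m \<Longrightarrow>
      v (Suc i) * v i * v (Suc i) = v i * v (Suc i) * v i - v i + v (Suc i)"
    and far: "\<And>i j. Suc i < j \<Longrightarrow> j \<le> m \<Longrightarrow> v j * v i = v i * v j"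
  shows "generated (v ` {..<Suc m}) \<subseteq> linear_in (generated (v ` {..<m})) (v m)"
proof -
  have square: "v m * y * v m \<in> linear_in B (v m)"
    if "v m * y = y * v m" "v m * v m = scal t * v m" "scal t * y \<in> B" "1 \<in> B" for B y m
  proof -
    have "v m * y * v m = (scal t * y) * v m * 1"
      using that(1,2) by (simp add: mult.assoc scal_left_commute)
    with that(3,4) show ?thesis by (metis linear_in_intros(2))
  qed
  show ?thesis
    unfolding lessThan_Suc image_insert using assms
  proof (induction m)
    case 0
    show ?case
    proof (rule generated_insert_subset, rule square)
      show "v 0 * y = y * v 0" if "y \<in> generated (v ` {..<0})" for y
        using that by (rule generated_commute) simp
    qed (use 0 in \<open>auto intro: generated.intros generated_1\<close>)
  next
    case (Suc m)
    let ?C = "generated (v ` {..<m})"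
    let ?B = "generated (v ` {..<Suc m})"
    let ?w = "v (Suc m)"
    have CB: "x \<in> ?B" if "x \<in> ?C" for x
      using that by (rule subsetD[OF generated_mono, rotated]) auto
    have com: "?w * z = z * ?w" if "z \<in> ?C" for z
      using that by (rule generated_commute) (use Suc.prems(3) in auto)
    show ?case
    proof (rule generated_insert_subset)
      fix y assume "y \<in> ?B"
      then have "y \<in> linear_in ?C (v m)"
        using Suc.IH Suc.prems unfolding lessThan_Suc image_insert by auto
      then show "?w * y * ?w \<in> linear_in ?B ?w"
      proof (rule linear_in_image[where f = "\<lambda>y. ?w * y * ?w"])
        fix a b assume ab: "a \<in> ?C" "b \<in> ?C"
        show "?w * a * ?w \<in> linear_in ?B ?w"
          by (rule square) (use com Suc.prems(1) ab in \<open>auto intro: CB generated.intros generated_1\<close>)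
        have "?w * (a * v m * b) * ?w = (?w * a) * v m * (b * ?w)"
          by (simp add: mult.assoc)
        also have "\<dots> = a * (?w * v m * ?w) * b"
          unfolding com[OF ab(1)] com[OF ab(2), symmetric] by (simp add: mult.assoc)
        also have "\<dots> = (a * v m) * ?w * (v m * b) + (a * ?w * b + scal (- 1) * a * v m * b)"
          unfolding Suc.prems(2)[OF le_refl] by (simp add: algebra_simps scal_hom)
        also have "\<dots> \<in> linear_in ?B ?w"
        proof -
          have "v m \<in> ?B" "a \<in> ?B" "b \<in> ?B" using ab by (auto intro: generated.gen CB)
          then show ?thesis by (intro linear_in_intros generated.mult generated.scal)
        qed
        finally show "?w * (a * v m * b) * ?w \<in> linear_in ?B ?w" .
      qed (auto intro: linear_in_intros simp: distrib_left distrib_right)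
    qed
  qed
qed

section \<open>Consequences of the relations of the algebras \<open>C_n\<close>\<close>

(* Sites and sizes are written with 1 and Suc side by side; 1 must not turn into Suc 0. *)
declare One_nat_def [simp del]

text \<open>The relations of all the algebras \<open>C_n\<close> at once, with \<open>t = q + 1/q\<close>. The Hecke relations are written
in the \<open>u_i = q - g_i\<close>.\<close>

locale C_tower =
  fixes u e :: "nat \<Rightarrow> ('i, 'a::comm_ring_1) lin_op" and t c :: 'a
  assumes quad: "1 \<le> i \<Longrightarrow> u i * u i = scal t * u i"
    and braid: "1 \<le> i \<Longrightarrow> u i * u (Suc i) * u i - u i = u (Suc i) * u i * u (Suc i) - u (Suc i)"
    and far: "1 \<le> i \<Longrightarrow> Suc i < j \<Longrightarrow> u i * u j = u j * u i"
    and e_0: "e 0 = 1"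
    and e_absorb: "r \<le> r' \<Longrightarrow> e r * e r' = e r'" "r \<le> r' \<Longrightarrow> e r' * e r = e r'"
    and e_commute: "r < i \<Longrightarrow> e r * u i = u i * e r"
    and e_Suc: "1 \<le> r \<Longrightarrow> e (Suc r) = e r * u r * e r - scal c * e r"
    and slide_left: "1 \<le> i \<Longrightarrow> Suc i < r \<Longrightarrow>
      (u i * u (Suc i) - u i) * e r = (u (Suc i) * u i - u (Suc i)) * e r"
    and slide_right: "1 \<le> i \<Longrightarrow> Suc i < r \<Longrightarrow>
      e r * (u (Suc i) * u i - u i) = e r * (u i * u (Suc i) - u (Suc i))"
begin

text \<open>The Hecke algebra on the tensor factors \<open>m, ..., n\<close>; it consists of scalars if \<open>m = n\<close>.\<close>

definition H :: "nat \<Rightarrow> nat \<Rightarrow> ('i, 'a) lin_op set" where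
  "H m n = generated (u ` {m..<n})"

definition A :: "nat \<Rightarrow> ('i, 'a) lin_op set" where
  "A n = generated (u ` {1..<n} \<union> e ` {1..n})"

lemma H_mono: "m' \<le> m \<Longrightarrow> n \<le> n' \<Longrightarrow> H m n \<subseteq> H m' n'"
  unfolding H_def by (rule generated_mono) auto

lemma H_subset_A: "H 1 n \<subseteq> A n"
  unfolding H_def A_def by (rule generated_mono) auto

lemma A_mono: "m \<le> n \<Longrightarrow> A m \<subseteq> A n"
  unfolding A_def by (rule generated_mono) auto

lemma A_intros:
  "scal x \<in> A n" "1 \<in> A n" "a \<in> A n \<Longrightarrow> b \<in> A n \<Longrightarrow> a + b \<in> A n"
  "a \<in> A n \<Longrightarrow> b \<in> A n \<Longrightarrow> a - b \<in> A n"
  "a \<in> A n \<Longrightarrow> b \<in> A n \<Longrightarrow> a * b \<in> A n" "1 \<le> i \<Longrightarrow> i < n \<Longrightarrow> u i \<in> A n" "r \<le> n \<Longrightarrow> e r \<in> A n"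
  unfolding A_def
proof -
  show "e r \<in> generated (u ` {1..<n} \<union> e ` {1..n})" if "r \<le> n"
    using that by (cases "r = 0") (auto simp: e_0 generated_1 intro: generated.gen)
qed (auto intro: generated.intros generated_1 generated_diff)

lemma H_intros:
  "scal x \<in> H m n" "1 \<in> H m n" "a \<in> H m n \<Longrightarrow> b \<in> H m n \<Longrightarrow> a + b \<in> H m n"
  "a \<in> H m n \<Longrightarrow> b \<in> H m n \<Longrightarrow> a - b \<in> H m n"
  "a \<in> H m n \<Longrightarrow> b \<in> H m n \<Longrightarrow> a * b \<in> H m n" "m \<le> i \<Longrightarrow> i < n \<Longrightarrow> u i \<in> H m n"
  unfolding H_def by (auto intro: generated.intros generated_1 generated_diff)

lemma H_trivial: "x \<in> H n n \<Longrightarrow> \<exists>c. x = scal c"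
  unfolding H_def
proof (induction rule: generated.induct)
  case (add x y)
  then show ?case by (metis scal_hom(1))
next
  case (mult x y)
  then show ?case by (metis scal_hom(2))
qed auto

lemma H_commute_e: "x \<in> H m n \<Longrightarrow> r < m \<Longrightarrow> e r * x = x * e r"
  unfolding H_def by (erule generated_commute) (auto simp: e_commute)

lemma H_commute_u: "x \<in> H 1 m \<Longrightarrow> m \<le> i \<Longrightarrow> 1 \<le> i \<Longrightarrow> u (Suc i) * x = x * u (Suc i)"
  unfolding H_def
  by (erule generated_commute) (use far[of _ "Suc i"] in auto)

lemma H_double_coset_right:
  assumes "1 \<le> n"
  shows "H 1 (Suc n) \<subseteq> linear_in (H 1 n) (u n)"
proof -
  define m where "m = n - 1"
  have n: "n = Suc m" using assms by (simp add: m_def)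
  define v where "v = (\<lambda>i. u (Suc i))"
  have img: "v ` {..<k} = u ` {1..<Suc k}" for k
  proof -
    have "{1..<Suc k} = Suc ` {..<k}" by (simp add: lessThan_atLeast0 One_nat_def)
    then show ?thesis by (simp add: v_def image_image)
  qed
  have "generated (v ` {..<Suc m}) \<subseteq> linear_in (generated (v ` {..<m})) (v m)"
  proof (rule Hecke_double_coset)
    show "v i * v i = scal t * v i" for i by (simp add: v_def quad)
    show "v (Suc i) * v i * v (Suc i) = v i * v (Suc i) * v i - v i + v (Suc i)" for i
      using braid[of "Suc i"] by (simp add: v_def)
    show "v j * v i = v i * v j" if "Suc i < j" for i j
      using that far[of "Suc i" "Suc j"] by (simp add: v_def)
  qed
  then show ?thesis unfolding img H_def n by (simp add: v_def)
qed

text \<open>The left-hand counterpart is the same statement for the generators in reverse order. It is used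
to peel off \<open>u m\<close>, because \<open>e m\<close> commutes with the remaining algebra \<open>H (Suc m) n\<close>.\<close>

lemma H_double_coset_left:
  assumes "1 \<le> m" "m < n"
  shows "H m n \<subseteq> linear_in (H (Suc m) n) (u m)"
proof -
  define l where "l = n - 1 - m"
  define v where "v = (\<lambda>i. u (n - 1 - i))"
  have img: "v ` {..<k} = u ` {n - k..<n}" if "k \<le> n" for k
  proof -
    have "{n - k..<n} \<subseteq> (\<lambda>i. n - 1 - i) ` {..<k}"
    proof
      fix i assume "i \<in> {n - k..<n}"
      then show "i \<in> (\<lambda>i. n - 1 - i) ` {..<k}"
        using that by (intro image_eqI[of _ _ "n - 1 - i"]) auto
    qed
    then have "{n - k..<n} = (\<lambda>i. n - 1 - i) ` {..<k}" using that by auto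
    then show ?thesis by (auto simp: v_def image_image)
  qed
  have "generated (v ` {..<Suc l}) \<subseteq> linear_in (generated (v ` {..<l})) (v l)"
  proof (rule Hecke_double_coset)
    show "v i * v i = scal t * v i" if "i \<le> l" for i
      unfolding v_def by (rule quad) (use that assms in \<open>auto simp: l_def\<close>)
    show "v (Suc i) * v i * v (Suc i) = v i * v (Suc i) * v i - v i + v (Suc i)" if "Suc i \<le> l" for i
    proof -
      have "n - 1 - i = Suc (n - 1 - Suc i)" using that assms by (auto simp: l_def)
      then show ?thesis using braid[of "n - 1 - Suc i"] that assms
        by (simp add: v_def l_def algebra_simps)
    qed
    show "v j * v i = v i * v j" if "Suc i < j" "j \<le> l" for i j
      unfolding v_def by (rule far) (use that assms in \<open>auto simp: l_def\<close>)
  qed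
  moreover have "l \<le> n" "Suc l \<le> n" "n - Suc l = m" "n - l = Suc m" "v l = u m"
    using assms by (auto simp: l_def v_def)
  ultimately show ?thesis unfolding H_def by (simp add: img)
qed

definition HeH :: "nat \<Rightarrow> ('i, 'a) lin_op set" where
  "HeH n = add_span {x * e r * y | x r y. x \<in> H 1 n \<and> y \<in> H 1 n \<and> r \<le> n}"

lemma HeH_incl: "x \<in> H 1 n \<Longrightarrow> y \<in> H 1 n \<Longrightarrow> r \<le> n \<Longrightarrow> x * e r * y \<in> HeH n"
  unfolding HeH_def by (blast intro: add_span.incl)

lemma HeH_add: "x \<in> HeH n \<Longrightarrow> y \<in> HeH n \<Longrightarrow> x + y \<in> HeH n"
  unfolding HeH_def by (rule add_span.add)

lemma HeH_0: "0 \<in> HeH n"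
  unfolding HeH_def by (rule add_span.zero)

lemma HeH_image:
  fixes f :: "('i, 'a) lin_op \<Rightarrow> ('i, 'a) lin_op"
  assumes "x \<in> HeH n" "\<And>x y. f (x + y) = f x + f y"
    "\<And>a b r. a \<in> H 1 n \<Longrightarrow> b \<in> H 1 n \<Longrightarrow> r \<le> n \<Longrightarrow> f (a * e r * b) \<in> T"
    "0 \<in> T" "\<And>x y. x \<in> T \<Longrightarrow> y \<in> T \<Longrightarrow> x + y \<in> T"
  shows "f x \<in> T"
  using assms(1) unfolding HeH_def
  by (rule add_span_image) (use assms(2-5) in auto)

lemma HeH_left: "z \<in> H 1 n \<Longrightarrow> x \<in> HeH n \<Longrightarrow> z * x \<in> HeH n"
proof (erule HeH_image)
  fix a b r assume *: "z \<in> H 1 n" "a \<in> H 1 n" "b \<in> H 1 n" "r \<le> n"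
  then have "(z * a) * e r * b \<in> HeH n" by (intro HeH_incl H_intros)
  then show "z * (a * e r * b) \<in> HeH n" by (simp add: mult.assoc)
qed (auto simp: distrib_left HeH_0 intro: HeH_add)

lemma HeH_right: "z \<in> H 1 n \<Longrightarrow> x \<in> HeH n \<Longrightarrow> x * z \<in> HeH n"
proof (erule HeH_image[where f = "\<lambda>x. x * z"])
  fix a b r assume *: "z \<in> H 1 n" "a \<in> H 1 n" "b \<in> H 1 n" "r \<le> n"
  then have "a * e r * (b * z) \<in> HeH n" by (intro HeH_incl H_intros)
  then show "a * e r * b * z \<in> HeH n" by (simp add: mult.assoc)
qed (auto simp: distrib_right HeH_0 intro: HeH_add)

lemma HeH_scal: "x \<in> HeH n \<Longrightarrow> scal a * x \<in> HeH n"
  by (intro HeH_left H_intros)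

lemma HeH_1: "1 \<in> HeH n"
  using HeH_incl[of 1 n 1 0] H_intros by (simp add: e_0)

text \<open>An occurrence of \<open>u i\<close> in \<open>b\<close> is flanked by two copies of \<open>e i\<close>, one of them split off from \<open>e r\<close>, and
\<open>e i * u i * e i = e (Suc i) + c e i\<close>. Hence either \<open>e i\<close> is absorbed into \<open>e r\<close>, or \<open>i\<close> increases. The
latter ends at \<open>i = n\<close>, where \<open>b\<close> is a scalar, or at \<open>i = Suc r\<close>, where \<open>e (Suc r)\<close> absorbs \<open>e r\<close> instead.\<close>

lemma e_H_e:
  assumes "1 \<le> i" "i \<le> Suc r" "i \<le> n" "r \<le> n" "b \<in> H i n"
  shows "e i * b * e r \<in> HeH n"
  using assms
proof (induction "Suc r - i" arbitrary: i b)
  case 0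
  then have i: "i = Suc r" by simp
  have "e i * b * e r = e i * (e r * b)"
    using H_commute_e[OF 0(6), of r] i by (simp add: mult.assoc)
  also have "\<dots> = 1 * e i * b" by (simp add: i mult.assoc[symmetric] e_absorb)
  also have "\<dots> \<in> HeH n" using 0 H_mono[of 1 i n n] by (intro HeH_incl H_intros) auto
  finally show ?case .
next
  case (Suc d)
  then have ir: "i \<le> r" by simp
  show ?case
  proof (cases "i = n")
    case True
    then obtain x where x: "b = scal x" using H_trivial Suc.prems by blast
    have "e i * b * e r = scal x * e r * 1"
      using ir by (simp add: x mult.assoc scal_left_commute e_absorb)
    also have "\<dots> \<in> HeH n" using Suc.prems by (intro HeH_incl H_intros) auto
    finally show ?thesis .
  next
    case False
    then have "b \<in> linear_in (H (Suc i) n) (u i)"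
      using H_double_coset_left[of i n] Suc.prems by auto
    then show ?thesis
    proof (rule linear_in_image[where f = "\<lambda>b. e i * b * e r"])
      fix x y assume xy: "x \<in> H (Suc i) n" "y \<in> H (Suc i) n"
      show "e i * x * e r \<in> HeH n"
      proof -
        have "e i * x * e r = x * e r * 1"
          using H_commute_e[OF xy(1), of i] ir by (simp add: mult.assoc e_absorb)
        also have "\<dots> \<in> HeH n"
          using xy H_mono[of 1 "Suc i" n n] Suc.prems by (intro HeH_incl H_intros) auto
        finally show ?thesis .
      qed
      show "e i * (x * u i * y) * e r \<in> HeH n"
      proof -
        have xH: "x \<in> H 1 n" and yH: "y \<in> H 1 n" using xy H_mono[of 1 "Suc i" n n] by auto
        have "e i * (x * u i * y) * e r = (e i * x) * u i * y * (e i * e r)"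
          using ir by (simp add: mult.assoc e_absorb)
        also have "\<dots> = x * e i * u i * (y * e i) * e r"
          using H_commute_e[OF xy(1), of i] by (simp add: mult.assoc)
        also have "\<dots> = x * (e i * u i * e i) * y * e r"
          using H_commute_e[OF xy(2), of i] by (simp add: mult.assoc)
        also have "e i * u i * e i = e (Suc i) + scal c * e i"
          using e_Suc[of i] Suc.prems by simp
        also have "x * (e (Suc i) + scal c * e i) * y * e r
            = x * (e (Suc i) * y * e r) + x * (scal c * (e i * y * e r))"
          by (simp add: algebra_simps)
        also have "e i * y * e r = y * (e i * e r)"
          using H_commute_e[OF xy(2), of i] by (simp add: mult.assoc)
        also have "\<dots> = y * e r * 1" using ir by (simp add: e_absorb)
        also have "x * (e (Suc i) * y * e r) + x * (scal c * (y * e r * 1)) \<in> HeH n"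
        proof (intro HeH_add HeH_left[OF xH] HeH_scal)
          show "e (Suc i) * y * e r \<in> HeH n"
            by (rule Suc.hyps) (use Suc ir False xy in auto)
          show "y * e r * 1 \<in> HeH n" using Suc.prems yH by (intro HeH_incl H_intros) auto
        qed
        finally show ?thesis .
      qed
    qed (auto intro: HeH_add HeH_0 simp: algebra_simps)
  qed
qed

lemma e_HeH: "1 \<le> r \<Longrightarrow> r \<le> n \<Longrightarrow> x \<in> HeH n \<Longrightarrow> e r * x \<in> HeH n"
proof (induction r arbitrary: x)
  case (Suc r)
  show ?case
  proof (cases "r = 0")
    case True
    from Suc.prems(3) have "e 1 * x \<in> HeH n"
    proof (rule HeH_image)
      fix a b r assume ab: "a \<in> H 1 n" "b \<in> H 1 n" "r \<le> n"
      have "e 1 * a * e r \<in> HeH n" by (rule e_H_e) (use ab Suc.prems in auto)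
      then have "(e 1 * a * e r) * b \<in> HeH n" using ab(2) by (rule HeH_right[rotated])
      then show "e 1 * (a * e r * b) \<in> HeH n" by (simp add: mult.assoc)
    qed (auto intro: HeH_add HeH_0 simp: distrib_left)
    with True show ?thesis by (simp add: One_nat_def)
  next
    case False
    have "e (Suc r) * x = e r * (u r * (e r * x)) + scal (- c) * (e r * x)"
      by (subst e_Suc) (use False in \<open>simp_all add: algebra_simps scal_hom\<close>)
    also have "\<dots> \<in> HeH n"
      using False Suc.prems by (intro HeH_add HeH_scal Suc.IH HeH_left H_intros) auto
    finally show ?thesis .
  qed
qed simp

text \<open>By the preceding lemma, left multiplication by the idempotents does not lead out of the span.\<close>

theorem A_subset_HeH: "A n \<subseteq> HeH n"
  unfolding A_def
proof (rule generated_subset_if_left_closed)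
  show "g * x \<in> HeH n" if "g \<in> u ` {1..<n} \<union> e ` {1..n}" "x \<in> HeH n" for g x
    using that(1)
  proof
    assume "g \<in> u ` {1..<n}"
    then have "g \<in> H 1 n" by (auto intro: H_intros)
    then show ?thesis using that(2) by (rule HeH_left)
  next
    assume "g \<in> e ` {1..n}"
    then show ?thesis using that(2) by (auto intro: e_HeH)
  qed
qed (auto intro: HeH_1 HeH_add HeH_scal)

text \<open>When \<open>e r\<close> stands to the right of \<open>u n * u (n - 1)\<close>, the slide relation exchanges the two
  factors up to shorter terms. So \<open>u n\<close> can be moved next to \<open>e r\<close>, and everything else to its left lies
  in the smaller Hecke algebra; likewise on the other side of \<open>e r\<close>.\<close>

lemma H_e_top:
  assumes "1 \<le> n" "n < r" "x \<in> H 1 (Suc n)"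
  shows "x * e r \<in> add_span {a * g * e r | a g. a \<in> H 1 n \<and> g \<in> {1, u n}}"
    and "e r * x \<in> add_span {e r * g * a | a g. a \<in> H 1 n \<and> g \<in> {1, u n}}"
proof -
  define L where "L n = add_span {a * g * e r | a g. a \<in> H 1 n \<and> g \<in> {1, u n}}" for n
  define R where "R n = add_span {e r * g * a | a g. a \<in> H 1 n \<and> g \<in> {1, u n}}" for n
  have L_add: "x \<in> L n \<Longrightarrow> y \<in> L n \<Longrightarrow> x + y \<in> L n" "0 \<in> L n"
    and R_add: "x \<in> R n \<Longrightarrow> y \<in> R n \<Longrightarrow> x + y \<in> R n" "0 \<in> R n" for x y n
    by (auto simp: L_def R_def intro: add_span.intros)
  have L_incl: "a * g * e r \<in> L n" and R_incl: "e r * g * a \<in> R n"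
    if "a \<in> H 1 n" "g \<in> {1, u n}" for a g n
    unfolding L_def R_def using that by (blast intro: add_span.incl)+
  have left: "z * y \<in> L n" if z: "z \<in> H 1 n" and "y \<in> L n" for z y n
    using that(2)[unfolded L_def]
  proof (rule add_span_image)
    fix y assume "y \<in> {a * g * e r | a g. a \<in> H 1 n \<and> g \<in> {1, u n}}"
    then obtain a g where y: "y = a * g * e r" "a \<in> H 1 n" "g \<in> {1, u n}" by blast
    then have "(z * a) * g * e r \<in> L n" using z by (intro L_incl H_intros)
    then show "z * y \<in> L n" by (simp add: y mult.assoc)
  qed (auto intro: L_add simp: distrib_left)
  have right: "y * z \<in> R n" if z: "z \<in> H 1 n" and "y \<in> R n" for z y n
    using that(2)[unfolded R_def]
  proof (rule add_span_image[where f = "\<lambda>y. y * z"])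
    fix y assume "y \<in> {e r * g * a | a g. a \<in> H 1 n \<and> g \<in> {1, u n}}"
    then obtain a g where y: "y = e r * g * a" "a \<in> H 1 n" "g \<in> {1, u n}" by blast
    then have "e r * g * (a * z) \<in> R n" using z by (intro R_incl H_intros)
    then show "y * z \<in> R n" by (simp add: y mult.assoc)
  qed (auto intro: R_add simp: distrib_right)
  have finish: "x * e r \<in> L n \<and> e r * x \<in> R n"
    if n: "1 \<le> n" and x: "x \<in> H 1 (Suc n)"
      and L: "\<And>z. z \<in> H 1 n \<Longrightarrow> u n * (z * e r) \<in> L n"
      and R: "\<And>z. z \<in> H 1 n \<Longrightarrow> e r * z * u n \<in> R n" for n x
  proof
    have x: "x \<in> linear_in (H 1 n) (u n)" using H_double_coset_right[OF n] x by auto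
    show "x * e r \<in> L n"
      using x
    proof (rule linear_in_image[where f = "\<lambda>x. x * e r"])
      fix a b assume ab: "a \<in> H 1 n" "b \<in> H 1 n"
      show "a * e r \<in> L n" using L_incl[OF ab(1), of 1] by simp
      show "a * u n * b * e r \<in> L n" using left[OF ab(1) L[OF ab(2)]] by (simp add: mult.assoc)
    qed (auto intro: L_add simp: distrib_right)
    show "e r * x \<in> R n"
      using x
    proof (rule linear_in_image)
      fix a b assume ab: "a \<in> H 1 n" "b \<in> H 1 n"
      show "e r * a \<in> R n" using R_incl[OF ab(1), of 1] by simp
      show "e r * (a * u n * b) \<in> R n" using right[OF ab(2) R[OF ab(1)]] by (simp add: mult.assoc)
    qed (auto intro: R_add simp: distrib_left)
  qed
  have "x * e r \<in> L n \<and> e r * x \<in> R n"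
    using assms
  proof (induction n arbitrary: x rule: dec_induct)
    case base
    show ?case
    proof (rule finish)
      fix z assume "z \<in> H 1 1"
      then obtain l where z: "z = scal l" using H_trivial by blast
      have "scal l * u 1 * e r \<in> L 1" "e r * u 1 * scal l \<in> R 1"
        by (auto intro!: L_incl R_incl H_intros)
      then show "u 1 * (z * e r) \<in> L 1" "e r * z * u 1 \<in> R 1"
        by (simp_all add: z mult.assoc scal_left_commute[of "u 1"] scal_commute[of "u 1"])
    qed (use base in auto)
  next
    case (step n)
    let ?n = "Suc n"
    have sub: "a \<in> H 1 ?n" if "a \<in> H 1 n" for a using that H_mono[of 1 1 n ?n] by auto
    have u: "u n \<in> H 1 ?n" using step by (intro H_intros) auto
    have com: "u ?n * a = a * u ?n" if "a \<in> H 1 n" for a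
      by (rule H_commute_u[OF that]) (use step in auto)
    show ?case
    proof (rule finish)
      fix z assume z: "z \<in> H 1 ?n"
      have IH: "z * e r \<in> L n" "e r * z \<in> R n"
        using step.IH[OF _ z] step.prems by auto
      show "u ?n * (z * e r) \<in> L ?n"
        using IH(1)[unfolded L_def]
      proof (rule add_span_image)
        fix y assume "y \<in> {a * g * e r | a g. a \<in> H 1 n \<and> g \<in> {1, u n}}"
        then obtain a g where y: "y = a * g * e r" "a \<in> H 1 n" "g \<in> {1, u n}" by blast
        have "u ?n * y = a * (u ?n * g * e r)"
          using com[OF y(2)] by (simp add: y(1) mult.assoc[symmetric])
        moreover have "u ?n * g * e r \<in> L ?n"
        proof (cases "g = 1")
          case True
          then show ?thesis using L_incl[OF H_intros(2), of "u ?n"] by simp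
        next
          case False
          then have "u ?n * g * e r = (scal (- 1) * u n) * 1 * e r + (1 * u ?n * e r + u n * u ?n * e r)"
            using slide_left[of n r] step y(3) by (simp add: algebra_simps scal_hom)
          also have "\<dots> \<in> L ?n" using u step by (intro L_add L_incl H_intros) auto
          finally show ?thesis .
        qed
        then have "a * (u ?n * g * e r) \<in> L ?n" by (rule left[OF sub[OF y(2)]])
        ultimately show "u ?n * y \<in> L ?n" by simp
      qed (auto intro: L_add simp: distrib_left)
      show "e r * z * u ?n \<in> R ?n"
        using IH(2)[unfolded R_def]
      proof (rule add_span_image[where f = "\<lambda>y. y * u ?n"])
        fix y assume "y \<in> {e r * g * a | a g. a \<in> H 1 n \<and> g \<in> {1, u n}}"
        then obtain a g where y: "y = e r * g * a" "a \<in> H 1 n" "g \<in> {1, u n}" by blast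
        have "y * u ?n = e r * g * u ?n * a" using com[OF y(2)] by (simp add: y(1) mult.assoc)
        moreover have "e r * g * u ?n \<in> R ?n"
        proof (cases "g = 1")
          case True
          then show ?thesis using R_incl[OF H_intros(2), of "u ?n"] by simp
        next
          case False
          then have "e r * g * u ?n = e r * 1 * (scal (- 1) * u n) + (e r * u ?n * 1 + e r * u ?n * u n)"
            using slide_right[of n r] step y(3) by (simp add: algebra_simps scal_hom)
          also have "\<dots> \<in> R ?n" using u step by (intro R_add R_incl H_intros) auto
          finally show ?thesis .
        qed
        then have "e r * g * u ?n * a \<in> R ?n" by (rule right[OF sub[OF y(2)]])
        ultimately show "y * u ?n \<in> R ?n" by simp
      qed (auto intro: R_add simp: distrib_right)
    qed (use step in auto)
  qed
  then show "x * e r \<in> add_span {a * g * e r | a g. a \<in> H 1 n \<and> g \<in> {1, u n}}"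
    "e r * x \<in> add_span {e r * g * a | a g. a \<in> H 1 n \<and> g \<in> {1, u n}}"
    unfolding L_def R_def by auto
qed

end

section \<open>Conditional expectations and the trace property\<close>

text \<open>\<open>F (Suc n)\<close> has the properties of a partial trace over tensor factor \<open>Suc n\<close>. The idempotent \<open>\<pi>\<close> takes
the place of the unit, since the partial trace of the unit is a multiple of the projection onto
those multi-indices that label basis vectors.\<close>

locale C_tower_expectation = C_tower u e t c
  for u e :: "nat \<Rightarrow> ('i, 'a::comm_ring_1) lin_op" and t c :: 'a +
  fixes F :: "nat \<Rightarrow> ('i, 'a) lin_op \<Rightarrow> ('i, 'a) lin_op" and \<pi> :: "('i, 'a) lin_op"
    and d0 d1 d2 a1 a2 f1 :: 'a
  assumes F_add: "F n (x + y) = F n x + F n y"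
    and F_left: "z \<in> A n \<Longrightarrow> F (Suc n) (z * x) = z * F (Suc n) x"
    and F_right: "z \<in> A n \<Longrightarrow> F (Suc n) (x * z) = F (Suc n) x * z"
    and F_1: "F (Suc n) 1 = scal d0 * \<pi>"
    and F_u: "1 \<le> n \<Longrightarrow> F (Suc n) (u n) = scal d1 * \<pi>"
    and F_u_u: "1 \<le> n \<Longrightarrow> x \<in> A n \<Longrightarrow>
      F (Suc n) (u n * x * u n) = scal d2 * (x * \<pi>) + F n x"
    and F_u_e_u: "1 \<le> n \<Longrightarrow>
      F (Suc n) (u n * e (Suc n) * u n) = (scal a1 * e n + scal a2 * e (n - 1)) * \<pi>"
    and F_e1: "F 1 (e 1) = scal f1 * \<pi>"
    and \<pi>_commute: "x \<in> A n \<Longrightarrow> \<pi> * x = x * \<pi>"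
begin

definition A\<pi> :: "nat \<Rightarrow> ('i, 'a) lin_op set" where
  "A\<pi> n = (\<lambda>x. x * \<pi>) ` A n"

lemma A\<pi>_intros:
  "x \<in> A n \<Longrightarrow> x * \<pi> \<in> A\<pi> n" "scal k * \<pi> \<in> A\<pi> n"
  "x \<in> A\<pi> n \<Longrightarrow> y \<in> A\<pi> n \<Longrightarrow> x + y \<in> A\<pi> n"
  unfolding A\<pi>_def
  by (auto simp: distrib_right[symmetric] intro!: imageI A_intros)

lemma A\<pi>_left: "z \<in> A n \<Longrightarrow> x \<in> A\<pi> n \<Longrightarrow> z * x \<in> A\<pi> n"
  unfolding A\<pi>_def by (auto simp: mult.assoc[symmetric] intro!: imageI A_intros)

lemma A\<pi>_right: "z \<in> A n \<Longrightarrow> x \<in> A\<pi> n \<Longrightarrow> x * z \<in> A\<pi> n"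
  unfolding A\<pi>_def
proof (elim imageE)
  fix y assume z: "z \<in> A n" and y: "y \<in> A n" "x = y * \<pi>"
  have "x * z = (y * z) * \<pi>" using \<pi>_commute[OF z] by (simp add: y mult.assoc)
  then show "x * z \<in> (\<lambda>x. x * \<pi>) ` A n" using A_intros(5)[OF y(1) z] by blast
qed

lemma A\<pi>_0: "0 \<in> A\<pi> n"
  using A\<pi>_intros(2)[of 0] by (simp add: scal_hom)

text \<open>In the span of the \<open>a * e r * b\<close> with \<open>a\<close>, \<open>b\<close> in the Hecke algebra, at most one \<open>u n\<close> survives on either
side of the middle factor: by the double cosets if \<open>r \<le> n\<close>, and by the slide relations if
\<open>r = Suc n\<close>. The rest of \<open>a\<close> and \<open>b\<close> passes through \<open>F\<close>.\<close>

lemma F_A_subset: "x \<in> A (Suc n) \<Longrightarrow> F (Suc n) x \<in> A\<pi> n"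
proof (induction n arbitrary: x)
  case 0
  have "x \<in> HeH 1" using 0 A_subset_HeH[of 1] by (auto simp: One_nat_def)
  then have "F 1 x \<in> A\<pi> 0"
  proof (rule HeH_image)
    fix a b r assume ab: "a \<in> H 1 1" "b \<in> H 1 1" and r: "r \<le> (1::nat)"
    obtain k l where kl: "a = scal k" "b = scal l" using ab H_trivial by blast
    have "F 1 (a * e r * b) = scal k * F 1 (e r) * scal l"
      using F_left[of "scal k" 0 "e r * scal l"] F_right[of "scal l" 0 "e r"]
      by (simp add: kl mult.assoc A_intros(1) One_nat_def)
    also have "\<dots> \<in> A\<pi> 0"
    proof (rule A\<pi>_right[OF A_intros(1) A\<pi>_left[OF A_intros(1)]])
      show "F 1 (e r) \<in> A\<pi> 0"
      proof (cases "r = 0")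
        case True
        then show ?thesis using F_1[of 0] by (simp add: e_0 A\<pi>_intros One_nat_def)
      next
        case False
        with r have "r = 1" by simp
        then show ?thesis by (simp add: F_e1 A\<pi>_intros)
      qed
    qed
    finally show "F 1 (a * e r * b) \<in> A\<pi> 0" .
  qed (auto simp: F_add A\<pi>_0 intro: A\<pi>_intros)
  then show ?case by (simp add: One_nat_def)
next
  case (Suc m)
  define n where "n = Suc m"
  have n: "1 \<le> n" by (simp add: n_def)
  have IH: "F n x \<in> A\<pi> n" if "x \<in> A n" for x
    using Suc.IH[of x] that A_mono[of m n] unfolding n_def A\<pi>_def by auto
  note HA = subsetD[OF H_subset_A, of _ n]
  let ?G = "{1, u n}"
  have bimod: "F (Suc n) (x * y * z) \<in> A\<pi> n"
    if "F (Suc n) y \<in> A\<pi> n" "x \<in> A n" "z \<in> A n" for x y z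
    by (simp add: F_right F_left that A\<pi>_left A\<pi>_right)
  \<comment> \<open>At most one \<open>u n\<close> on either side of an element of the smaller algebra.\<close>
  have GG: "F (Suc n) (g * y * g') \<in> A\<pi> n" if g: "g \<in> ?G" "g' \<in> ?G" and y: "y \<in> A n" for g g' y
  proof -
    have "F (Suc n) 1 \<in> A\<pi> n" "F (Suc n) (u n) \<in> A\<pi> n"
      using n by (simp_all add: F_1 F_u A\<pi>_intros)
    from this[THEN bimod, OF _ A_intros(2)] this[THEN bimod, OF A_intros(2)] y
    have "F (Suc n) y \<in> A\<pi> n" "F (Suc n) (u n * y) \<in> A\<pi> n" "F (Suc n) (y * u n) \<in> A\<pi> n"
      by (force simp: A_intros)+
    moreover have "F (Suc n) (u n * y * u n) \<in> A\<pi> n"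
      unfolding F_u_u[OF n y] by (intro A\<pi>_intros(3) A\<pi>_left A_intros A\<pi>_intros IH y)
    ultimately show ?thesis using g by auto
  qed
  have low: "F (Suc n) (a * y * b) \<in> A\<pi> n"
    if a: "a \<in> H 1 (Suc n)" and b: "b \<in> H 1 (Suc n)" and y: "y \<in> A n" for a b y
  proof -
    have D: "x \<in> linear_in (H 1 n) (u n)" if "x \<in> H 1 (Suc n)" for x
      using H_double_coset_right[OF n] that by blast
    have base: "F (Suc n) ((x * g * x') * y * (z * g' * z')) \<in> A\<pi> n"
      if "x \<in> H 1 n" "x' \<in> H 1 n" "z \<in> H 1 n" "z' \<in> H 1 n" "g \<in> ?G" "g' \<in> ?G" for x x' z z' g g'
    proof -
      have "F (Suc n) (x * (g * (x' * y * z) * g') * z') \<in> A\<pi> n"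
        by (rule bimod[OF GG[OF that(5,6)] HA[OF that(1)] HA[OF that(4)]])
           (intro A_intros HA that y)
      then show ?thesis by (simp add: mult.assoc)
    qed
    have one: "1 \<in> H 1 n" by (rule H_intros)
    show ?thesis
      using D[OF a]
    proof (rule linear_in_image[where f = "\<lambda>a. F (Suc n) (a * y * b)"])
      fix x x' assume x: "x \<in> H 1 n" "x' \<in> H 1 n"
      show "F (Suc n) (x * y * b) \<in> A\<pi> n"
        using D[OF b]
      proof (rule linear_in_image[where f = "\<lambda>b. F (Suc n) (x * y * b)"])
        fix z z' assume z: "z \<in> H 1 n" "z' \<in> H 1 n"
        show "F (Suc n) (x * y * z) \<in> A\<pi> n" using base[OF x(1) one z(1) one, of 1 1] by simp
        show "F (Suc n) (x * y * (z * u n * z')) \<in> A\<pi> n" using base[OF x(1) one z, of 1 "u n"] by simp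
      qed (auto simp: F_add distrib_left A\<pi>_0 intro: A\<pi>_intros)
      show "F (Suc n) (x * u n * x' * y * b) \<in> A\<pi> n"
        using D[OF b]
      proof (rule linear_in_image[where f = "\<lambda>b. F (Suc n) (x * u n * x' * y * b)"])
        fix z z' assume z: "z \<in> H 1 n" "z' \<in> H 1 n"
        show "F (Suc n) (x * u n * x' * y * z) \<in> A\<pi> n" using base[OF x z(1) one, of "u n" 1] by simp
        show "F (Suc n) (x * u n * x' * y * (z * u n * z')) \<in> A\<pi> n"
          using base[OF x z, of "u n" "u n"] by simp
      qed (auto simp: F_add distrib_left A\<pi>_0 intro: A\<pi>_intros)
    qed (auto simp: F_add distrib_right A\<pi>_0 intro: A\<pi>_intros)
  qed
  \<comment> \<open>The same around \<open>e (Suc n)\<close>. With a \<open>u n\<close> on at most one side, the recursion for \<open>e (Suc n)\<close>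
    reduces to the smaller algebra; \<open>u n\<close> on both sides is the case that needs its own formula.\<close>
  have topG: "F (Suc n) (g * e (Suc n) * g') \<in> A\<pi> n" if g: "g \<in> ?G" "g' \<in> ?G" for g g'
  proof -
    have en: "e n \<in> A n" by (intro A_intros) auto
    have u: "u n \<in> ?G" and one: "1 \<in> ?G" by auto
    have rec: "e (Suc n) = e n * u n * e n + scal (- c) * e n" using e_Suc[OF n] by (simp add: scal_hom)
    have F_scal: "F (Suc n) (scal l * x) = scal l * F (Suc n) x" for l x by (rule F_left) (rule A_intros)
    consider "g = 1" | "g' = 1" | "g = u n" "g' = u n" using g by auto
    then show ?thesis
    proof cases
      case 1
      have "F (Suc n) (e n * (u n * e n * g') * 1) \<in> A\<pi> n" "F (Suc n) (1 * e n * g') \<in> A\<pi> n"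
        by (rule bimod[OF GG[OF u g(2) en] en A_intros(2)], rule GG[OF one g(2) en])
      then show ?thesis
        by (simp add: 1 rec distrib_right F_add mult.assoc F_scal A\<pi>_intros(3) A\<pi>_left A_intros(1))
    next
      case 2
      have "F (Suc n) (1 * (g * e n * u n) * e n) \<in> A\<pi> n" "F (Suc n) (g * e n * 1) \<in> A\<pi> n"
        by (rule bimod[OF GG[OF g(1) u en] A_intros(2) en], rule GG[OF g(1) one en])
      then show ?thesis
        by (simp add: 2 rec distrib_left F_add mult.assoc scal_left_commute[of g] F_scal
            A\<pi>_intros(3) A\<pi>_left A_intros(1))
    next
      case 3
      show ?thesis unfolding 3 F_u_e_u[OF n] by (intro A\<pi>_intros A_intros) auto
    qed
  qed
  have top: "F (Suc n) (a * e (Suc n) * b) \<in> A\<pi> n"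
    if a: "a \<in> H 1 (Suc n)" and b: "b \<in> H 1 (Suc n)" for a b
  proof -
    have "F (Suc n) (a * e (Suc n) * (e (Suc n) * b)) \<in> A\<pi> n"
      using H_e_top(1)[OF n lessI a]
    proof (rule add_span_image[where f = "\<lambda>x. F (Suc n) (x * (e (Suc n) * b))"])
      fix x assume "x \<in> {a * g * e (Suc n) | a g. a \<in> H 1 n \<and> g \<in> ?G}"
      then obtain a' g where x: "x = a' * g * e (Suc n)" "a' \<in> H 1 n" "g \<in> ?G" by blast
      show "F (Suc n) (x * (e (Suc n) * b)) \<in> A\<pi> n"
        using H_e_top(2)[OF n lessI b]
      proof (rule add_span_image[where f = "\<lambda>y. F (Suc n) (x * y)"])
        fix y assume "y \<in> {e (Suc n) * g * a | a g. a \<in> H 1 n \<and> g \<in> ?G}"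
        then obtain b' g' where y: "y = e (Suc n) * g' * b'" "b' \<in> H 1 n" "g' \<in> ?G" by blast
        have "x * y = a' * g * (e (Suc n) * e (Suc n)) * g' * b'" by (simp add: x y mult.assoc)
        also have "\<dots> = a' * (g * e (Suc n) * g') * b'" by (simp add: e_absorb mult.assoc)
        finally show "F (Suc n) (x * y) \<in> A\<pi> n"
          using bimod[OF topG[OF x(3) y(3)] HA[OF x(2)] HA[OF y(2)]] by simp
      qed (auto simp: F_add distrib_left A\<pi>_0 intro: A\<pi>_intros)
    qed (auto simp: F_add distrib_right A\<pi>_0 intro: A\<pi>_intros)
    moreover have "a * e (Suc n) * (e (Suc n) * b) = a * e (Suc n) * b"
      by (metis mult.assoc e_absorb(1) order_refl)
    ultimately show ?thesis by simp
  qed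
  have "x \<in> HeH (Suc n)" using Suc.prems A_subset_HeH by (auto simp: n_def)
  then have "F (Suc n) x \<in> A\<pi> n"
  proof (rule HeH_image)
    fix a b r assume ab: "a \<in> H 1 (Suc n)" "b \<in> H 1 (Suc n)" "r \<le> Suc n"
    show "F (Suc n) (a * e r * b) \<in> A\<pi> n"
    proof (cases "r = Suc n")
      case True
      then show ?thesis using top ab by simp
    next
      case False
      then show ?thesis using ab by (intro low A_intros) auto
    qed
  qed (auto simp: F_add A\<pi>_0 intro: A\<pi>_intros)
  then show ?case by (simp add: n_def)
qed

end

locale C_tower_trace = C_tower_expectation +
  fixes Tr :: "nat \<Rightarrow> ('a, 'b) lin_op \<Rightarrow> 'b"
  assumes Tr_Suc: "Tr (Suc n) x = Tr n (F (Suc n) x)"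
    and Tr_add: "Tr n (x + y) = Tr n x + Tr n y"
    and Tr_scal: "Tr n (scal k * x) = k * Tr n x"
    and Tr_\<pi>: "Tr n (x * \<pi>) = Tr n x"
    and Tr_u: "1 \<le> i \<Longrightarrow> i < n \<Longrightarrow> Tr n (u i * x) = Tr n (x * u i)"
begin

lemma Tr_diff: "Tr n (x - y) = Tr n x - Tr n y"
  using Tr_add[of n "x - y" y] by (simp add: algebra_simps)

text \<open>An element \<open>z\<close> of the smaller algebra can be moved around \<open>y\<close> because \<open>F (z * y) = z * F y\<close> and
\<open>F (y * z) = F y * z\<close>, where \<open>F y\<close> lies in the smaller algebra too. The \<open>u i\<close> are covered by
hypothesis, and the remaining generator \<open>e (Suc m)\<close> is a polynomial in \<open>e m\<close> and \<open>u m\<close>.\<close>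

theorem trace_property:
  assumes "x \<in> A n" "y \<in> A n"
  shows "Tr n (x * y) = Tr n (y * x)"
  using assms
proof (induction n arbitrary: x y)
  case 0
  then have "x * y = y * x"
    unfolding A_def by (intro generated_commute[of y "{}" x]) auto
  then show ?case by simp
next
  case (Suc m)
  have e: "Tr (Suc m) (e r * y) = Tr (Suc m) (y * e r)" if "r \<le> Suc m" "y \<in> A (Suc m)" for r y
  proof (cases "m = 0")
    case True
    have ee: "y' * e r = e r * y'" if "y' = e 0 \<or> y' = e 1" for y'
      using that \<open>r \<le> Suc m\<close> True e_absorb[of 0 1] by (cases r) (auto simp: e_0 One_nat_def)
    have "e r * y = y * e r"
      using that(2) unfolding A_def
      by (rule generated_commute) (use True ee in \<open>auto simp: One_nat_def\<close>)
    then show ?thesis by simp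
  next
    case False
    have low: "Tr (Suc m) (z * y) = Tr (Suc m) (y * z)" if "z \<in> A m" "y \<in> A (Suc m)" for z y
    proof -
      obtain y' where y': "y' \<in> A m" "F (Suc m) y = y' * \<pi>"
        using F_A_subset[OF \<open>y \<in> A (Suc m)\<close>] by (auto simp: A\<pi>_def)
      have "Tr (Suc m) (z * y) = Tr m ((z * y') * \<pi>)"
        by (simp add: Tr_Suc F_left that y' mult.assoc)
      also have "\<dots> = Tr m (y' * z)" unfolding Tr_\<pi> using Suc.IH that y' by blast
      also have "\<dots> = Tr m (y' * z * \<pi>)" by (simp add: Tr_\<pi>)
      also have "\<dots> = Tr m (y' * (\<pi> * z))"
        unfolding \<pi>_commute[OF that(1)] by (simp add: mult.assoc)
      also have "\<dots> = Tr (Suc m) (y * z)"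
        by (simp add: Tr_Suc F_right that y' mult.assoc)
      finally show ?thesis .
    qed
    show ?thesis
    proof (cases "r = Suc m")
      case False
      then show ?thesis using that by (intro low A_intros) auto
    next
      case True
      have em: "e m \<in> A m" "e m \<in> A (Suc m)" "u m \<in> A (Suc m)"
        using False by (auto intro: A_intros)
      have "Tr (Suc m) (e m * u m * e m * y) = Tr (Suc m) (u m * (e m * y) * e m)"
        using low[OF em(1), of "u m * (e m * y)"] em that by (simp add: mult.assoc A_intros)
      also have "\<dots> = Tr (Suc m) (e m * y * e m * u m)"
        using Tr_u[of m "Suc m" "e m * y * e m"] False by (simp add: mult.assoc)
      also have "\<dots> = Tr (Suc m) (y * (e m * u m * e m))"
        using low[OF em(1), of "y * e m * u m"] em that by (simp add: mult.assoc A_intros)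
      finally have 1: "Tr (Suc m) (e m * u m * e m * y) = Tr (Suc m) (y * (e m * u m * e m))" .
      have 2: "Tr (Suc m) (scal c * e m * y) = Tr (Suc m) (y * (scal c * e m))"
        using low[OF em(1) that(2)] by (simp add: mult.assoc scal_left_commute[of y] Tr_scal)
      have "1 \<le> m" using False by simp
      then show ?thesis unfolding True e_Suc[OF \<open>1 \<le> m\<close>] left_diff_distrib right_diff_distrib Tr_diff 1 2 by simp
    qed
  qed
  have "x \<in> A (Suc m) \<and> (\<forall>y\<in>A (Suc m). Tr (Suc m) (x * y) = Tr (Suc m) (y * x))"
    if "x \<in> generated (u ` {1..<Suc m} \<union> e ` {1..Suc m})" for x
    using that
  proof induction
    case (scal k)
    then show ?case by (simp add: scal_commute A_intros)
  next
    case (gen x)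
    then show ?case using e by (auto intro: A_intros Tr_u)
  next
    case (add x z)
    then show ?case by (simp add: A_intros distrib_left distrib_right Tr_add)
  next
    case (mult x z)
    show ?case
    proof (intro conjI ballI)
      show "x * z \<in> A (Suc m)" using mult by (simp add: A_intros)
      fix y assume y: "y \<in> A (Suc m)"
      have "Tr (Suc m) (x * (z * y)) = Tr (Suc m) (z * (y * x))"
        using mult y A_intros(5) by (simp add: mult.assoc)
      also have "\<dots> = Tr (Suc m) (y * x * z)" using mult y A_intros(5) by simp
      finally show "Tr (Suc m) (x * z * y) = Tr (Suc m) (y * (x * z))" by (simp add: mult.assoc)
    qed
  qed
  then show ?case using Suc.prems by (simp add: A_def)
qed

end

section \<open>Operators on multi-indices\<close>

text \<open>A multi-index labels a basis vector of the infinite tensor power if its entries are less than the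
dimension \<open>N\<close>. Entries, and the indices of \<open>\<alpha>\<close> and \<open>D\<close> below, start at \<open>0\<close>, tensor factors at \<open>1\<close>.\<close>

definition valid :: "nat \<Rightarrow> (nat \<Rightarrow> nat) \<Rightarrow> bool" where
  "valid N a \<longleftrightarrow> (\<forall>t. a t < N)"

lemma valid_upd: "valid N a \<Longrightarrow> x < N \<Longrightarrow> valid N (a(t := x))"
  by (simp add: valid_def)

lemma valid_less: "valid N a \<Longrightarrow> a t < N"
  by (simp add: valid_def)

lift_definition valid_op :: "nat \<Rightarrow> (nat \<Rightarrow> nat, 'a::comm_ring_1) lin_op"
  is "\<lambda>N f a. if valid N a then f a else 0" by (simp add: fun_eq_iff)

text \<open>The matrix unit with entry \<open>1\<close> at \<open>(i, j)\<close>, acting on tensor factor \<open>t\<close>. It is cut off at multi-indices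
that are not valid; thus the sum of the diagonal units is the same operator \<open>valid_op\<close> for every \<open>t\<close>.\<close>

lift_definition munit :: "nat \<Rightarrow> nat \<Rightarrow> nat \<Rightarrow> nat \<Rightarrow> (nat \<Rightarrow> nat, 'a::comm_ring_1) lin_op"
  is "\<lambda>N t i j f a. if valid N a \<and> a t = i then f (a(t := j)) else 0" by (simp add: fun_eq_iff)

lemmas app_munit = munit.rep_eq
lemmas app_valid_op = valid_op.rep_eq

lemma sum_delta2:
  fixes g :: "nat \<Rightarrow> nat \<Rightarrow> 'a::comm_monoid_add"
  assumes "x < N" "y < N"
  shows "(\<Sum>i<N. \<Sum>j<N. if i = x \<and> j = y then g i j else 0) = g x y"
proof -
  have "(\<Sum>i<N. \<Sum>j<N. if i = x \<and> j = y then g i j else 0)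
      = (\<Sum>i<N. if i = x then (\<Sum>j<N. if j = y then g i j else 0) else 0)"
    by (intro sum.cong) auto
  then show ?thesis using assms by simp
qed

lemma sum_rotate:
  fixes f :: "'i \<Rightarrow> 'j \<Rightarrow> 'k \<Rightarrow> 'a::comm_monoid_add"
  shows "(\<Sum>x\<in>X. \<Sum>y\<in>Y. \<Sum>z\<in>Z. f x y z) = (\<Sum>z\<in>Z. \<Sum>x\<in>X. \<Sum>y\<in>Y. f x y z)"
proof -
  have "(\<Sum>x\<in>X. \<Sum>y\<in>Y. \<Sum>z\<in>Z. f x y z) = (\<Sum>x\<in>X. \<Sum>z\<in>Z. \<Sum>y\<in>Y. f x y z)"
    by (intro sum.cong refl sum.swap)
  also have "\<dots> = (\<Sum>z\<in>Z. \<Sum>x\<in>X. \<Sum>y\<in>Y. f x y z)" by (rule sum.swap)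
  finally show ?thesis .
qed

lemma munit_commute:
  "t \<noteq> t' \<Longrightarrow> j < N \<Longrightarrow> l < N \<Longrightarrow> munit N t i j * munit N t' k l = munit N t' k l * munit N t i j"
  by (rule lin_op_eqI) (auto simp: app_simps app_munit valid_upd fun_upd_twist)

lemma munit_mult:
  "j < N \<Longrightarrow> munit N t i j * munit N t k l = (if j = k then munit N t i l else 0)"
  by (rule lin_op_eqI) (auto simp: app_simps app_munit valid_upd)

lemma munit_sum: "(\<Sum>i<N. munit N t i i) = valid_op N"
  by (rule lin_op_eqI)
     (auto simp: app_sum_op app_munit app_valid_op fun_upd_idem valid_less
        if_distrib[of "\<lambda>b. b \<and> _"] cong: if_cong conj_cong)

lemma munit_valid_op: "j < N \<Longrightarrow> munit N t i j * valid_op N = munit N t i j"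
  "valid_op N * munit N t i j = munit N t i j"
  by (rule lin_op_eqI; auto simp: app_simps app_munit app_valid_op valid_upd)+

lemma valid_op_idem: "valid_op N * valid_op N = valid_op N"
  by (rule lin_op_eqI; auto simp: app_simps app_valid_op)

text \<open>The vector \<open>\<alpha>\<close> is normalised by the sum in the last hypothesis, which is \<open>q^k + ... + q^(-k)\<close>
with \<open>q = s\<^sup>2\<close>.\<close>

locale N_state =
  fixes s w :: "'a::field" and k N :: nat
  assumes N: "N = 2 * k + 1" and k_pos: "1 \<le> k" and s_0: "s \<noteq> 0" and w_0: "w \<noteq> 0"
    and w_sq: "w\<^sup>2 = (\<Sum>i<N. s powi (2 * int k - 2 * int i))"
begin

abbreviation E :: "nat \<Rightarrow> nat \<Rightarrow> nat \<Rightarrow> (nat \<Rightarrow> nat, 'a) lin_op" where "E \<equiv> munit N"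

definition \<alpha> :: "nat \<Rightarrow> 'a" where "\<alpha> i = s powi (int k - int i) / w"
definition d :: "nat \<Rightarrow> nat \<Rightarrow> 'a" where "d i j = (if i < j then inverse (s\<^sup>2) else s\<^sup>2)"
definition D :: "nat \<Rightarrow> 'a" where "D i = s powi (4 * int i - 4 * int k)"

text \<open>The operator \<open>U\<close> on the tensor factors \<open>p\<close> and \<open>q\<close>.\<close>

definition U2 :: "nat \<Rightarrow> nat \<Rightarrow> (nat \<Rightarrow> nat, 'a) lin_op" where
  "U2 p q = (\<Sum>i<N. \<Sum>j<N. if i = j then 0
     else scal (d i j) * E p i i * E q j j + E p i j * E q j i)"

text \<open>The orthogonal projection onto the line of \<open>\<alpha>\<close>, acting on tensor factor \<open>t\<close>; \<open>E\<close> now denotes matrix units.\<close>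

definition \<epsilon> :: "nat \<Rightarrow> (nat \<Rightarrow> nat, 'a) lin_op" where
  "\<epsilon> t = (\<Sum>i<N. \<Sum>j<N. scal (\<alpha> i * \<alpha> j) * E t i j)"

definition u :: "nat \<Rightarrow> (nat \<Rightarrow> nat, 'a) lin_op" where "u t = U2 t (Suc t)"

fun e :: "nat \<Rightarrow> (nat \<Rightarrow> nat, 'a) lin_op" where
  "e 0 = 1" | "e (Suc r) = e r * \<epsilon> (Suc r)"

lemma app_U2:
  assumes "p \<noteq> q"
  shows "app (U2 p q) f a = (if valid N a \<and> a p \<noteq> a q
    then d (a p) (a q) * f a + f (a(p := a q, q := a p)) else 0)"
proof (cases "valid N a")
  case True
  have "app (U2 p q) f a = (\<Sum>i<N. \<Sum>j<N. if i = a p \<and> j = a q then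
      (if i = j then 0 else d i j * f a + f (a(p := j, q := i))) else 0)"
    unfolding U2_def app_sum_op
    by (intro sum.cong refl)
       (use True assms in \<open>auto simp: app_simps app_munit valid_upd fun_upd_idem\<close>)
  also have "\<dots> = (if a p = a q then 0 else d (a p) (a q) * f a + f (a(p := a q, q := a p)))"
    using True by (intro sum_delta2) (auto simp: valid_less)
  finally show ?thesis using True by simp
next
  case False
  then show ?thesis by (auto simp: U2_def app_sum_op app_simps app_munit intro!: sum.neutral)
qed

lemma app_\<epsilon>:
  "app (\<epsilon> t) f a = (if valid N a then \<alpha> (a t) * (\<Sum>j<N. \<alpha> j * f (a(t := j))) else 0)"
proof (cases "valid N a")
  case True
  have "app (\<epsilon> t) f a = (\<Sum>i<N. if i = a t then \<Sum>j<N. \<alpha> i * \<alpha> j * f (a(t := j)) else 0)"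
    unfolding \<epsilon>_def app_sum_op
    by (intro sum.cong refl) (use True in \<open>auto simp: app_simps app_munit\<close>)
  also have "\<dots> = (\<Sum>j<N. \<alpha> (a t) * \<alpha> j * f (a(t := j)))"
    using True by (simp add: valid_less)
  finally show ?thesis using True by (simp add: sum_distrib_left mult.assoc)
next
  case False
  then show ?thesis by (auto simp: \<epsilon>_def app_sum_op app_simps app_munit intro!: sum.neutral)
qed

lemma commute_U2:
  assumes "\<And>i j. i < N \<Longrightarrow> j < N \<Longrightarrow> x * E p i j = E p i j * x"
    "\<And>i j. i < N \<Longrightarrow> j < N \<Longrightarrow> x * E q i j = E q i j * x"
  shows "x * U2 p q = U2 p q * x"
proof -
  have "x * E p i j * E q i' j' = E p i j * E q i' j' * x"
    if "i < N" "j < N" "i' < N" "j' < N" for i j i' j'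
    by (simp add: assms(1)[OF that(1,2)] mult.assoc assms(2)[OF that(3,4)])
  then show ?thesis
    unfolding U2_def sum_distrib_left sum_distrib_right
    by (intro sum.cong refl)
       (simp add: distrib_left distrib_right mult.assoc scal_left_commute[of x])
qed

lemma commute_\<epsilon>:
  assumes "\<And>i j. i < N \<Longrightarrow> j < N \<Longrightarrow> x * E p i j = E p i j * x"
  shows "x * \<epsilon> p = \<epsilon> p * x"
  unfolding \<epsilon>_def sum_distrib_left sum_distrib_right
  by (intro sum.cong refl) (auto simp: assms mult.assoc scal_left_commute[of x])

lemma E_U2: "t \<noteq> p \<Longrightarrow> t \<noteq> q \<Longrightarrow> j < N \<Longrightarrow> E t i j * U2 p q = U2 p q * E t i j"
  by (intro commute_U2 munit_commute) auto

lemma E_\<epsilon>: "t \<noteq> p \<Longrightarrow> j < N \<Longrightarrow> E t i j * \<epsilon> p = \<epsilon> p * E t i j"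
  by (intro commute_\<epsilon> munit_commute) auto

lemma U2_U2: "p \<noteq> p' \<Longrightarrow> p \<noteq> q' \<Longrightarrow> q \<noteq> p' \<Longrightarrow> q \<noteq> q' \<Longrightarrow> U2 p q * U2 p' q' = U2 p' q' * U2 p q"
  by (intro commute_U2 E_U2[symmetric]) auto

lemma \<epsilon>_U2: "t \<noteq> p \<Longrightarrow> t \<noteq> q \<Longrightarrow> \<epsilon> t * U2 p q = U2 p q * \<epsilon> t"
  by (intro commute_U2 E_\<epsilon>[symmetric]) auto

lemma \<epsilon>_\<epsilon>: "\<epsilon> t * \<epsilon> t' = \<epsilon> t' * \<epsilon> t"
  by (cases "t = t'") (auto intro!: commute_\<epsilon> E_\<epsilon>[symmetric])

section \<open>Sums of powers of the parameter\<close>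

lemma q_cancel: "x * inverse (s\<^sup>2) * s\<^sup>2 = x" "x * s\<^sup>2 * inverse (s\<^sup>2) = x"
  using s_0 by simp_all

lemma s_powi: "s powi m * s powi n = s powi (m + n)"
  using s_0 by (simp add: power_int_add)

lemma powi_add_2: "s powi (m + 2) = s powi m * s\<^sup>2"
  using s_0 by (simp add: power_int_add)

lemma powi_add_4: "s powi (m + 4) = s powi m * s\<^sup>2 * s\<^sup>2"
  using powi_add_2[of m] powi_add_2[of "m + 2"] by (simp add: add.assoc)

text \<open>The arguments of \<open>h\<close> on the left are the numbers \<open>1, ..., N - 2\<close>, each once: those below \<open>i\<close> move up and
those above \<open>j\<close> move down, which closes the gaps at \<open>i\<close> and \<open>j\<close>. All the coefficients below are
independent of the indices for this reason, as factors \<open>d\<close> shift the geometric sequences \<open>D\<close> and \<open>\<alpha>\<^sup>2\<close>.\<close>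

lemma sum_shift:
  fixes h :: "nat \<Rightarrow> 'a"
  assumes "i < j" "j < N"
  shows "(\<Sum>b<N. if b = i \<or> b = j then 0
     else if b < i then h (Suc b) else if b < j then h b else h (b - 1)) = (\<Sum>b=1..<N-1. h b)"
proof -
  have "(\<Sum>b<N. if b = i \<or> b = j then 0
     else if b < i then h (Suc b) else if b < j then h b else h (b - 1)) =
   (\<Sum>b\<in>{..<N} - {i, j}. if b < i then h (Suc b) else if b < j then h b else h (b - 1))"
    by (rule sum.mono_neutral_cong_right) auto
  also have "\<dots> = (\<Sum>b=1..<N-1. h b)"
    by (rule sum.reindex_bij_witness[of _ "\<lambda>c. if c \<le> i then c - 1 else if c < j then c else Suc c"
          "\<lambda>b. if b < i then Suc b else if b < j then b else b - 1"])
       (use assms in \<open>auto simp: One_nat_def\<close>)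
  finally show ?thesis .
qed

text \<open>With a single gap, the numbers \<open>1, ..., N - 2\<close> are all hit, and \<open>i\<close> a second time, from its
neighbour \<open>j\<close>.\<close>

lemma sum_shift_diag:
  fixes h :: "nat \<Rightarrow> 'a"
  assumes "i < N"
  shows "(\<Sum>b<N. if b = i then 0 else if b < i then h (Suc b) else h (b - 1)) =
    (\<Sum>b=1..<N-1. h b) + h i"
proof -
  \<comment> \<open>The neighbour whose argument on the left-hand side is \<open>i\<close>.\<close>
  define j where "j = (if i = 0 then 1 else i - 1)"
  have j: "j \<noteq> i" "j < N" "(if j < i then h (Suc j) else h (j - 1)) = h i"
    using assms N k_pos by (auto simp: j_def)
  have "(\<Sum>b<N. if b = i then 0 else if b < i then h (Suc b) else h (b - 1)) =
    (\<Sum>b<N. (if b = i \<or> b = j then 0 else if b < i then h (Suc b) else h (b - 1)) +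
       (if b = j then h i else 0))"
    by (rule sum.cong) (use j in \<open>auto split: if_splits\<close>)
  also have "\<dots> = (\<Sum>b<N. if b = i \<or> b = j then 0 else if b < i then h (Suc b) else h (b - 1)) + h i"
    using j by (simp add: sum.distrib)
  also have "(\<Sum>b<N. if b = i \<or> b = j then 0 else if b < i then h (Suc b) else h (b - 1)) =
    (\<Sum>b<N. if b = min i j \<or> b = max i j then 0
     else if b < min i j then h (Suc b) else if b < max i j then h b else h (b - 1))"
    by (rule sum.cong) (auto simp: j_def min_def max_def)
  also have "\<dots> = (\<Sum>b=1..<N-1. h b)"
    using j assms by (intro sum_shift) auto
  finally show ?thesis .
qed

lemma sum_shift_half:
  fixes h :: "nat \<Rightarrow> 'a"
  assumes "i < N"
  shows "(\<Sum>b<N. if b = i then 0 else if b < i then h (Suc b) else h b) = (\<Sum>b=1..<N. h b)"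
proof -
  have "(\<Sum>b<N. if b = i then 0 else if b < i then h (Suc b) else h b) =
    (\<Sum>b\<in>{..<N} - {i}. if b < i then h (Suc b) else h b)"
    by (rule sum.mono_neutral_cong_right) auto
  also have "\<dots> = (\<Sum>b=1..<N. h b)"
    by (rule sum.reindex_bij_witness[of _ "\<lambda>c. if c \<le> i then c - 1 else c"
          "\<lambda>b. if b < i then Suc b else b"])
       (use assms in auto)
  finally show ?thesis .
qed

lemma \<alpha>_sq: "\<alpha> i * \<alpha> i = s powi (2 * int k - 2 * int i) / w\<^sup>2"
  by (simp add: \<alpha>_def s_powi power2_eq_square)

lemma \<alpha>_sq_Suc: "\<alpha> (Suc b) * \<alpha> (Suc b) = \<alpha> b * \<alpha> b * inverse (s\<^sup>2)"
proof -
  have "s powi (2 * int k - 2 * int b) = s powi (2 * int k - 2 * int (Suc b) + 2)"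
    by (simp add: algebra_simps)
  then show ?thesis unfolding \<alpha>_sq powi_add_2 using s_0 by (simp add: divide_simps)
qed

lemma D_Suc: "D (Suc b) = D b * s\<^sup>2 * s\<^sup>2"
proof -
  have "D (Suc b) = s powi (4 * int b - 4 * int k + 4)"
    unfolding D_def by (rule arg_cong[of _ _ "\<lambda>m. s powi m"]) simp
  then show ?thesis unfolding powi_add_4 by (simp add: D_def)
qed

lemma \<alpha>_sq_pred: "0 < b \<Longrightarrow> \<alpha> (b - 1) * \<alpha> (b - 1) = \<alpha> b * \<alpha> b * s\<^sup>2"
  using \<alpha>_sq_Suc[of "b - 1"] s_0 by (simp add: One_nat_def field_simps)

lemma D_pred: "0 < b \<Longrightarrow> D (b - 1) = D b * inverse (s\<^sup>2) * inverse (s\<^sup>2)"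
  using D_Suc[of "b - 1"] s_0 by (simp add: One_nat_def field_simps)

lemma sum_\<alpha>_sq: "(\<Sum>i<N. \<alpha> i * \<alpha> i) = 1"
  using w_0 by (simp add: \<alpha>_sq sum_divide_distrib[symmetric] w_sq[symmetric])

definition c where "c = (\<Sum>i=1..<N-1. \<alpha> i * \<alpha> i)"

lemma sum_\<alpha>_d:
  assumes "y < N"
  shows "(\<Sum>j<N. if j = y then 0 else \<alpha> j * \<alpha> j * d j y) = c + \<alpha> y * \<alpha> y"
proof -
  have "(\<Sum>j<N. if j = y then 0 else \<alpha> j * \<alpha> j * d j y) =
    (\<Sum>b<N. if b = y then 0 else if b < y then \<alpha> (Suc b) * \<alpha> (Suc b) else \<alpha> (b - 1) * \<alpha> (b - 1))"
    by (rule sum.cong) (auto simp: \<alpha>_sq_Suc \<alpha>_sq_pred d_def not_less_iff_gr_or_eq)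
  then show ?thesis using sum_shift_diag[OF assms, of "\<lambda>b. \<alpha> b * \<alpha> b"] by (simp add: c_def)
qed

definition d1 where "d1 = (\<Sum>b=1..<N. D b * inverse (s\<^sup>2))"
definition d2 where "d2 = (\<Sum>b=1..<N-1. D b)"

lemma sum_D_d:
  assumes "i < N"
  shows "(\<Sum>b<N. if b = i then 0 else D b * d i b) = d1"
proof -
  have "(\<Sum>b<N. if b = i then 0 else D b * d i b) =
    (\<Sum>b<N. if b = i then 0 else if b < i then D (Suc b) * inverse (s\<^sup>2) else D b * inverse (s\<^sup>2))"
    by (rule sum.cong) (use s_0 in \<open>auto simp: D_Suc d_def field_simps\<close>)
  then show ?thesis using sum_shift_half[OF assms, of "\<lambda>b. D b * inverse (s\<^sup>2)"]
    by (simp add: d1_def)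
qed

lemma sum_D_d_d:
  assumes "i < N" "j < N"
  shows "(\<Sum>b<N. if b = i \<or> b = j then 0 else D b * d i b * d j b) = d2 + (if i = j then D i else 0)"
proof -
  have *: "(\<Sum>b<N. if b = i \<or> b = j then 0 else D b * d i b * d j b) = d2"
    if "i < j" "j < N" for i j
  proof -
    have "(\<Sum>b<N. if b = i \<or> b = j then 0 else D b * d i b * d j b) =
      (\<Sum>b<N. if b = i \<or> b = j then 0 else if b < i then D (Suc b) else if b < j then D b else D (b - 1))"
      by (rule sum.cong)
         (use that in \<open>auto simp: D_Suc D_pred d_def q_cancel not_less_iff_gr_or_eq\<close>)
    then show ?thesis using sum_shift[OF that, of D] by (simp add: d2_def)
  qed
  have "(\<Sum>b<N. if b = i \<or> b = j then 0 else D b * d i b * d j b) = d2 + D i" if "i = j"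
  proof -
    have "(\<Sum>b<N. if b = i \<or> b = j then 0 else D b * d i b * d j b) =
      (\<Sum>b<N. if b = i then 0 else if b < i then D (Suc b) else D (b - 1))"
      by (rule sum.cong)
         (use that in \<open>auto simp: D_Suc D_pred d_def q_cancel not_less_iff_gr_or_eq\<close>)
    then show ?thesis using sum_shift_diag[OF assms(1), of D] by (simp add: d2_def)
  qed
  moreover have "(\<Sum>b<N. if b = i \<or> b = j then 0 else D b * d i b * d j b) = d2" if "j < i"
  proof -
    have "(\<Sum>b<N. if b = i \<or> b = j then 0 else D b * d i b * d j b) =
      (\<Sum>b<N. if b = j \<or> b = i then 0 else D b * d j b * d i b)"
      by (rule sum.cong) auto
    then show ?thesis using *[OF that assms(1)] by simp
  qed
  ultimately show ?thesis using *[of i j] assms by (cases i j rule: linorder_cases) auto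
qed

end

context N_state begin

section \<open>The relations hold for the operators\<close>

lemma lin_op_eqI2:
  assumes "\<And>f a. \<not> valid N a \<Longrightarrow> app S f a = app T f a"
    "\<And>f a x y. valid N a \<Longrightarrow> x < N \<Longrightarrow> y < N \<Longrightarrow>
       app S f (a(p := x, q := y)) = app T f (a(p := x, q := y))"
  shows "S = T"
proof (rule lin_op_eqI)
  fix f a
  show "app S f a = app T f a"
    using assms(1)[of a f] assms(2)[of a "a p" "a q" f] by (cases "valid N a") (auto simp: valid_less)
qed

lemma lin_op_eqI3:
  assumes "\<And>f a. \<not> valid N a \<Longrightarrow> app S f a = app T f a"
    "\<And>f a x y z. valid N a \<Longrightarrow> x < N \<Longrightarrow> y < N \<Longrightarrow> z < N \<Longrightarrow>
       app S f (a(p := x, q := y, r := z)) = app T f (a(p := x, q := y, r := z))"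
  shows "S = T"
proof (rule lin_op_eqI)
  fix f a
  show "app S f a = app T f a"
    using assms(1)[of a f] assms(2)[of a "a p" "a q" "a r" f] by (cases "valid N a") (auto simp: valid_less)
qed

text \<open>The action of \<open>U\<close> on coordinates: on functions of the two entries that it involves.\<close>

definition U_fun :: "(nat \<Rightarrow> nat \<Rightarrow> 'a) \<Rightarrow> nat \<Rightarrow> nat \<Rightarrow> 'a" where
  "U_fun g x y = (if x = y then 0 else d x y * g x y + g y x)"

lemma app_U2_invalid: "\<not> valid N a \<Longrightarrow> p \<noteq> q \<Longrightarrow> app (U2 p q) f a = 0"
  by (simp add: app_U2)

lemma app_\<epsilon>_invalid: "\<not> valid N a \<Longrightarrow> app (\<epsilon> t) f a = 0"
  by (simp add: app_\<epsilon>)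

lemma app_U2_upd:
  assumes "p \<noteq> q" "valid N a" "x < N" "y < N"
  shows "app (U2 p q) f (a(p := x, q := y)) = U_fun (\<lambda>x y. f (a(p := x, q := y))) x y"
proof -
  have "a(p := x, q := y, p := y, q := x) = a(p := y, q := x)" using assms by auto
  then show ?thesis using assms by (simp add: app_U2 U_fun_def valid_upd)
qed

lemma app_U2_upd3:
  assumes "p \<noteq> q" "p \<noteq> r" "q \<noteq> r" "valid N a" "x < N" "y < N" "z < N"
  shows "app (U2 p q) f (a(p := x, q := y, r := z)) = U_fun (\<lambda>x y. f (a(p := x, q := y, r := z))) x y"
    and "app (U2 q r) f (a(p := x, q := y, r := z)) = U_fun (\<lambda>y z. f (a(p := x, q := y, r := z))) y z"
proof -
  have *: "a(p := x, q := y, r := z) = a(r := z, p := x, q := y)" for x y z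
    using assms by auto
  show "app (U2 p q) f (a(p := x, q := y, r := z)) = U_fun (\<lambda>x y. f (a(p := x, q := y, r := z))) x y"
    unfolding * using app_U2_upd[of p q "a(r := z)" x y f] assms by (simp add: valid_upd)
  show "app (U2 q r) f (a(p := x, q := y, r := z)) = U_fun (\<lambda>y z. f (a(p := x, q := y, r := z))) y z"
    using app_U2_upd[of q r "a(p := x)" y z f] assms by (simp add: valid_upd)
qed

lemma app_\<epsilon>_upd:
  assumes "p \<noteq> q" "valid N a" "x < N" "y < N"
  shows "app (\<epsilon> p) f (a(p := x, q := y)) = \<alpha> x * (\<Sum>x<N. \<alpha> x * f (a(p := x, q := y)))"
    and "app (\<epsilon> q) f (a(p := x, q := y)) = \<alpha> y * (\<Sum>y<N. \<alpha> y * f (a(p := x, q := y)))"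
  using assms by (simp_all add: app_\<epsilon> valid_upd fun_upd_twist)

lemma app_\<epsilon>\<epsilon>\<epsilon>_upd:
  assumes "p \<noteq> q" "p \<noteq> r" "q \<noteq> r" "valid N a" "x < N" "y < N" "z < N"
  shows "app (\<epsilon> p * \<epsilon> q * \<epsilon> r) f (a(p := x, q := y, r := z)) = \<alpha> x * \<alpha> y * \<alpha> z *
    (\<Sum>x<N. \<Sum>y<N. \<Sum>z<N. \<alpha> x * \<alpha> y * \<alpha> z * f (a(p := x, q := y, r := z)))"
proof -
  have p: "a(p := x, q := y, r := z, p := x', q := y', r := z') = a(p := x', q := y', r := z')"
    for x y z x' y' z' using assms by auto
  have 1: "app (\<epsilon> p) f (a(p := x, q := y, r := z)) = \<alpha> x * (\<Sum>x<N. \<alpha> x * f (a(p := x, q := y, r := z)))"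
    if "x < N" "y < N" "z < N" for x y z f
  proof -
    have "a(p := x, q := y, r := z, p := x') = a(p := x', q := y, r := z)" for x' using assms by auto
    then show ?thesis using assms that by (simp add: app_\<epsilon> valid_upd)
  qed
  have 2: "app (\<epsilon> q) f (a(p := x, q := y, r := z)) = \<alpha> y * (\<Sum>y<N. \<alpha> y * f (a(p := x, q := y, r := z)))"
    if "x < N" "y < N" "z < N" for x y z f
  proof -
    have "a(p := x, q := y, r := z, q := y') = a(p := x, q := y', r := z)" for y' using assms by auto
    then show ?thesis using assms that by (simp add: app_\<epsilon> valid_upd)
  qed
  have 3: "app (\<epsilon> r) f (a(p := x, q := y, r := z)) = \<alpha> z * (\<Sum>z<N. \<alpha> z * f (a(p := x, q := y, r := z)))"
    if "x < N" "y < N" "z < N" for x y z f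
    using assms that by (simp add: app_\<epsilon> valid_upd)
  show ?thesis
    using assms by (simp add: app_simps 1 2 3 sum_distrib_left mult.assoc mult.left_commute)
qed

lemma U2_quad: "p \<noteq> q \<Longrightarrow> U2 p q * U2 p q = scal (s\<^sup>2 + inverse (s\<^sup>2)) * U2 p q"
  by (rule lin_op_eqI2[where p = p and q = q])
     (use s_0 in \<open>auto simp: app_simps app_U2_invalid app_U2_upd U_fun_def d_def field_simps\<close>)

lemma U2_braid:
  assumes "p \<noteq> q" "p \<noteq> r" "q \<noteq> r"
  shows "U2 p q * U2 q r * U2 p q - U2 p q = U2 q r * U2 p q * U2 q r - U2 q r"
proof (rule lin_op_eqI3[where p = p and q = q and r = r])
  fix f :: "(nat \<Rightarrow> nat) \<Rightarrow> 'a" and a x y z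
  assume a: "valid N a" and xyz: "x < N" "y < N" "z < N"
  show "app (U2 p q * U2 q r * U2 p q - U2 p q) f (a(p := x, q := y, r := z)) =
    app (U2 q r * U2 p q * U2 q r - U2 q r) f (a(p := x, q := y, r := z))"
    using xyz s_0
    by (simp add: app_simps app_U2_upd3[OF assms a] U_fun_def) (auto simp: d_def field_simps)
qed (use assms in \<open>auto simp: app_simps app_U2_invalid\<close>)

text \<open>Up to the symmetric factor \<open>A\<close>, the coordinates depend only on the relative order of \<open>x\<close>, \<open>y\<close>, \<open>z\<close>.\<close>

lemma slide_kernel:
  assumes "\<And>x y z. A x y z = \<alpha> x * \<alpha> y * \<alpha> z"
  shows "U_fun (\<lambda>x y. U_fun (\<lambda>y z. A x y z) y z) x y - U_fun (\<lambda>x y. A x y z) x y =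
    U_fun (\<lambda>y z. U_fun (\<lambda>x y. A x y z) x y) y z - U_fun (\<lambda>y z. A x y z) y z"
  using s_0 by (auto simp: U_fun_def assms d_def field_simps)

text \<open>\<open>U\<close> is a symmetric matrix. This turns the right-hand slide relation into the left-hand one.\<close>

lemma U_fun_adjoint: "(\<Sum>x<N. \<Sum>y<N. h x y * U_fun g x y) = (\<Sum>x<N. \<Sum>y<N. U_fun h x y * g x y)"
proof -
  have "(\<Sum>x<N. \<Sum>y<N. h x y * U_fun g x y) =
     (\<Sum>x<N. \<Sum>y<N. if x = y then 0 else h x y * d x y * g x y) +
     (\<Sum>x<N. \<Sum>y<N. if x = y then 0 else h x y * g y x)"
    unfolding sum.distrib[symmetric] by (intro sum.cong) (auto simp: U_fun_def algebra_simps)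
  also have "(\<Sum>x<N. \<Sum>y<N. if x = y then 0 else h x y * g y x) =
      (\<Sum>x<N. \<Sum>y<N. if x = y then 0 else h y x * g x y)"
    by (subst sum.swap) (intro sum.cong, auto)
  also have "(\<Sum>x<N. \<Sum>y<N. if x = y then 0 else h x y * d x y * g x y) + \<dots> =
      (\<Sum>x<N. \<Sum>y<N. U_fun h x y * g x y)"
    unfolding sum.distrib[symmetric] by (intro sum.cong) (auto simp: U_fun_def algebra_simps)
  finally show ?thesis .
qed

lemma U2_slide_left:
  assumes "p \<noteq> q" "p \<noteq> r" "q \<noteq> r"
  shows "(U2 p q * U2 q r - U2 p q) * (\<epsilon> p * \<epsilon> q * \<epsilon> r) =
    (U2 q r * U2 p q - U2 q r) * (\<epsilon> p * \<epsilon> q * \<epsilon> r)"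
proof (rule lin_op_eqI3[where p = p and q = q and r = r])
  fix f :: "(nat \<Rightarrow> nat) \<Rightarrow> 'a" and a x y z
  assume a: "valid N a" and xyz: "x < N" "y < N" "z < N"
  \<comment> \<open>The image of the projection consists of multiples of \<open>\<alpha> \<otimes> \<alpha> \<otimes> \<alpha>\<close>; \<open>S\<close> is the coefficient.\<close>
  define S where "S = (\<Sum>x<N. \<Sum>y<N. \<Sum>z<N. \<alpha> x * \<alpha> y * \<alpha> z * f (a(p := x, q := y, r := z)))"
  have *: "app (\<epsilon> p * \<epsilon> q * \<epsilon> r) f (a(p := x, q := y, r := z)) = \<alpha> x * \<alpha> y * \<alpha> z * S"
    if "x < N" "y < N" "z < N" for x y z
    using app_\<epsilon>\<epsilon>\<epsilon>_upd[OF assms a that] by (simp add: S_def)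
  define h where "h = app (\<epsilon> p * \<epsilon> q * \<epsilon> r) f"
  have h: "h (a(p := x, q := y, r := z)) = \<alpha> x * \<alpha> y * \<alpha> z * S" if "x < N" "y < N" "z < N" for x y z
    using *[OF that] by (simp add: h_def)
  have "app (U2 p q * U2 q r - U2 p q) h (a(p := x, q := y, r := z)) =
    app (U2 q r * U2 p q - U2 q r) h (a(p := x, q := y, r := z))"
    using xyz s_0 by (simp add: app_simps app_U2_upd3[OF assms a] U_fun_def h)
       (auto simp: d_def field_simps)
  then show "app ((U2 p q * U2 q r - U2 p q) * (\<epsilon> p * \<epsilon> q * \<epsilon> r)) f (a(p := x, q := y, r := z)) =
    app ((U2 q r * U2 p q - U2 q r) * (\<epsilon> p * \<epsilon> q * \<epsilon> r)) f (a(p := x, q := y, r := z))"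
    unfolding h_def by (simp add: app_simps(6))
qed (use assms in \<open>auto simp: app_simps app_U2_invalid\<close>)

lemma U2_slide_right:
  assumes "p \<noteq> q" "p \<noteq> r" "q \<noteq> r"
  shows "(\<epsilon> p * \<epsilon> q * \<epsilon> r) * (U2 q r * U2 p q - U2 p q) =
    (\<epsilon> p * \<epsilon> q * \<epsilon> r) * (U2 p q * U2 q r - U2 q r)"
proof (rule lin_op_eqI3[where p = p and q = q and r = r])
  fix f :: "(nat \<Rightarrow> nat) \<Rightarrow> 'a" and a x y z
  assume a: "valid N a" and xyz: "x < N" "y < N" "z < N"
  define A where "A = (\<lambda>x y z. \<alpha> x * \<alpha> y * \<alpha> z)"
  define g where "g = (\<lambda>x y z. f (a(p := x, q := y, r := z)))"
  \<comment> \<open>Pairing with \<open>A\<close>; \<open>u12\<close> and \<open>u23\<close> are the coordinate forms of the two operators.\<close>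
  define L where "L = (\<lambda>g. \<Sum>x<N. \<Sum>y<N. \<Sum>z<N. A x y z * g x y z)"
  define u12 :: "(nat \<Rightarrow> nat \<Rightarrow> nat \<Rightarrow> 'a) \<Rightarrow> nat \<Rightarrow> nat \<Rightarrow> nat \<Rightarrow> 'a"
    where "u12 = (\<lambda>g x y z. U_fun (\<lambda>x y. g x y z) x y)"
  define u23 :: "(nat \<Rightarrow> nat \<Rightarrow> nat \<Rightarrow> 'a) \<Rightarrow> nat \<Rightarrow> nat \<Rightarrow> nat \<Rightarrow> 'a"
    where "u23 = (\<lambda>g x. U_fun (\<lambda>y z. g x y z))"
  have adj: "(\<Sum>x<N. \<Sum>y<N. \<Sum>z<N. h x y z * u23 g x y z) = (\<Sum>x<N. \<Sum>y<N. \<Sum>z<N. u23 h x y z * g x y z)"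
    "(\<Sum>x<N. \<Sum>y<N. \<Sum>z<N. h x y z * u12 g x y z) = (\<Sum>x<N. \<Sum>y<N. \<Sum>z<N. u12 h x y z * g x y z)" for h g
  proof -
    show "(\<Sum>x<N. \<Sum>y<N. \<Sum>z<N. h x y z * u23 g x y z) = (\<Sum>x<N. \<Sum>y<N. \<Sum>z<N. u23 h x y z * g x y z)"
      unfolding u23_def by (intro sum.cong refl U_fun_adjoint)
    have "(\<Sum>x<N. \<Sum>y<N. \<Sum>z<N. h x y z * u12 g x y z) = (\<Sum>z<N. \<Sum>x<N. \<Sum>y<N. h x y z * u12 g x y z)"
      by (rule sum_rotate)
    also have "\<dots> = (\<Sum>z<N. \<Sum>x<N. \<Sum>y<N. u12 h x y z * g x y z)"
      unfolding u12_def by (intro sum.cong refl U_fun_adjoint)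
    also have "\<dots> = (\<Sum>x<N. \<Sum>y<N. \<Sum>z<N. u12 h x y z * g x y z)" by (rule sum_rotate[symmetric])
    finally show "(\<Sum>x<N. \<Sum>y<N. \<Sum>z<N. h x y z * u12 g x y z) = (\<Sum>x<N. \<Sum>y<N. \<Sum>z<N. u12 h x y z * g x y z)" .
  qed
  have app_L: "app (\<epsilon> p * \<epsilon> q * \<epsilon> r) h (a(p := x, q := y, r := z)) =
      \<alpha> x * \<alpha> y * \<alpha> z * L (\<lambda>x y z. h (a(p := x, q := y, r := z)))" for h
    using app_\<epsilon>\<epsilon>\<epsilon>_upd[OF assms a xyz, of h] by (simp add: L_def A_def)
  have app_1: "app (U2 q r * U2 p q - U2 p q) f (a(p := x, q := y, r := z)) = u23 (u12 g) x y z - u12 g x y z"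
    if "x < N" "y < N" "z < N" for x y z
    using that unfolding u12_def u23_def g_def
    by (simp add: app_simps app_U2_upd3[OF assms a] U_fun_def)
  have app_2: "app (U2 p q * U2 q r - U2 q r) f (a(p := x, q := y, r := z)) = u12 (u23 g) x y z - u23 g x y z"
    if "x < N" "y < N" "z < N" for x y z
    using that unfolding u12_def u23_def g_def
    by (simp add: app_simps app_U2_upd3[OF assms a] U_fun_def)
  have "L (\<lambda>x y z. app (U2 q r * U2 p q - U2 p q) f (a(p := x, q := y, r := z)))
      = L (u23 (u12 g)) - L (u12 g)"
    unfolding L_def sum_subtractf[symmetric]
    by (intro sum.cong) (auto simp: app_1 algebra_simps)
  also have "\<dots> = (\<Sum>x<N. \<Sum>y<N. \<Sum>z<N. (u12 (u23 A) x y z - u12 A x y z) * g x y z)"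
    unfolding L_def adj left_diff_distrib sum_subtractf ..
  also have "\<dots> = (\<Sum>x<N. \<Sum>y<N. \<Sum>z<N. (u23 (u12 A) x y z - u23 A x y z) * g x y z)"
    unfolding u12_def u23_def by (subst slide_kernel) (auto simp: A_def)
  also have "\<dots> = L (u12 (u23 g)) - L (u23 g)"
    unfolding L_def adj left_diff_distrib sum_subtractf ..
  also have "\<dots> = L (\<lambda>x y z. app (U2 p q * U2 q r - U2 q r) f (a(p := x, q := y, r := z)))"
    unfolding L_def sum_subtractf[symmetric]
    by (intro sum.cong) (auto simp: app_2 algebra_simps)
  finally show "app ((\<epsilon> p * \<epsilon> q * \<epsilon> r) * (U2 q r * U2 p q - U2 p q)) f (a(p := x, q := y, r := z)) =
      app ((\<epsilon> p * \<epsilon> q * \<epsilon> r) * (U2 p q * U2 q r - U2 q r)) f (a(p := x, q := y, r := z))"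
    unfolding app_simps(6)[of "\<epsilon> p * \<epsilon> q * \<epsilon> r"] app_L by simp
qed (use assms in \<open>auto simp: app_simps app_\<epsilon>_invalid\<close>)

lemma \<epsilon>_idem: "\<epsilon> t * \<epsilon> t = \<epsilon> t"
proof (rule lin_op_eqI)
  fix f a
  show "app (\<epsilon> t * \<epsilon> t) f a = app (\<epsilon> t) f a"
  proof (cases "valid N a")
    case True
    define S where "S = (\<Sum>j<N. \<alpha> j * f (a(t := j)))"
    have "app (\<epsilon> t) f (a(t := j)) = \<alpha> j * S" if "j < N" for j
      using True that by (simp add: app_\<epsilon> valid_upd S_def)
    then have "app (\<epsilon> t * \<epsilon> t) f a = \<alpha> (a t) * (\<Sum>j<N. \<alpha> j * \<alpha> j * S)"
      using True by (simp add: app_simps app_\<epsilon>[of t "app (\<epsilon> t) f"] mult.assoc)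
    also have "\<dots> = (\<Sum>j<N. \<alpha> j * \<alpha> j) * app (\<epsilon> t) f a"
      using True by (simp add: app_\<epsilon> S_def[symmetric] sum_distrib_right[symmetric] mult.left_commute)
    finally show ?thesis by (simp add: sum_\<alpha>_sq)
  qed (simp add: app_simps app_\<epsilon>)
qed

text \<open>The swapping part of \<open>U\<close> contributes \<open>\<epsilon> p * \<epsilon> q\<close>, except that the terms with equal entries are missing.
They are compensated for by the diagonal part, which makes its coefficient constant.\<close>

lemma \<epsilon>_U2_\<epsilon>:
  assumes "p \<noteq> q"
  shows "\<epsilon> p * U2 p q * \<epsilon> p = \<epsilon> p * \<epsilon> q + scal c * \<epsilon> p"
proof (rule lin_op_eqI2[where p = p and q = q])
  fix f :: "(nat \<Rightarrow> nat) \<Rightarrow> 'a" and a x y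
  assume a: "valid N a" and xy: "x < N" "y < N"
  define g where "g = (\<lambda>x y. f (a(p := x, q := y)))"
  define S where "S = (\<lambda>y. \<Sum>x<N. \<alpha> x * g x y)"
  have S: "app (\<epsilon> p) f (a(p := x, q := y)) = \<alpha> x * S y" if "x < N" "y < N" for x y
    using app_\<epsilon>_upd(1)[OF assms a that] by (simp add: S_def g_def)
  have US: "app (U2 p q) (app (\<epsilon> p) f) (a(p := x, q := y)) = U_fun (\<lambda>x y. \<alpha> x * S y) x y"
    if "x < N" "y < N" for x y
    using that by (simp add: app_U2_upd[OF assms a] U_fun_def S)
  have "app (\<epsilon> p * U2 p q * \<epsilon> p) f (a(p := x, q := y)) =
      \<alpha> x * (\<Sum>x<N. \<alpha> x * U_fun (\<lambda>x y. \<alpha> x * S y) x y)"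
    using xy by (simp add: app_simps app_\<epsilon>_upd(1)[OF assms a] US)
  also have "(\<Sum>x<N. \<alpha> x * U_fun (\<lambda>x y. \<alpha> x * S y) x y) =
      (\<Sum>x<N. (if x = y then 0 else \<alpha> x * \<alpha> x * d x y) * S y) +
      (\<Sum>x<N. \<alpha> y * (\<alpha> x * S x) - (if x = y then \<alpha> y * (\<alpha> y * S y) else 0))"
    unfolding sum.distrib[symmetric]
    by (intro sum.cong) (auto simp: U_fun_def algebra_simps)
  also have "\<dots> = (c + \<alpha> y * \<alpha> y) * S y + (\<alpha> y * (\<Sum>x<N. \<alpha> x * S x) - \<alpha> y * (\<alpha> y * S y))"
    using xy by (simp add: sum_subtractf sum_distrib_right[symmetric] sum_distrib_left[symmetric] sum_\<alpha>_d)
  also have "\<alpha> x * \<dots> = \<alpha> x * (\<alpha> y * (\<Sum>x<N. \<alpha> x * S x)) + c * (\<alpha> x * S y)"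
    by (simp add: algebra_simps)
  also have "\<alpha> x * (\<alpha> y * (\<Sum>y<N. \<alpha> y * S y)) = app (\<epsilon> p * \<epsilon> q) f (a(p := x, q := y))"
  proof -
    have "app (\<epsilon> q * \<epsilon> p) f (a(p := x, q := y)) = \<alpha> y * (\<Sum>y<N. \<alpha> y * (\<alpha> x * S y))"
      using xy by (simp add: app_simps app_\<epsilon>_upd(2)[OF assms a] S)
    then show ?thesis unfolding \<epsilon>_\<epsilon>[of p q] by (simp add: sum_distrib_left mult.left_commute)
  qed
  finally show "app (\<epsilon> p * U2 p q * \<epsilon> p) f (a(p := x, q := y)) =
      app (\<epsilon> p * \<epsilon> q + scal c * \<epsilon> p) f (a(p := x, q := y))"
    by (simp only: app_simps S[OF xy])
qed (use assms in \<open>auto simp: app_simps app_\<epsilon>_invalid\<close>)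

lemma e_\<epsilon>_commute: "e r * \<epsilon> t = \<epsilon> t * e r"
  by (induction r) (auto simp: mult.assoc \<epsilon>_\<epsilon>[of _ t], simp add: mult.assoc[symmetric])

lemma e_U2: "r < p \<Longrightarrow> r < q \<Longrightarrow> e r * U2 p q = U2 p q * e r"
proof (induction r)
  case (Suc r)
  from Suc.prems have "e (Suc r) * U2 p q = e r * U2 p q * \<epsilon> (Suc r)"
    by (simp add: mult.assoc \<epsilon>_U2)
  also have "\<dots> = U2 p q * e (Suc r)" using Suc by (metis Suc_lessD e.simps(2) mult.assoc)
  finally show ?case .
qed simp

lemma \<epsilon>_e: "1 \<le> t \<Longrightarrow> t \<le> r \<Longrightarrow> \<epsilon> t * e r = e r"
proof (induction r)
  case (Suc r)
  show ?case
  proof (cases "t = Suc r")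
    case True
    then show ?thesis by (simp add: e_\<epsilon>_commute \<epsilon>_idem mult.assoc[symmetric])
  next
    case False
    with Suc show ?thesis by (simp add: mult.assoc[symmetric])
  qed
qed simp

lemma e_mult_e: "r \<le> r' \<Longrightarrow> e r * e r' = e r'"
  by (induction r) (auto simp: mult.assoc \<epsilon>_e)

lemma e_e_commute: "e r * e r' = e r' * e r"
  by (induction r) (auto simp: mult.assoc e_\<epsilon>_commute[symmetric], simp add: mult.assoc[symmetric])

sublocale C_tower u e "s\<^sup>2 + inverse (s\<^sup>2)" c
proof
  show "u i * u i = scal (s\<^sup>2 + inverse (s\<^sup>2)) * u i" for i
    unfolding u_def by (rule U2_quad) simp
  show "u i * u (Suc i) * u i - u i = u (Suc i) * u i * u (Suc i) - u (Suc i)" for i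
    unfolding u_def by (rule U2_braid) auto
  show "u i * u j = u j * u i" if "Suc i < j" for i j
    unfolding u_def by (rule U2_U2) (use that in auto)
  show "e r * e r' = e r'" if "r \<le> r'" for r r' using e_mult_e that .
  show "e r' * e r = e r'" if "r \<le> r'" for r r' using e_mult_e[OF that] by (simp add: e_e_commute)
  show "e r * u i = u i * e r" if "r < i" for r i
    unfolding u_def by (rule e_U2) (use that in auto)
  show "e (Suc r) = e r * u r * e r - scal c * e r" if r: "1 \<le> r" for r
  proof -
    obtain m where m: "r = Suc m" using r by (cases r) auto
    have "e r * u r * e r = e m * (\<epsilon> r * u r * (e m * \<epsilon> r))" by (simp add: m mult.assoc)
    also have "\<dots> = e m * (\<epsilon> r * (u r * e m) * \<epsilon> r)" by (simp add: mult.assoc)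
    also have "u r * e m = e m * u r" unfolding u_def by (rule e_U2[symmetric]) (auto simp: m)
    also have "e m * (\<epsilon> r * (e m * u r) * \<epsilon> r) = (e m * e m) * (\<epsilon> r * u r * \<epsilon> r)"
      by (simp add: mult.assoc e_\<epsilon>_commute) (simp add: mult.assoc[symmetric] e_\<epsilon>_commute)
    also have "e m * e m = e m" by (simp add: e_mult_e)
    also have "\<epsilon> r * u r * \<epsilon> r = \<epsilon> r * \<epsilon> (Suc r) + scal c * \<epsilon> r"
      unfolding u_def by (rule \<epsilon>_U2_\<epsilon>) simp
    also have "e m * \<dots> = e (Suc r) + scal c * e r"
      by (simp add: m distrib_left mult.assoc scal_left_commute[of "e m"])
    finally show ?thesis by simp
  qed
  show "(u i * u (Suc i) - u i) * e r = (u (Suc i) * u i - u (Suc i)) * e r"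
    if "1 \<le> i" "Suc i < r" for i r
  proof -
    have *: "e r = \<epsilon> i * \<epsilon> (Suc i) * \<epsilon> (Suc (Suc i)) * e r" using that by (simp add: mult.assoc \<epsilon>_e)
    have "(u i * u (Suc i) - u i) * (\<epsilon> i * \<epsilon> (Suc i) * \<epsilon> (Suc (Suc i))) =
      (u (Suc i) * u i - u (Suc i)) * (\<epsilon> i * \<epsilon> (Suc i) * \<epsilon> (Suc (Suc i)))"
      unfolding u_def by (rule U2_slide_left) auto
    then show ?thesis by (subst (1 2) *) (simp add: mult.assoc[symmetric])
  qed
  show "e r * (u (Suc i) * u i - u i) = e r * (u i * u (Suc i) - u (Suc i))"
    if "1 \<le> i" "Suc i < r" for i r
  proof -
    have *: "e r = e r * (\<epsilon> i * \<epsilon> (Suc i) * \<epsilon> (Suc (Suc i)))"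
      using that by (simp add: e_\<epsilon>_commute mult.assoc[symmetric] \<epsilon>_e)
    have "(\<epsilon> i * \<epsilon> (Suc i) * \<epsilon> (Suc (Suc i))) * (u (Suc i) * u i - u i) =
      (\<epsilon> i * \<epsilon> (Suc i) * \<epsilon> (Suc (Suc i))) * (u i * u (Suc i) - u (Suc i))"
      unfolding u_def by (rule U2_slide_right) auto
    then show ?thesis by (subst (1 2) *) (simp add: mult.assoc)
  qed
qed simp

end

context N_state begin

section \<open>The partial trace over one tensor factor\<close>

abbreviation \<pi> :: "(nat \<Rightarrow> nat, 'a) lin_op" where "\<pi> \<equiv> valid_op N"

definition F :: "nat \<Rightarrow> (nat \<Rightarrow> nat, 'a) lin_op \<Rightarrow> (nat \<Rightarrow> nat, 'a) lin_op" where
  "F n T = (\<Sum>b<N. \<Sum>l<N. scal (D b) * (E n l b * T * E n b l))"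

lemma F_add: "F n (x + y) = F n x + F n y"
  by (simp add: F_def distrib_left distrib_right sum.distrib)

lemma F_sum: "F n (\<Sum>i\<in>I. x i) = (\<Sum>i\<in>I. F n (x i))"
proof (induction I rule: infinite_finite_induct)
  case empty
  then show ?case using F_add[of n 0 0] by simp
next
  case (infinite I)
  then show ?case using F_add[of n 0 0] by simp
qed (simp add: F_add)

lemma F_left:
  assumes "\<And>i j. i < N \<Longrightarrow> j < N \<Longrightarrow> E n i j * z = z * E n i j"
  shows "F n (z * x) = z * F n x"
  unfolding F_def sum_distrib_left
proof (intro sum.cong refl)
  fix b l assume "b \<in> {..<N}" "l \<in> {..<N}"
  then have "E n l b * (z * x) = z * (E n l b * x)"
    using assms[of l b] by (simp add: mult.assoc[symmetric])
  then show "scal (D b) * (E n l b * (z * x) * E n b l) = z * (scal (D b) * (E n l b * x * E n b l))"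
    by (simp add: mult.assoc scal_left_commute[of z])
qed

lemma F_right:
  assumes "\<And>i j. i < N \<Longrightarrow> j < N \<Longrightarrow> E n i j * z = z * E n i j"
  shows "F n (x * z) = F n x * z"
  unfolding F_def sum_distrib_right
  by (intro sum.cong refl) (simp add: mult.assoc assms)

lemma F_scal: "F n (scal l * x) = scal l * F n x"
  by (rule F_left) (simp add: scal_commute)

lemma E_u: "n \<noteq> i \<Longrightarrow> n \<noteq> Suc i \<Longrightarrow> b < N \<Longrightarrow> E n l b * u i = u i * E n l b"
  unfolding u_def by (rule E_U2) auto

lemma E_e: "r < n \<Longrightarrow> b < N \<Longrightarrow> E n l b * e r = e r * E n l b"
proof (induction r)
  case (Suc r)
  then have IH: "E n l b * e r = e r * E n l b"
    and \<epsilon>: "E n l b * \<epsilon> (Suc r) = \<epsilon> (Suc r) * E n l b"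
    by (auto intro: E_\<epsilon>)
  have "E n l b * e (Suc r) = (E n l b * e r) * \<epsilon> (Suc r)" by (simp add: mult.assoc)
  also have "\<dots> = e r * (E n l b * \<epsilon> (Suc r))" by (simp only: IH mult.assoc)
  also have "\<dots> = e (Suc r) * E n l b" by (simp only: \<epsilon> e.simps mult.assoc)
  finally show ?case .
qed simp

lemma E_A: "z \<in> A n \<Longrightarrow> n < m \<Longrightarrow> b < N \<Longrightarrow> E m l b * z = z * E m l b"
  unfolding A_def
  by (erule generated_commute) (auto intro: E_u E_e)

lemma \<pi>_u: "\<pi> * u i = u i" "u i * \<pi> = u i"
  unfolding u_def
  by (rule lin_op_eqI; simp add: app_simps app_U2 app_valid_op valid_upd valid_less)+

lemma \<pi>_\<epsilon>: "\<pi> * \<epsilon> i = \<epsilon> i" "\<epsilon> i * \<pi> = \<epsilon> i"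
  by (rule lin_op_eqI; simp add: app_simps app_\<epsilon> app_valid_op valid_upd valid_less)+

lemma \<pi>_A: "z \<in> A n \<Longrightarrow> \<pi> * z = z * \<pi>"
  unfolding A_def
proof (erule generated_commute)
  fix g assume "g \<in> u ` {1..<n} \<union> e ` {1..n}"
  moreover have "\<pi> * e r = e r * \<pi>" for r
  proof (induction r)
    case (Suc r)
    have "\<pi> * e (Suc r) = (\<pi> * e r) * \<epsilon> (Suc r)" by (simp add: mult.assoc)
    also have "\<dots> = e r * (\<pi> * \<epsilon> (Suc r))" by (simp only: Suc.IH mult.assoc)
    also have "\<dots> = e (Suc r) * \<pi>" by (simp only: \<pi>_\<epsilon> e.simps mult.assoc)
    finally show ?case .
  qed simp
  ultimately show "\<pi> * g = g * \<pi>" by (auto simp: \<pi>_u)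
qed

lemma sum_scal_E_diag: "(\<Sum>l<N. x * E n l l) = x * \<pi>"
  by (simp add: sum_distrib_left[symmetric] munit_sum)

lemma F_1: "F n 1 = scal (\<Sum>b<N. D b) * \<pi>"
proof -
  have "F n 1 = (\<Sum>b<N. \<Sum>l<N. scal (D b) * E n l l)"
    unfolding F_def by (intro sum.cong refl) (simp add: munit_mult)
  then show ?thesis
    by (simp add: sum_scal_E_diag scal_sum sum_distrib_right)
qed

lemma E_E: "t \<noteq> t' \<Longrightarrow> j < N \<Longrightarrow> l < N \<Longrightarrow> E t i j * E t' m l = E t' m l * E t i j"
  by (rule munit_commute)

lemma E_mult: "j < N \<Longrightarrow> E t i j * E t m l = (if j = m then E t i l else 0)"
  by (rule munit_mult)

text \<open>The diagonal part of \<open>U\<close> in factor \<open>t\<close>, with the other factor fixed at \<open>b\<close>.\<close>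

definition P :: "nat \<Rightarrow> nat \<Rightarrow> (nat \<Rightarrow> nat, 'a) lin_op" where
  "P t b = (\<Sum>i<N. if i = b then 0 else scal (d i b) * E t i i)"

lemma E_row_U2:
  assumes "p \<noteq> q" "b < N" "l < N"
  shows "E q l b * U2 p q = P p b * E q l b + (\<Sum>i<N. if i = b then 0 else E p i b * E q l i)"
proof -
  have "E q l b * U2 p q = (\<Sum>i<N. \<Sum>j<N. (if j = b then (if i = b then 0 else scal (d i b) * E p i i * E q l b) else 0)
      + (if j = b then if i = b then 0 else E p i b * E q l i else 0))"
    unfolding U2_def sum_distrib_left
  proof (intro sum.cong refl)
    fix i j assume ij: "i \<in> {..<N}" "j \<in> {..<N}"
    have 1: "E q l b * (E p i j' * E q j j'') = (if b = j then E p i j' * E q l j'' else 0)"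
      if "j' < N" for i j j' j''
    proof -
      have "E q l b * (E p i j' * E q j j'') = E p i j' * (E q l b * E q j j'')"
        using E_E[of q p b j' l i] assms that by (simp add: mult.assoc[symmetric])
      then show ?thesis using assms by (simp add: munit_mult)
    qed
    show "E q l b * (if i = j then 0 else scal (d i j) * E p i i * E q j j + E p i j * E q j i) =
      (if j = b then (if i = b then 0 else scal (d i b) * E p i i * E q l b) else 0)
      + (if j = b then if i = b then 0 else E p i b * E q l i else 0)"
      using ij by (auto simp: distrib_left 1 mult.assoc scal_left_commute[of "E q l b"])
  qed
  also have "\<dots> = (\<Sum>i<N. (if i = b then 0 else scal (d i b) * E p i i * E q l b)
      + (if i = b then 0 else E p i b * E q l i))"
    using assms by (intro sum.cong refl) (simp add: sum.distrib)
  finally show ?thesis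
    by (simp add: P_def sum.distrib sum_distrib_right if_distribR if_distrib[of "\<lambda>x. x * _"] cong: if_cong)
qed

lemma U2_E_col:
  assumes "p \<noteq> q" "b < N" "l < N"
  shows "U2 p q * E q b l = E q b l * P p b + (\<Sum>i<N. if i = b then 0 else E p b i * E q i l)"
proof -
  have com: "E q b l * E p i i = E p i i * E q b l" if "i < N" for i
    using assms that by (intro munit_commute) auto
  have "U2 p q * E q b l = (\<Sum>i<N. \<Sum>j<N. (if j = b then (if i = b then 0 else scal (d i b) * E p i i * E q b l) else 0)
      + (if i = b then if j = b then 0 else E p b j * E q j l else 0))"
    unfolding U2_def sum_distrib_right
    by (intro sum.cong refl) (use assms in \<open>auto simp: distrib_right mult.assoc munit_mult\<close>)
  also have "\<dots> = (\<Sum>i<N. \<Sum>j<N. if j = b then (if i = b then 0 else scal (d i b) * E p i i * E q b l) else 0)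
     + (\<Sum>j<N. \<Sum>i<N. if i = b then if j = b then 0 else E p b j * E q j l else 0)"
    by (simp add: sum.distrib sum.swap[of "\<lambda>i j. if i = b then if j = b then 0 else E p b j * E q j l else 0"])
  also have "(\<Sum>i<N. \<Sum>j<N. if j = b then (if i = b then 0 else scal (d i b) * E p i i * E q b l) else 0)
     = E q b l * P p b"
    unfolding P_def sum_distrib_left
    by (intro sum.cong refl) (use assms com in \<open>auto simp: mult.assoc scal_left_commute[of "E q b l"]\<close>)
  finally show ?thesis using assms by simp
qed

lemma E_P: "p \<noteq> q \<Longrightarrow> l < N \<Longrightarrow> E q b l * P p b' = P p b' * E q b l"
  unfolding P_def sum_distrib_left sum_distrib_right
  by (intro sum.cong refl)
     (auto simp: mult.assoc scal_left_commute[of "E q b l"] munit_commute)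

text \<open>Write both factors \<open>U\<close> as a diagonal and a swapping part. The mixed terms vanish. The diagonal parts
give a constant multiple of \<open>x\<close>, with a correction for equal entries, and the swapping parts give
the partial trace of \<open>x\<close> over factor \<open>p\<close>, without the diagonal terms that the correction restores.\<close>

lemma F_u_mid:
  assumes pq: "p \<noteq> q" and x: "\<And>i j. i < N \<Longrightarrow> j < N \<Longrightarrow> E q i j * x = x * E q i j"
  shows "F q (U2 p q * x * U2 p q) = scal d2 * (\<pi> * x * \<pi>) + F p x * \<pi>"
proof -
  have 1: "E q l b * U2 p q * x * (U2 p q * E q b l) =
     (P p b * x * P p b + (\<Sum>i<N. if i = b then 0 else E p i b * x * E p b i)) * E q l l"
    if b: "b < N" and l: "l < N" for b l
  proof -
    have x': "E q i j * (x * z) = x * (E q i j * z)" if "i < N" "j < N" for i j z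
      using x[OF that] by (simp add: mult.assoc[symmetric])
    have E': "E q i j * (E p i' j' * z) = E p i' j' * (E q i j * z)" if "j < N" "j' < N" for i j i' j' z
      using E_E[of q p j j' i i'] pq that by (simp add: mult.assoc[symmetric])
    have P': "E q i j * (P p b * z) = P p b * (E q i j * z)" if "j < N" for i j z
      using E_P[OF pq that, of i b] by (simp add: mult.assoc[symmetric])
    have EE: "E q i j * (E q i' j' * z) = (if j = i' then E q i j' * z else 0)" if "j < N" for i j i' j' z
      by (simp add: mult.assoc[symmetric] E_mult[OF that])
    define R where "R = (\<Sum>i<N. if i = b then 0 else E p i b * E q l i)"
    define C where "C = (\<Sum>i<N. if i = b then 0 else E p b i * E q i l)"
    \<comment> \<open>Diagonal and swapping parts multiplied out; only the products of like parts survive.\<close>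
    have PP: "P p b * E q l b * x * (E q b l * P p b) = P p b * x * P p b * E q l l"
      using b l by (simp add: mult.assoc x' P' EE munit_mult E_P[OF pq])
    have PC: "P p b * E q l b * x * C = 0"
      unfolding C_def sum_distrib_left
      by (rule sum.neutral) (use b l in \<open>auto simp: mult.assoc x' E' EE munit_mult\<close>)
    have RP: "R * x * (E q b l * P p b) = 0"
      unfolding R_def sum_distrib_right
      by (rule sum.neutral) (use b l in \<open>auto simp: mult.assoc x' E' EE munit_mult\<close>)
    have "R * x * C = (\<Sum>i<N. \<Sum>j<N. if j = i then if i = b then 0 else E p i b * x * E p b i * E q l l else 0)"
      unfolding R_def C_def sum_distrib_right sum_distrib_left
      by (subst sum.swap, intro sum.cong refl)
         (use b l in \<open>auto simp: mult.assoc x' E' EE munit_mult\<close>)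
    also have "\<dots> = (\<Sum>i<N. if i = b then 0 else E p i b * x * E p b i * E q l l)"
      by (intro sum.cong refl) simp
    also have "\<dots> = (\<Sum>i<N. if i = b then 0 else E p i b * x * E p b i) * E q l l"
      unfolding sum_distrib_right by (intro sum.cong refl) simp
    finally have RC: "R * x * C = \<dots>" .
    show ?thesis
      unfolding E_row_U2[OF pq b l] U2_E_col[OF pq b l] R_def[symmetric] C_def[symmetric]
      by (simp add: distrib_left distrib_right PP PC RP RC)
  qed
  have "F q (U2 p q * x * U2 p q) = (\<Sum>b<N. \<Sum>l<N. scal (D b) *
      (P p b * x * P p b + (\<Sum>i<N. if i = b then 0 else E p i b * x * E p b i)) * E q l l)"
    unfolding F_def
  proof (intro sum.cong refl)
    fix b l assume bl: "b \<in> {..<N}" "l \<in> {..<N}"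
    show "scal (D b) * (E q l b * (U2 p q * x * U2 p q) * E q b l) = scal (D b) *
      (P p b * x * P p b + (\<Sum>i<N. if i = b then 0 else E p i b * x * E p b i)) * E q l l"
      using 1[of b l] bl by (simp add: mult.assoc)
  qed
  also have "\<dots> = (\<Sum>b<N. scal (D b) * (P p b * x * P p b)) * \<pi> +
      (\<Sum>b<N. \<Sum>i<N. if i = b then 0 else scal (D b) * (E p i b * x * E p b i)) * \<pi>"
    by (simp add: sum_scal_E_diag sum_distrib_right[symmetric] distrib_left sum.distrib sum_distrib_left
        if_distrib[of "\<lambda>z. scal _ * z"] cong: if_cong) (simp add: distrib_right)
  also have "(\<Sum>b<N. scal (D b) * (P p b * x * P p b)) =
     (\<Sum>i<N. \<Sum>j<N. scal (\<Sum>b<N. if b = i \<or> b = j then 0 else D b * d i b * d j b) * (E p i i * x * E p j j))"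
  proof -
    have "(\<Sum>b<N. scal (D b) * (P p b * x * P p b)) =
      (\<Sum>b<N. \<Sum>i<N. \<Sum>j<N. scal (if b = i \<or> b = j then 0 else D b * d i b * d j b) * (E p i i * x * E p j j))"
    proof (intro sum.cong refl)
      fix b
      have "P p b * x * P p b = (\<Sum>i<N. \<Sum>j<N. (if i = b then 0 else scal (d i b) * E p i i) * x * (if j = b then 0 else scal (d j b) * E p j j))"
        unfolding P_def sum_distrib_left sum_distrib_right by (subst sum.swap) simp
      then have "scal (D b) * (P p b * x * P p b) = (\<Sum>i<N. \<Sum>j<N. scal (D b) * ((if i = b then 0 else scal (d i b) * E p i i) * x * (if j = b then 0 else scal (d j b) * E p j j)))"
        by (simp add: sum_distrib_left)
      also have "\<dots> = (\<Sum>i<N. \<Sum>j<N. scal (if b = i \<or> b = j then 0 else D b * d i b * d j b) * (E p i i * x * E p j j))"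
        by (intro sum.cong refl)
           (auto simp: scal_hom mult.assoc scal_left_commute[of x] scal_left_commute[of "E _ _ _"])
      finally show "scal (D b) * (P p b * x * P p b) = \<dots>" .
    qed
    also have "\<dots> = (\<Sum>i<N. \<Sum>j<N. \<Sum>b<N. scal (if b = i \<or> b = j then 0 else D b * d i b * d j b) * (E p i i * x * E p j j))"
      by (rule sum_rotate[symmetric])
    finally show ?thesis by (simp add: scal_sum sum_distrib_right)
  qed
  also have "\<dots> = (\<Sum>i<N. \<Sum>j<N. scal d2 * (E p i i * x * E p j j)
      + (if j = i then scal (D i) * (E p i i * x * E p i i) else 0))"
    by (intro sum.cong refl) (auto simp: sum_D_d_d scal_hom distrib_right)
  also have "\<dots> = scal d2 * (\<pi> * x * \<pi>) + (\<Sum>i<N. scal (D i) * (E p i i * x * E p i i))"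
  proof -
    have "\<pi> * x * \<pi> = (\<Sum>i<N. \<Sum>j<N. E p i i * x * E p j j)"
      unfolding munit_sum[symmetric, of N p] sum_distrib_left sum_distrib_right by (subst sum.swap) simp
    then show ?thesis by (simp add: sum.distrib sum_distrib_left)
  qed
  also have "(scal d2 * (\<pi> * x * \<pi>) + (\<Sum>i<N. scal (D i) * (E p i i * x * E p i i))) * \<pi> +
      (\<Sum>b<N. \<Sum>i<N. if i = b then 0 else scal (D b) * (E p i b * x * E p b i)) * \<pi> =
     scal d2 * (\<pi> * x * \<pi>) * \<pi> + F p x * \<pi>"
  proof -
    have "F p x = (\<Sum>b<N. \<Sum>i<N. (if i = b then scal (D b) * (E p b b * x * E p b b) else 0) +
       (if i = b then 0 else scal (D b) * (E p i b * x * E p b i)))"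
      unfolding F_def by (intro sum.cong refl) auto
    then show ?thesis by (simp add: sum.distrib distrib_right)
  qed
  finally show ?thesis by (simp add: mult.assoc valid_op_idem)
qed

lemma F_\<pi>: "F p x * \<pi> = F p x" "\<pi> * F p x = F p x"
  unfolding F_def sum_distrib_right sum_distrib_left
  by (intro sum.cong refl; simp add: mult.assoc munit_valid_op scal_left_commute[of \<pi>])+
     (simp add: mult.assoc[symmetric] munit_valid_op)

lemma F_u: "1 \<le> n \<Longrightarrow> F (Suc n) (u n) = scal d1 * \<pi>"
proof -
  have 1: "E (Suc n) l b * u n * E (Suc n) b l = P n b * E (Suc n) l l"
    if "b < N" "l < N" for b l
  proof -
    have 0: "(\<Sum>i<N. if i = b then 0 else E n i b * E (Suc n) l i) * E (Suc n) b l = 0"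
      unfolding sum_distrib_right by (rule sum.neutral) (auto simp: mult.assoc munit_mult)
    show ?thesis
      unfolding u_def using that
      by (subst E_row_U2) (simp_all add: distrib_right 0 mult.assoc munit_mult)
  qed
  have "F (Suc n) (u n) = (\<Sum>b<N. \<Sum>l<N. scal (D b) * P n b * E (Suc n) l l)"
    unfolding F_def by (intro sum.cong refl) (simp add: 1, simp add: mult.assoc)
  also have "\<dots> = (\<Sum>b<N. scal (D b) * P n b) * \<pi>"
    by (simp add: sum_scal_E_diag sum_distrib_right)
  also have "(\<Sum>b<N. scal (D b) * P n b) = (\<Sum>b<N. \<Sum>i<N. scal (if b = i then 0 else D b * d i b) * E n i i)"
    unfolding P_def sum_distrib_left
    by (intro sum.cong refl) (auto simp: scal_hom mult.assoc)
  also have "\<dots> = (\<Sum>i<N. scal (\<Sum>b<N. if b = i then 0 else D b * d i b) * E n i i)"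
    by (subst sum.swap) (simp add: scal_sum sum_distrib_right)
  also have "\<dots> = (\<Sum>i<N. scal d1 * E n i i)" by (simp add: sum_D_d)
  also have "\<dots> * \<pi> = scal d1 * \<pi>" by (simp add: sum_scal_E_diag mult.assoc valid_op_idem)
  finally show ?thesis .
qed

end

context N_state begin

text \<open>Only the summand \<open>l = a n\<close> of the definition is nonzero at \<open>a\<close>.\<close>

lemma app_F:
  assumes "valid N a"
  shows "app (F n T) f a = (\<Sum>b<N. D b * app T (app (E n b (a n)) f) (a(n := b)))"
proof -
  have "app (F n T) f a = (\<Sum>b<N. \<Sum>l<N. if l = a n then D b * app T (app (E n b l) f) (a(n := b)) else 0)"
    unfolding F_def app_sum_op
    by (intro sum.cong refl) (use assms in \<open>auto simp: app_simps app_munit\<close>)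
  then show ?thesis using assms by (simp add: valid_less)
qed

lemma F_\<epsilon>: "F n (\<epsilon> n) = scal (\<Sum>b<N. D b * (\<alpha> b * \<alpha> b)) * \<pi>"
proof (rule lin_op_eqI)
  fix f a
  show "app (F n (\<epsilon> n)) f a = app (scal (\<Sum>b<N. D b * (\<alpha> b * \<alpha> b)) * \<pi>) f a"
  proof (cases "valid N a")
    case True
    have "app (\<epsilon> n) (app (E n b (a n)) f) (a(n := b)) = \<alpha> b * \<alpha> b * f a" if b: "b < N" for b
    proof -
      have "app (E n b (a n)) f (a(n := j)) = (if j = b then f a else 0)" if "j < N" for j
        using True that by (simp add: app_munit valid_upd)
      then have "app (\<epsilon> n) (app (E n b (a n)) f) (a(n := b)) =
          \<alpha> b * (\<Sum>j<N. \<alpha> j * (if j = b then f a else 0))"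
        using True b by (simp add: app_\<epsilon> valid_upd)
      also have "(\<Sum>j<N. \<alpha> j * (if j = b then f a else 0)) = (\<Sum>j<N. if j = b then \<alpha> b * f a else 0)"
        by (intro sum.cong) auto
      finally have "app (\<epsilon> n) (app (E n b (a n)) f) (a(n := b)) =
          \<alpha> b * (\<Sum>j<N. if j = b then \<alpha> b * f a else 0)" .
      then show ?thesis using b by simp
    qed
    then show ?thesis using True
      by (simp add: app_F app_simps app_valid_op sum_distrib_right mult.assoc)
  next
    case False
    then show ?thesis by (auto simp: F_def app_sum_op app_simps app_munit app_valid_op intro!: sum.neutral)
  qed
qed

text \<open>The coordinates of \<open>U (\<alpha> \<otimes> \<alpha>)\<close>.\<close>

definition W :: "nat \<Rightarrow> nat \<Rightarrow> 'a" where "W = U_fun (\<lambda>x y. \<alpha> x * \<alpha> y)"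

definition a2 where "a2 = (2 + s\<^sup>2 + inverse (s\<^sup>2)) / (w\<^sup>2 * w\<^sup>2)"
definition a1 where "a1 = (2 + s\<^sup>2 + inverse (s\<^sup>2)) * (\<Sum>b=1..<N-1. D b * (\<alpha> b * \<alpha> b))"

lemma W_eq: "W x b = (if x = b then 0 else \<alpha> x * \<alpha> b * (1 + d x b))"
  by (simp add: W_def U_fun_def algebra_simps)

lemma d_cases: "x < b \<Longrightarrow> d x b = inverse (s\<^sup>2)" "b < x \<Longrightarrow> d x b = s\<^sup>2"
  by (simp_all add: d_def)

text \<open>The sequence \<open>D \<alpha>\<^sup>2\<close> is geometric with ratio \<open>q\<close>, and the products of \<open>1 + q\<close> and \<open>1 + 1/q\<close> are
\<open>2 + q + 1/q\<close> times a power of \<open>q\<close> that shifts it by one step. The extra diagonal term does not depend on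
\<open>x\<close>, because \<open>\<alpha>\<^sup>4 D\<close> is constant.\<close>

lemma sum_D_W_W:
  assumes "x < N" "j < N"
  shows "(\<Sum>b<N. D b * W x b * W j b) = a1 * \<alpha> x * \<alpha> j + (if x = j then a2 else 0)"
proof -
  define T where "T = (\<lambda>b. D b * (\<alpha> b * \<alpha> b))"
  define m where "m = 2 + s\<^sup>2 + inverse (s\<^sup>2)"
  have T_Suc: "T (Suc b) = T b * s\<^sup>2" for b
    using s_0 by (simp add: T_def D_Suc \<alpha>_sq_Suc field_simps)
  have T_pred: "T (b - 1) = T b * inverse (s\<^sup>2)" if "0 < b" for b
    using T_Suc[of "b - 1"] that s_0 by (simp add: One_nat_def field_simps)
  have mm: "(1 + s\<^sup>2) * (1 + s\<^sup>2) = m * s\<^sup>2" "(1 + inverse (s\<^sup>2)) * (1 + s\<^sup>2) = m"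
    "(1 + s\<^sup>2) * (1 + inverse (s\<^sup>2)) = m" "(1 + inverse (s\<^sup>2)) * (1 + inverse (s\<^sup>2)) = m * inverse (s\<^sup>2)"
    using s_0 by (simp_all add: m_def field_simps)
  have a1: "a1 = m * (\<Sum>b=1..<N-1. T b)" by (simp add: a1_def m_def T_def)
  have off: "(\<Sum>b<N. D b * W x b * W j b) = a1 * \<alpha> x * \<alpha> j" if "x < j" "j < N" for x j
  proof -
    have "(\<Sum>b<N. D b * W x b * W j b) = (\<Sum>b<N. \<alpha> x * \<alpha> j * m * (if b = x \<or> b = j then 0
       else if b < x then T (Suc b) else if b < j then T b else T (b - 1)))"
    proof (intro sum.cong refl)
      fix b
      have "D b * W x b * W j b = (if b = x \<or> b = j then 0 else \<alpha> x * \<alpha> j * (T b * ((1 + d x b) * (1 + d j b))))"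
        by (simp add: W_eq T_def)
      also have "\<dots> = \<alpha> x * \<alpha> j * m * (if b = x \<or> b = j then 0
         else if b < x then T (Suc b) else if b < j then T b else T (b - 1))"
      proof -
        consider "b = x \<or> b = j" | "b < x" | "x < b" "b < j" | "j < b" by linarith
        then show ?thesis
        proof cases
          case 2
          with that show ?thesis by (simp add: d_cases mm T_Suc)
        next
          case 3
          with that show ?thesis by (simp add: d_cases mm)
        next
          case 4
          with that show ?thesis by (simp add: d_cases mm T_pred)
        qed simp
      qed
      finally show "D b * W x b * W j b = \<dots>" .
    qed
    also have "\<dots> = a1 * \<alpha> x * \<alpha> j"
      unfolding sum_distrib_left[symmetric] sum_shift[OF that]
      by (simp add: a1)
    finally show ?thesis .
  qed
  have "(\<Sum>b<N. D b * W x b * W j b) = a1 * \<alpha> x * \<alpha> j + a2" if "x = j"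
  proof -
    have "(\<Sum>b<N. D b * W x b * W x b) = (\<Sum>b<N. \<alpha> x * \<alpha> x * m * (if b = x then 0
       else if b < x then T (Suc b) else T (b - 1)))"
    proof (intro sum.cong refl)
      fix b
      have "D b * W x b * W x b = (if b = x then 0 else \<alpha> x * \<alpha> x * (T b * ((1 + d x b) * (1 + d x b))))"
        by (simp add: W_eq T_def)
      also have "\<dots> = \<alpha> x * \<alpha> x * m * (if b = x then 0 else if b < x then T (Suc b) else T (b - 1))"
      proof -
        consider "b = x" | "b < x" | "x < b" by linarith
        then show ?thesis
        proof cases
          case 2
          with that show ?thesis by (simp add: d_cases mm T_Suc)
        next
          case 3
          with that show ?thesis by (simp add: d_cases mm T_pred)
        qed simp
      qed
      finally show "D b * W x b * W x b = \<dots>" .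
    qed
    also have "\<dots> = \<alpha> x * \<alpha> x * m * ((\<Sum>b=1..<N-1. T b) + T x)"
      unfolding sum_distrib_left[symmetric] sum_shift_diag[OF assms(1)] ..
    also have "\<dots> = a1 * \<alpha> x * \<alpha> x + m * (\<alpha> x * \<alpha> x * T x)"
      by (simp add: a1 algebra_simps)
    also have "\<alpha> x * \<alpha> x * T x = 1 / (w\<^sup>2 * w\<^sup>2)"
    proof -
      have "s powi (2 * int k - 2 * int x) * (s powi (4 * int x - 4 * int k) * s powi (2 * int k - 2 * int x)) = 1"
        by (simp add: s_powi)
      then show ?thesis by (simp add: T_def \<alpha>_sq D_def)
    qed
    also have "m * \<dots> = a2" by (simp add: a2_def m_def)
    finally show ?thesis using that by simp
  qed
  moreover have "(\<Sum>b<N. D b * W x b * W j b) = a1 * \<alpha> x * \<alpha> j" if "j < x"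
    using off[OF that assms(1)] by (simp add: mult.commute mult.left_commute)
  ultimately show ?thesis using off[of x j] assms by (cases x j rule: linorder_cases) auto
qed

text \<open>The operator in question is \<open>f \<mapsto> W \<langle>W, f\<rangle>\<close> in the two entries, and the partial trace contracts the
second entries of the two copies of \<open>W\<close>.\<close>

lemma F_U2_\<epsilon>\<epsilon>_U2:
  assumes "p \<noteq> q"
  shows "F q (U2 p q * (\<epsilon> p * \<epsilon> q) * U2 p q) = scal a1 * \<epsilon> p + scal a2 * \<pi>"
proof (rule lin_op_eqI2[where p = p and q = q])
  fix f :: "(nat \<Rightarrow> nat) \<Rightarrow> 'a" and a x y
  assume a: "valid N a" and xy: "x < N" "y < N"
  define T where "T = U2 p q * (\<epsilon> p * \<epsilon> q) * U2 p q"
  have \<epsilon>\<epsilon>: "app (\<epsilon> p * \<epsilon> q) h (a(p := x, q := y)) =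
      \<alpha> x * \<alpha> y * (\<Sum>x<N. \<Sum>y<N. \<alpha> x * \<alpha> y * h (a(p := x, q := y)))" if "x < N" "y < N" for h x y
    using that by (simp add: app_simps app_\<epsilon>_upd[OF assms a] sum_distrib_left mult.assoc mult.left_commute)
  have T: "app T h (a(p := x, q := b)) = W x b * (\<Sum>j<N. \<Sum>l<N. W j l * h (a(p := j, q := l)))"
    if "x < N" "b < N" for h x b
  proof -
    define S where "S = (\<Sum>j<N. \<Sum>l<N. \<alpha> j * \<alpha> l * app (U2 p q) h (a(p := j, q := l)))"
    have "S = (\<Sum>j<N. \<Sum>l<N. \<alpha> j * \<alpha> l * U_fun (\<lambda>j l. h (a(p := j, q := l))) j l)"
      unfolding S_def by (intro sum.cong refl) (simp add: app_U2_upd[OF assms a])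
    also have "\<dots> = (\<Sum>j<N. \<Sum>l<N. W j l * h (a(p := j, q := l)))"
      unfolding W_def by (rule U_fun_adjoint)
    finally have S: "S = \<dots>" .
    define h' where "h' = app (\<epsilon> p * \<epsilon> q) (app (U2 p q) h)"
    have h': "h' (a(p := x, q := y)) = \<alpha> x * \<alpha> y * S" if "x < N" "y < N" for x y
      unfolding h'_def S_def using that by (rule \<epsilon>\<epsilon>)
    have "app T h (a(p := x, q := b)) = app (U2 p q) h' (a(p := x, q := b))"
      by (simp add: T_def h'_def app_simps(6))
    also have "\<dots> = U_fun (\<lambda>x y. h' (a(p := x, q := y))) x b"
      using that by (rule app_U2_upd[OF assms a])
    also have "\<dots> = W x b * S"
      using that by (simp add: U_fun_def W_def h' algebra_simps)
    finally show ?thesis unfolding S .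
  qed
  have "app (F q T) f (a(p := x, q := y)) =
      (\<Sum>b<N. D b * app T (app (E q b y) f) (a(p := x, q := b)))"
    using a xy assms by (simp add: app_F valid_upd)
  also have "\<dots> = (\<Sum>b<N. D b * W x b * (\<Sum>j<N. W j b * f (a(p := j, q := y))))"
  proof (intro sum.cong refl)
    fix b assume b: "b \<in> {..<N}"
    have "(\<Sum>l<N. W j l * app (E q b y) f (a(p := j, q := l))) = W j b * f (a(p := j, q := y))"
      if "j < N" for j
    proof -
      have "(\<Sum>l<N. W j l * app (E q b y) f (a(p := j, q := l))) =
        (\<Sum>l<N. if l = b then W j b * f (a(p := j, q := y)) else 0)"
        using a that by (intro sum.cong) (auto simp: app_munit valid_upd)
      then show ?thesis using b by simp
    qed
    then show "D b * app T (app (E q b y) f) (a(p := x, q := b)) =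
        D b * W x b * (\<Sum>j<N. W j b * f (a(p := j, q := y)))"
      using b xy by (simp add: T)
  qed
  also have "\<dots> = (\<Sum>j<N. (\<Sum>b<N. D b * W x b * W j b) * f (a(p := j, q := y)))"
    unfolding sum_distrib_left sum_distrib_right by (subst sum.swap) (simp add: mult.assoc)
  also have "\<dots> = (\<Sum>j<N. a1 * (\<alpha> x * (\<alpha> j * f (a(p := j, q := y)))) +
      (if j = x then a2 * f (a(p := x, q := y)) else 0))"
  proof (intro sum.cong refl)
    fix j assume "j \<in> {..<N}"
    then show "(\<Sum>b<N. D b * W x b * W j b) * f (a(p := j, q := y)) =
        a1 * (\<alpha> x * (\<alpha> j * f (a(p := j, q := y)))) + (if j = x then a2 * f (a(p := x, q := y)) else 0)"
      using xy by (subst sum_D_W_W) (auto simp: algebra_simps)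
  qed
  also have "\<dots> = app (scal a1 * \<epsilon> p + scal a2 * \<pi>) f (a(p := x, q := y))"
    using xy a by (simp add: app_simps app_\<epsilon>_upd[OF assms a] sum.distrib sum_distrib_left[symmetric]
        app_valid_op valid_upd)
  finally show "app (F q (U2 p q * (\<epsilon> p * \<epsilon> q) * U2 p q)) f (a(p := x, q := y)) =
     app (scal a1 * \<epsilon> p + scal a2 * \<pi>) f (a(p := x, q := y))"
    unfolding T_def .
next
  fix f :: "(nat \<Rightarrow> nat) \<Rightarrow> 'a" and a
  assume "\<not> valid N a"
  then show "app (F q (U2 p q * (\<epsilon> p * \<epsilon> q) * U2 p q)) f a = app (scal a1 * \<epsilon> p + scal a2 * \<pi>) f a"
    by (auto simp: F_def app_sum_op app_simps app_munit app_valid_op app_\<epsilon> intro!: sum.neutral)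
qed

section \<open>The trace\<close>

text \<open>The full trace is the iterated partial trace. After \<open>n\<close> steps an operator on the first \<open>n\<close> factors has
become a scalar, which is read off from its action on the constant function.\<close>

fun Tr :: "nat \<Rightarrow> (nat \<Rightarrow> nat, 'a) lin_op \<Rightarrow> 'a" where
  "Tr 0 T = app T (\<lambda>a. if valid N a then 1 else 0) (\<lambda>_. 0)"
| "Tr (Suc n) T = Tr n (F (Suc n) T)"

lemma Tr_add: "Tr n (x + y) = Tr n x + Tr n y"
  by (induction n arbitrary: x y) (simp_all add: app_simps F_add)

lemma Tr_scal: "Tr n (scal l * x) = l * Tr n x"
  by (induction n arbitrary: x) (simp_all add: app_simps F_scal)

lemma Tr_\<pi>: "Tr n (x * \<pi>) = Tr n x"
proof (induction n arbitrary: x)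
  case 0
  have "app \<pi> (\<lambda>a. if valid N a then 1 else 0) = (\<lambda>a. if valid N a then 1 else (0::'a))"
    by (auto simp: app_valid_op)
  then show ?case by (simp add: app_simps)
next
  case (Suc n)
  have "F (Suc n) (x * \<pi>) = F (Suc n) x * \<pi>"
    by (rule F_right) (simp add: munit_valid_op)
  then show ?case using Suc.IH by simp
qed

text \<open>A matrix unit is moved around the partial trace at the price of a quotient of entries of \<open>D\<close>. In every
term of \<open>U\<close> these quotients cancel, since \<open>U\<close> preserves the multiset of indices.\<close>

lemma F_unit:
  assumes "i < N" "j < N"
  shows "scal (D j) * F n (E n i j * T) = scal (D i) * F n (T * E n i j)"
proof -
  have "F n (E n i j * T) = (\<Sum>b<N. \<Sum>l<N. if b = i then scal (D i) * (E n l j * T * E n i l) else 0)"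
    unfolding F_def
    by (intro sum.cong refl) (auto simp: munit_mult mult.assoc[symmetric] assms)
  also have "\<dots> = (\<Sum>l<N. scal (D i) * (E n l j * T * E n i l))"
    using assms by (subst sum.swap) simp
  finally have 1: "F n (E n i j * T) = \<dots>" .
  have "F n (T * E n i j) = (\<Sum>b<N. \<Sum>l<N. if b = j then scal (D j) * (E n l j * T * E n i l) else 0)"
    unfolding F_def
    by (intro sum.cong refl) (auto simp: munit_mult mult.assoc assms)
  also have "\<dots> = (\<Sum>l<N. scal (D j) * (E n l j * T * E n i l))"
    using assms by (subst sum.swap) simp
  finally have 2: "F n (T * E n i j) = \<dots>" .
  show ?thesis unfolding 1 2 sum_distrib_left
    by (intro sum.cong refl) (simp add: mult.assoc[symmetric] scal_hom(2)[symmetric] mult.commute)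
qed

lemma F_F_unit:
  assumes "p \<noteq> q" "i < N" "j < N" "i' < N" "j' < N"
  shows "scal (D j * D j') * F p (F q (E p i j * E q i' j' * T)) =
    scal (D i * D i') * F p (F q (T * (E p i j * E q i' j')))"
proof -
  have com: "E q l b * E p i j = E p i j * E q l b" if "b < N" for l b
    using assms that by (intro munit_commute) auto
  have "scal (D j * D j') * F p (F q (E p i j * E q i' j' * T)) =
     scal (D j) * F p (E p i j * (scal (D j') * F q (E q i' j' * T)))"
    by (simp add: scal_hom mult.assoc F_left[of q "E p i j"] com scal_left_commute[of "E p i j"] F_scal)
  also have "\<dots> = scal (D j) * F p (E p i j * (scal (D i') * F q (T * E q i' j')))"
    by (subst F_unit) (use assms in auto)
  also have "\<dots> = scal (D i') * (scal (D j) * F p (E p i j * F q (T * E q i' j')))"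
    by (simp add: scal_left_commute[of "E p i j"] F_scal scal_left_commute[of "scal (D j)"])
  also have "\<dots> = scal (D i') * (scal (D i) * F p (F q (T * E q i' j') * E p i j))"
    by (subst F_unit) (use assms in auto)
  also have "F q (T * E q i' j') * E p i j = F q (T * (E p i j * E q i' j'))"
    using F_right[of q "E p i j" "T * E q i' j'"] com assms by (simp add: mult.assoc)
  finally show ?thesis by (simp add: scal_hom mult.assoc scal_left_commute[of "scal (D i)"])
qed

lemma D_nonzero: "D i \<noteq> 0"
  using s_0 by (simp add: D_def)

lemma scal_cancel:
  fixes l :: 'a
  assumes "l \<noteq> 0" "scal l * x = scal l * y"
  shows "x = y"
proof -
  have "scal (inverse l) * (scal l * x) = scal (inverse l) * (scal l * y)" using assms by simp
  then show ?thesis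
    using assms(1) by (simp only: mult.assoc[symmetric] scal_hom(2)[symmetric]) (simp add: scal_hom)
qed

lemma F_F_U2:
  assumes "p \<noteq> q"
  shows "F p (F q (U2 p q * T)) = F p (F q (T * U2 p q))"
proof -
  have "F p (F q (E p i i * E q j j * T)) = F p (F q (T * (E p i i * E q j j)))"
    "F p (F q (E p i j * E q j i * T)) = F p (F q (T * (E p i j * E q j i)))"
    if "i < N" "j < N" for i j
    using F_F_unit[of p q i i j j T] F_F_unit[of p q i j j i T] assms that D_nonzero
    by (auto intro!: scal_cancel[of "D i * D j"] simp: mult.commute[of "D j"])
  then show ?thesis
    unfolding U2_def sum_distrib_left sum_distrib_right F_sum
    by (intro sum.cong refl)
       (auto simp: distrib_left distrib_right F_add F_scal mult.assoc scal_left_commute[of T])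
qed

lemma Tr_u: "1 \<le> i \<Longrightarrow> i < n \<Longrightarrow> Tr n (u i * x) = Tr n (x * u i)"
proof (induction n arbitrary: x)
  case (Suc n)
  show ?case
  proof (cases "i < n")
    case True
    have "F (Suc n) (u i * x) = u i * F (Suc n) x"
      by (rule F_left) (use True in \<open>auto intro: E_u\<close>)
    moreover have "F (Suc n) (x * u i) = F (Suc n) x * u i"
      by (rule F_right) (use True in \<open>auto intro: E_u\<close>)
    ultimately show ?thesis using Suc True by simp
  next
    case False
    with Suc.prems have "i = n" "n \<noteq> 0" by auto
    then obtain m where "n = Suc m" "i = Suc m" by (cases n) auto
    then show ?thesis using F_F_U2[of "Suc m" "Suc (Suc m)" x] by (simp add: u_def)
  qed
qed simp

definition d0 where "d0 = (\<Sum>b<N. D b)"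
definition f1 where "f1 = (\<Sum>b<N. D b * (\<alpha> b * \<alpha> b))"

sublocale C_tower_trace u e "s\<^sup>2 + inverse (s\<^sup>2)" c F \<pi> d0 d1 d2 a1 a2 f1 Tr
proof
  show "F n (x + y) = F n x + F n y" for n x y by (rule F_add)
  show "F (Suc n) (z * x) = z * F (Suc n) x" if "z \<in> A n" for n x z
    by (rule F_left) (use that in \<open>auto intro: E_A\<close>)
  show "F (Suc n) (x * z) = F (Suc n) x * z" if "z \<in> A n" for n x z
    by (rule F_right) (use that in \<open>auto intro: E_A\<close>)
  show "F (Suc n) 1 = scal d0 * \<pi>" for n unfolding d0_def by (rule F_1)
  show "F (Suc n) (u n) = scal d1 * \<pi>" if "1 \<le> n" for n using that by (rule F_u)
  show "F (Suc n) (u n * x * u n) = scal d2 * (x * \<pi>) + F n x" if "1 \<le> n" "x \<in> A n" for n x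
  proof -
    have "F (Suc n) (u n * x * u n) = scal d2 * (\<pi> * x * \<pi>) + F n x * \<pi>"
      unfolding u_def by (rule F_u_mid) (use that in \<open>auto intro: E_A\<close>)
    then show ?thesis by (simp add: \<pi>_A[OF that(2)] mult.assoc valid_op_idem F_\<pi>)
  qed
  show "F (Suc n) (u n * e (Suc n) * u n) = (scal a1 * e n + scal a2 * e (n - 1)) * \<pi>" if n: "1 \<le> n" for n
  proof -
    obtain m where m: "n = Suc m" using n by (cases n) auto
    have "u n * e (Suc n) * u n = (u n * e m) * (\<epsilon> n * \<epsilon> (Suc n)) * u n"
      by (simp add: m mult.assoc)
    also have "u n * e m = e m * u n" unfolding u_def by (rule e_U2[symmetric]) (auto simp: m)
    also have "e m * u n * (\<epsilon> n * \<epsilon> (Suc n)) * u n = e m * (U2 n (Suc n) * (\<epsilon> n * \<epsilon> (Suc n)) * U2 n (Suc n))"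
      by (simp add: u_def mult.assoc)
    finally have "F (Suc n) (u n * e (Suc n) * u n) =
        F (Suc n) (e m * (U2 n (Suc n) * (\<epsilon> n * \<epsilon> (Suc n)) * U2 n (Suc n)))" by simp
    also have "\<dots> = e m * F (Suc n) (U2 n (Suc n) * (\<epsilon> n * \<epsilon> (Suc n)) * U2 n (Suc n))"
      by (rule F_left) (auto simp: m intro: E_e)
    also have "F (Suc n) (U2 n (Suc n) * (\<epsilon> n * \<epsilon> (Suc n)) * U2 n (Suc n)) = scal a1 * \<epsilon> n + scal a2 * \<pi>"
      by (rule F_U2_\<epsilon>\<epsilon>_U2) simp
    also have "e m * \<dots> = (scal a1 * e n + scal a2 * e (n - 1)) * \<pi>"
      by (simp add: m One_nat_def distrib_left distrib_right mult.assoc scal_left_commute[of "e m"] \<pi>_\<epsilon>)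
    finally show ?thesis .
  qed
  show "F 1 (e 1) = scal f1 * \<pi>" using F_\<epsilon>[of 1] by (simp add: f1_def One_nat_def)
  show "\<pi> * x = x * \<pi>" if "x \<in> A n" for x n using that by (rule \<pi>_A)
  show "Tr (Suc n) x = Tr n (F (Suc n) x)" for n x by simp
  show "Tr n (x + y) = Tr n x + Tr n y" for n x y by (rule Tr_add)
  show "Tr n (scal l * x) = l * Tr n x" for n l x by (rule Tr_scal)
  show "Tr n (x * \<pi>) = Tr n x" for n x by (rule Tr_\<pi>)
  show "Tr n (u i * x) = Tr n (x * u i)" if "1 \<le> i" "i < n" for n i x using that by (rule Tr_u)
qed

end

section \<open>Operators and matrices\<close>

lemma mult_add_less: "I < M \<Longrightarrow> b < N \<Longrightarrow> I * N + b < M * (N::nat)"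
proof -
  assume "I < M" "b < N"
  then have "I * N + b < Suc I * N" by simp
  also have "\<dots> \<le> M * N" using \<open>I < M\<close> by (intro mult_le_mono1) simp
  finally show ?thesis .
qed

lemma sum_div_mod:
  fixes g :: "nat \<Rightarrow> 'a::comm_monoid_add"
  assumes "0 < N"
  shows "(\<Sum>I<M. \<Sum>b<N. g (I * N + b)) = (\<Sum>J<M * N. g J)"
  unfolding sum.cartesian_product
  by (rule sum.reindex_bij_witness[of _ "\<lambda>J. (J div N, J mod N)" "\<lambda>(I, b). I * N + b"])
     (use assms in \<open>auto simp: mult_add_less less_mult_imp_div_less\<close>)

lemma mod_div_pow:
  assumes "m < n" "0 < N"
  shows "(I mod N ^ n) div N ^ m mod N = I div N ^ m mod (N::nat)"
proof -
  define l where "l = n - m - 1"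
  have n: "N ^ n = N ^ m * (N * N ^ l)"
    using assms by (simp add: l_def power_add[symmetric] One_nat_def flip: power_Suc)
  have "I mod N ^ n = N ^ m * (I div N ^ m mod (N * N ^ l)) + I mod N ^ m"
    unfolding n by (rule mod_mult2_eq)
  then have "(I mod N ^ n) div N ^ m = I div N ^ m mod (N * N ^ l)"
    using assms by simp
  then show ?thesis by (simp add: mod_mod_cancel)
qed

lemma kron_dims: "dim_row (kron A B) = dim_row A * dim_row B" "dim_col (kron A B) = dim_col A * dim_col B"
  by (simp_all add: kron_def)

lemma index_kron:
  "I < dim_row A * dim_row B \<Longrightarrow> J < dim_col A * dim_col B \<Longrightarrow>
   kron A B $$ (I, J) = A $$ (I div dim_row B, J div dim_col B) * B $$ (I mod dim_row B, J mod dim_col B)"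
  by (simp add: kron_def)

context N_state begin

lemma N_pos: "0 < N" using N by simp

text \<open>Entry \<open>t\<close> is digit \<open>t\<close>, counted from the left, of the \<open>n\<close>-digit expansion of \<open>I\<close> in base \<open>N\<close>: the
lexicographic numbering of the basis of the \<open>n\<close>-th tensor power.\<close>

definition digits :: "nat \<Rightarrow> nat \<Rightarrow> nat \<Rightarrow> nat" where
  "digits n I t = (if 1 \<le> t \<and> t \<le> n then I div N ^ (n - t) mod N else 0)"

lemma valid_digits: "valid N (digits n I)"
  using N_pos by (simp add: valid_def digits_def)

lemma digits_less: "digits n I t < N"
  using N_pos by (simp add: digits_def)

lemma digits_Suc: "digits (Suc n) I = (digits n (I div N))(Suc n := I mod N)"
proof
  fix t
  show "digits (Suc n) I t = ((digits n (I div N))(Suc n := I mod N)) t"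
    by (cases "t \<le> n") (auto simp: digits_def Suc_diff_le div_mult2_eq)
qed

lemma digits_snoc: "b < N \<Longrightarrow> digits (Suc n) (I * N + b) = (digits n I)(Suc n := b)"
  by (simp add: digits_Suc)

lemma digits_inj: "I < N ^ n \<Longrightarrow> J < N ^ n \<Longrightarrow> (\<forall>t\<in>{1..n}. digits n I t = digits n J t) \<longleftrightarrow> I = J"
proof (induction n arbitrary: I J)
  case 0
  then show ?case by simp
next
  case (Suc n)
  have "(\<forall>t\<in>{1..Suc n}. digits (Suc n) I t = digits (Suc n) J t) \<longleftrightarrow>
    I mod N = J mod N \<and> (\<forall>t\<in>{1..n}. digits n (I div N) t = digits n (J div N) t)"
    by (auto simp: digits_Suc le_Suc_eq)
  also have "\<dots> \<longleftrightarrow> I mod N = J mod N \<and> I div N = J div N"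
    using Suc.prems by (subst Suc.IH) (auto simp: less_mult_imp_div_less mult.commute)
  also have "\<dots> \<longleftrightarrow> I = J" by (metis div_mod_decomp)
  finally show ?case .
qed

lemma digits_surj: "valid N a \<Longrightarrow> \<exists>J<N ^ n. \<forall>t\<in>{1..n}. digits n J t = a t"
proof (induction n)
  case (Suc n)
  then obtain J where J: "J < N ^ n" "\<forall>t\<in>{1..n}. digits n J t = a t" by auto
  have "a (Suc n) < N" using Suc.prems by (rule valid_less)
  with J show ?case
    by (intro exI[of _ "J * N + a (Suc n)"])
       (auto simp: digits_snoc mult_add_less mult.commute[of N])
qed simp

definition basis :: "nat \<Rightarrow> nat \<Rightarrow> (nat \<Rightarrow> nat) \<Rightarrow> 'a" where
  "basis n J a = (if valid N a \<and> (\<forall>t\<in>{1..n}. a t = digits n J t) then 1 else 0)"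

text \<open>The \<open>n\<close>-th tensor power, as the functions of the first \<open>n\<close> entries.\<close>

definition tensors :: "nat \<Rightarrow> ((nat \<Rightarrow> nat) \<Rightarrow> 'a) set" where
  "tensors n = {f. (\<forall>a. \<not> valid N a \<longrightarrow> f a = 0) \<and>
     (\<forall>a b. valid N a \<longrightarrow> valid N b \<longrightarrow> (\<forall>t\<in>{1..n}. a t = b t) \<longrightarrow> f a = f b)}"

definition preserves :: "nat \<Rightarrow> (nat \<Rightarrow> nat, 'a) lin_op \<Rightarrow> bool" where
  "preserves n T \<longleftrightarrow> (\<forall>f\<in>tensors n. app T f \<in> tensors n)"

definition Mat :: "nat \<Rightarrow> (nat \<Rightarrow> nat, 'a) lin_op \<Rightarrow> 'a mat" where
  "Mat n T = mat (N ^ n) (N ^ n) (\<lambda>(I, J). app T (basis n J) (digits n I))"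

lemma tensors_cong:
  "f \<in> tensors n \<Longrightarrow> valid N a \<Longrightarrow> valid N b \<Longrightarrow> (\<And>t. t \<in> {1..n} \<Longrightarrow> a t = b t) \<Longrightarrow> f a = f b"
  unfolding tensors_def by blast

lemma tensors_invalid: "f \<in> tensors n \<Longrightarrow> \<not> valid N a \<Longrightarrow> f a = 0"
  unfolding tensors_def by blast

lemma tensorsI:
  assumes "\<And>a. \<not> valid N a \<Longrightarrow> f a = 0"
    "\<And>a b. valid N a \<Longrightarrow> valid N b \<Longrightarrow> (\<And>t. t \<in> {1..n} \<Longrightarrow> a t = b t) \<Longrightarrow> f a = f b"
  shows "f \<in> tensors n"
  unfolding tensors_def using assms by blast

lemma basis_tensor: "basis n J \<in> tensors n"
  by (auto simp: tensors_def basis_def)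

lemma tensor_expand:
  assumes "f \<in> tensors n"
  shows "f = (\<lambda>a. \<Sum>J<N ^ n. f (digits n J) * basis n J a)"
proof
  fix a
  show "f a = (\<Sum>J<N ^ n. f (digits n J) * basis n J a)"
  proof (cases "valid N a")
    case True
    then obtain K where K: "K < N ^ n" "\<forall>t\<in>{1..n}. digits n K t = a t"
      using digits_surj by blast
    have "(\<Sum>J<N ^ n. f (digits n J) * basis n J a) = (\<Sum>J<N ^ n. if J = K then f (digits n K) else 0)"
    proof (intro sum.cong refl)
      fix J assume "J \<in> {..<N ^ n}"
      then have "(\<forall>t\<in>{1..n}. a t = digits n J t) \<longleftrightarrow> J = K"
        using digits_inj[of J n K] K by (metis lessThan_iff)
      then show "f (digits n J) * basis n J a = (if J = K then f (digits n K) else 0)"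
        using True by (simp add: basis_def)
    qed
    also have "\<dots> = f (digits n K)" using K by simp
    also have "\<dots> = f a" using tensors_cong[OF assms valid_digits True] K by blast
    finally show ?thesis ..
  next
    case False
    then show ?thesis using assms by (simp add: tensors_def basis_def)
  qed
qed

lemma Mat_carrier: "Mat n T \<in> carrier_mat (N ^ n) (N ^ n)"
  by (simp add: Mat_def)

lemma Mat_mult:
  assumes "preserves n S"
  shows "Mat n (T * S) = Mat n T * Mat n S"
proof (rule eq_matI)
  fix I J assume "I < dim_row (Mat n T * Mat n S)" "J < dim_col (Mat n T * Mat n S)"
  then have IJ: "I < N ^ n" "J < N ^ n" by (simp_all add: Mat_def)
  have "app S (basis n J) \<in> tensors n" using assms basis_tensor by (simp add: preserves_def)
  from tensor_expand[OF this]
  have "app T (app S (basis n J)) (digits n I) =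
      app T (\<lambda>a. \<Sum>K<N ^ n. app S (basis n J) (digits n K) * basis n K a) (digits n I)"
    by (rule arg_cong)
  also have "\<dots> = (\<Sum>K<N ^ n. app S (basis n J) (digits n K) * app T (basis n K) (digits n I))"
    by (simp add: app_sum app_mult)
  finally show "Mat n (T * S) $$ (I, J) = (Mat n T * Mat n S) $$ (I, J)"
    using IJ by (simp add: Mat_def app_simps scalar_prod_def mult.commute atLeast0LessThan)
qed (simp_all add: Mat_def)

lemma Mat_add: "Mat n (S + T) = Mat n S + Mat n T"
  by (rule eq_matI) (simp_all add: Mat_def app_simps)

lemma Mat_scal: "Mat n (scal l) = l \<cdot>\<^sub>m 1\<^sub>m (N ^ n)"
proof (rule eq_matI)
  fix I J assume "I < dim_row (l \<cdot>\<^sub>m 1\<^sub>m (N ^ n))" "J < dim_col (l \<cdot>\<^sub>m 1\<^sub>m (N ^ n))"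
  then show "Mat n (scal l) $$ (I, J) = (l \<cdot>\<^sub>m 1\<^sub>m (N ^ n)) $$ (I, J)"
    using digits_inj[of I n J] by (auto simp: Mat_def app_simps basis_def valid_digits)
qed (simp_all add: Mat_def)

lemma Mat_1: "Mat n 1 = 1\<^sub>m (N ^ n)"
proof -
  have "1 \<cdot>\<^sub>m 1\<^sub>m (N ^ n) = (1\<^sub>m (N ^ n) :: 'a mat)" by (rule eq_matI) auto
  then show ?thesis using Mat_scal[of n 1] by (simp add: scal_hom)
qed

lemma preservesI: "(\<And>f. f \<in> tensors n \<Longrightarrow> app T f \<in> tensors n) \<Longrightarrow> preserves n T"
  by (simp add: preserves_def)

lemma preservesD: "preserves n T \<Longrightarrow> f \<in> tensors n \<Longrightarrow> app T f \<in> tensors n"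
  by (simp add: preserves_def)

lemma preserves_add:
  assumes "preserves n S" "preserves n T"
  shows "preserves n (S + T)"
proof (intro preservesI tensorsI)
  fix f a assume "f \<in> tensors n" "\<not> valid N a"
  then show "app (S + T) f a = 0"
    using assms[THEN preservesD, THEN tensors_invalid] by (simp add: app_simps)
next
  fix f a b assume *: "f \<in> tensors n" "valid N a" "valid N b" "\<And>t. t \<in> {1..n} \<Longrightarrow> a t = b t"
  have "app S f a = app S f b" using preservesD[OF assms(1) *(1)] *(2-4) by (rule tensors_cong)
  moreover have "app T f a = app T f b" using preservesD[OF assms(2) *(1)] *(2-4) by (rule tensors_cong)
  ultimately show "app (S + T) f a = app (S + T) f b" by (simp add: app_simps)
qed

lemma preserves_scal: "preserves n (scal l)"
proof (intro preservesI tensorsI)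
  fix f a assume "f \<in> tensors n" "\<not> valid N a"
  then show "app (scal l) f a = 0" by (simp add: app_simps tensors_invalid)
next
  fix f a b assume "f \<in> tensors n" "valid N a" "valid N b" "\<And>t. t \<in> {1..n} \<Longrightarrow> a t = b t"
  then have "f a = f b" by (rule tensors_cong)
  then show "app (scal l) f a = app (scal l) f b" by (simp add: app_simps)
qed

lemma preserves_mult: "preserves n S \<Longrightarrow> preserves n T \<Longrightarrow> preserves n (S * T)"
proof -
  have *: "app (S * T) f = app S (app T f)" for f by (rule ext) (simp add: app_simps)
  show "preserves n S \<Longrightarrow> preserves n T \<Longrightarrow> preserves n (S * T)" by (simp add: preserves_def *)
qed

lemma preserves_u:
  assumes "1 \<le> i" "i < n"
  shows "preserves n (u i)"
proof (intro preservesI tensorsI)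
  fix f a b
  assume f: "f \<in> tensors n" and va: "valid N a" and vb: "valid N b"
    and ab: "\<And>t. t \<in> {1..n} \<Longrightarrow> a t = b t"
  have eq: "a i = b i" "a (Suc i) = b (Suc i)" using assms by (auto intro!: ab)
  have "f (a(i := a (Suc i), Suc i := a i)) = f (b(i := b (Suc i), Suc i := b i))"
    using f by (rule tensors_cong) (use va vb ab eq in \<open>auto intro!: valid_upd intro: valid_less\<close>)
  moreover have "f a = f b" using f va vb ab by (rule tensors_cong)
  ultimately show "app (u i) f a = app (u i) f b" using va vb eq by (simp add: u_def app_U2)
qed (simp add: u_def app_U2)

lemma preserves_\<epsilon>:
  assumes "1 \<le> t" "t \<le> n"
  shows "preserves n (\<epsilon> t)"
proof (intro preservesI tensorsI)
  fix f a b
  assume f: "f \<in> tensors n" and va: "valid N a" and vb: "valid N b"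
    and ab: "\<And>t. t \<in> {1..n} \<Longrightarrow> a t = b t"
  have eq: "a t = b t" using assms by (intro ab) auto
  have "f (a(t := j)) = f (b(t := j))" if "j < N" for j
    using f by (rule tensors_cong) (use va vb ab that in \<open>auto intro: valid_upd\<close>)
  then show "app (\<epsilon> t) f a = app (\<epsilon> t) f b" using va vb eq by (simp add: app_\<epsilon>)
qed (simp add: app_\<epsilon>)

lemma preserves_e: "r \<le> n \<Longrightarrow> preserves n (e r)"
proof (induction r)
  case 0
  then show ?case using preserves_scal[of n 1] by (simp add: scal_hom)
next
  case (Suc r)
  then have "preserves n (e r * \<epsilon> (Suc r))" by (intro preserves_mult preserves_\<epsilon>) (auto simp: One_nat_def)
  then show ?case by simp
qed

lemma preserves_A: "x \<in> A n \<Longrightarrow> preserves n x"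
  unfolding A_def
  by (induction rule: generated.induct)
     (auto intro: preserves_scal preserves_add preserves_mult preserves_u preserves_e)

lemma basis_upd:
  assumes "valid N a"
  shows "basis n J a = (if \<forall>t\<in>{1..n}. a t = digits n J t then 1 else 0)"
  using assms by (simp add: basis_def)

text \<open>The last tensor factor corresponds to the last digit, so the partial trace over it is the inner
sum when the numbers below \<open>N ^ Suc n\<close> are written as \<open>I * N + b\<close>.\<close>

lemma Tr_eq_sum:
  "Tr n T = (\<Sum>I<N ^ n. (\<Prod>t=1..n. D (digits n I t)) * app T (basis n I) (digits n I))"
proof (induction n arbitrary: T)
  case 0
  have "basis 0 0 = (\<lambda>a. if valid N a then 1 else 0)" "digits 0 0 = (\<lambda>_. 0)"
    by (auto simp: basis_def digits_def fun_eq_iff)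
  then show ?case by (simp add: One_nat_def)
next
  case (Suc n)
  let ?g = "\<lambda>J. (\<Prod>t=1..Suc n. D (digits (Suc n) J t)) * app T (basis (Suc n) J) (digits (Suc n) J)"
  have "Tr (Suc n) T = (\<Sum>I<N ^ n. (\<Prod>t=1..n. D (digits n I t)) * app (F (Suc n) T) (basis n I) (digits n I))"
    by (simp add: Suc.IH)
  also have "\<dots> = (\<Sum>I<N ^ n. \<Sum>b<N. ?g (I * N + b))"
  proof (intro sum.cong refl)
    fix I
    have "app (E (Suc n) b 0) (basis n I) = basis (Suc n) (I * N + b)" if b: "b < N" for b
    proof
      fix a
      have "(\<forall>t\<in>{1..n}. (a(Suc n := 0)) t = digits n I t) \<and> a (Suc n) = b \<longleftrightarrow>
        (\<forall>t\<in>{1..Suc n}. a t = digits (Suc n) (I * N + b) t)"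
        unfolding digits_snoc[OF b] by (auto simp: le_Suc_eq)
      note eq = this
      show "app (E (Suc n) b 0) (basis n I) a = basis (Suc n) (I * N + b) a"
      proof (cases "valid N a \<and> a (Suc n) = b")
        case True
        then have "app (E (Suc n) b 0) (basis n I) a = basis n I (a(Suc n := 0))"
          by (simp add: app_munit)
        also have "\<dots> = (if \<forall>t\<in>{1..n}. (a(Suc n := 0)) t = digits n I t then 1 else 0)"
          using True N_pos by (intro basis_upd valid_upd) auto
        also have "\<dots> = basis (Suc n) (I * N + b) a"
          using True by (simp add: basis_def eq[symmetric] del: fun_upd_apply)
        finally show ?thesis .
      next
        case False
        then show ?thesis by (auto simp: app_munit basis_def eq[symmetric] simp del: fun_upd_apply)
      qed
    qed
    moreover have "digits n I (Suc n) = 0" by (simp add: digits_def)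
    moreover have "(\<Prod>t=1..Suc n. D (digits (Suc n) (I * N + b) t)) = (\<Prod>t=1..n. D (digits n I t)) * D b"
      if "b < N" for b
      using that by (simp add: digits_snoc)
    ultimately show "(\<Prod>t=1..n. D (digits n I t)) * app (F (Suc n) T) (basis n I) (digits n I) =
       (\<Sum>b<N. ?g (I * N + b))"
      by (simp add: app_F valid_digits digits_snoc sum_distrib_left mult.assoc)
  qed
  also have "\<dots> = (\<Sum>J<N ^ n * N. ?g J)" by (rule sum_div_mod[OF N_pos])
  finally show ?case by (simp add: mult.commute)
qed

lemma D_mat_eq: "D_mat s N = mat_diag N D"
proof -
  have "(s\<^sup>2) powi (2 * int (i + 1) - int N - 1) = D i" for i
  proof -
    have "(s\<^sup>2) powi (2 * int (i + 1) - int N - 1) = s powi (2 * (2 * int (i + 1) - int N - 1))"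
      by (metis of_nat_numeral power_int_mult power_int_of_nat)
    then show ?thesis by (simp add: D_def N algebra_simps)
  qed
  then show ?thesis by (simp add: D_mat_def)
qed

lemma digits_Suc_first: "I < N ^ Suc n \<Longrightarrow> digits (Suc n) I 1 = I div N ^ n"
  by (simp add: digits_def One_nat_def less_mult_imp_div_less mult.commute)

lemma digits_Suc_rest: "1 \<le> t \<Longrightarrow> digits (Suc n) I (Suc t) = digits n (I mod N ^ n) t"
  by (simp add: digits_def mod_div_pow N_pos)

lemma tensor_power_D:
  "tensor_power (D_mat s N) n = mat_diag (N ^ n) (\<lambda>I. \<Prod>t=1..n. D (digits n I t))"
proof (induction n)
  case 0
  then show ?case by (auto simp: mat_diag_def)
next
  case (Suc n)
  have tp: "tensor_power (D_mat s N) (Suc n) =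
      kron (mat_diag N D) (mat_diag (N ^ n) (\<lambda>I. \<Prod>t=1..n. D (digits n I t)))"
    by (simp only: tensor_power.simps Suc.IH) (simp only: D_mat_eq)
  show ?case
  proof (rule eq_matI)
    fix I J assume "I < dim_row (mat_diag (N ^ Suc n) (\<lambda>I. \<Prod>t=1..Suc n. D (digits (Suc n) I t)))"
      "J < dim_col (mat_diag (N ^ Suc n) (\<lambda>I. \<Prod>t=1..Suc n. D (digits (Suc n) I t)))"
    then have IJ: "I < N * N ^ n" "J < N * N ^ n" by (simp_all add: mat_diag_def)
    have pos: "0 < N ^ n" using N_pos by simp
    have IJ': "I div N ^ n < N" "J div N ^ n < N" "I mod N ^ n < N ^ n" "J mod N ^ n < N ^ n"
      using IJ pos by (auto simp: less_mult_imp_div_less)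
    have eq: "I = J \<longleftrightarrow> I div N ^ n = J div N ^ n \<and> I mod N ^ n = J mod N ^ n"
      by (metis div_mod_decomp)
    have "(\<Prod>t=1..Suc n. D (digits (Suc n) I t)) = D (digits (Suc n) I 1) * (\<Prod>t=Suc 1..Suc n. D (digits (Suc n) I t))"
      by (rule prod.atLeast_Suc_atMost) simp
    also have "(\<Prod>t=Suc 1..Suc n. D (digits (Suc n) I t)) = (\<Prod>t=1..n. D (digits (Suc n) I (Suc t)))"
      by (rule prod.shift_bounds_cl_Suc_ivl)
    also have "\<dots> = (\<Prod>t=1..n. D (digits n (I mod N ^ n) t))"
      by (intro prod.cong refl) (simp add: digits_Suc_rest)
    finally have "(\<Prod>t=1..Suc n. D (digits (Suc n) I t)) =
        D (I div N ^ n) * (\<Prod>t=1..n. D (digits n (I mod N ^ n) t))"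
      using IJ digits_Suc_first[of I n] by simp
    then have "mat_diag (N ^ Suc n) (\<lambda>I. \<Prod>t=1..Suc n. D (digits (Suc n) I t)) $$ (I, J) =
        (if I = J then D (I div N ^ n) * (\<Prod>t=1..n. D (digits n (I mod N ^ n) t)) else 0)"
      using IJ by (auto simp: mat_diag_def simp del: prod.cl_ivl_Suc)
    moreover have "tensor_power (D_mat s N) (Suc n) $$ (I, J) =
        (if I = J then D (I div N ^ n) * (\<Prod>t=1..n. D (digits n (I mod N ^ n) t)) else 0)"
      unfolding tp eq using IJ IJ' by (auto simp: kron_def mat_diag_def)
    ultimately show "tensor_power (D_mat s N) (Suc n) $$ (I, J) =
        mat_diag (N ^ Suc n) (\<lambda>I. \<Prod>t=1..Suc n. D (digits (Suc n) I t)) $$ (I, J)" by simp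
  qed (unfold tp, simp_all add: kron_def mat_diag_def)
qed

lemma mat_trace_Mat: "mat_trace (Mat n T * tensor_power (D_mat s N) n) = Tr n T"
proof -
  have "Mat n T * tensor_power (D_mat s N) n =
    mat (N ^ n) (N ^ n) (\<lambda>(I, J). Mat n T $$ (I, J) * (\<Prod>t=1..n. D (digits n J t)))"
    unfolding tensor_power_D by (rule mat_diag_mult_right[OF Mat_carrier])
  then show ?thesis
    by (simp add: mat_trace_def Tr_eq_sum Mat_def mult.commute)
qed

lemma Mat_e1:
  assumes "1 \<le> n"
  shows "Mat n (e 1) = kron (E_mat s w k N) (1\<^sub>m (N ^ (n - 1)))"
proof -
  obtain m where n: "n = Suc m" using assms by (cases n) auto
  have e1: "e 1 = \<epsilon> 1" by (simp add: One_nat_def)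
  have \<alpha>: "alpha s w k (i + 1) = \<alpha> i" for i by (simp add: alpha_def \<alpha>_def)
  show ?thesis
  proof (rule eq_matI)
    fix I J assume "I < dim_row (kron (E_mat s w k N) (1\<^sub>m (N ^ (n - 1))))"
      "J < dim_col (kron (E_mat s w k N) (1\<^sub>m (N ^ (n - 1))))"
    then have IJ: "I < N * N ^ m" "J < N * N ^ m" by (simp_all add: kron_def E_mat_def n One_nat_def)
    have pos: "0 < N ^ m" using N_pos by simp
    have IJ': "I div N ^ m < N" "J div N ^ m < N" "I mod N ^ m < N ^ m" "J mod N ^ m < N ^ m"
      using IJ pos by (auto simp: less_mult_imp_div_less)
    have first: "digits n I 1 = I div N ^ m" "digits n J 1 = J div N ^ m"
      using IJ by (simp_all add: n digits_Suc_first)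
    have rest: "(\<forall>t\<in>{1..n}. ((digits n I)(1 := l)) t = digits n J t) \<longleftrightarrow>
       l = J div N ^ m \<and> I mod N ^ m = J mod N ^ m" for l
    proof -
      have set_eq: "{1..n} = insert 1 (Suc ` {1..m})"
        by (auto simp: n One_nat_def image_Suc_atLeastAtMost)
      have ball: "(\<forall>t\<in>{1..n}. Q t) \<longleftrightarrow> Q 1 \<and> (\<forall>t\<in>{1..m}. Q (Suc t))" for Q
        unfolding set_eq by (simp only: ball_simps)
      have "(\<forall>t\<in>{1..n}. ((digits n I)(1 := l)) t = digits n J t) \<longleftrightarrow>
         l = digits n J 1 \<and> (\<forall>t\<in>{1..m}. digits n I (Suc t) = digits n J (Suc t))"
        unfolding ball by (auto simp: One_nat_def)
      also have "(\<forall>t\<in>{1..m}. digits n I (Suc t) = digits n J (Suc t)) \<longleftrightarrow>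
         (\<forall>t\<in>{1..m}. digits m (I mod N ^ m) t = digits m (J mod N ^ m) t)"
        by (simp add: n digits_Suc_rest)
      also have "\<dots> \<longleftrightarrow> I mod N ^ m = J mod N ^ m" using IJ' by (intro digits_inj)
      finally show ?thesis by (simp add: first)
    qed
    have "app (\<epsilon> 1) (basis n J) (digits n I) = \<alpha> (digits n I 1) * (\<Sum>l<N. \<alpha> l * basis n J ((digits n I)(1 := l)))"
      by (simp add: app_\<epsilon> valid_digits)
    also have "(\<Sum>l<N. \<alpha> l * basis n J ((digits n I)(1 := l))) =
       (\<Sum>l<N. if l = J div N ^ m then (if I mod N ^ m = J mod N ^ m then \<alpha> (J div N ^ m) else 0) else 0)"
      by (intro sum.cong refl) (simp add: basis_def valid_upd valid_digits rest del: fun_upd_apply)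
    also have "\<dots> = (if I mod N ^ m = J mod N ^ m then \<alpha> (J div N ^ m) else 0)"
      using IJ' by simp
    finally have "app (e 1) (basis n J) (digits n I) =
        \<alpha> (I div N ^ m) * (if I mod N ^ m = J mod N ^ m then \<alpha> (J div N ^ m) else 0)"
      by (simp only: first e1)
    then show "Mat n (e 1) $$ (I, J) = kron (E_mat s w k N) (1\<^sub>m (N ^ (n - 1))) $$ (I, J)"
      using IJ IJ' \<alpha> by (simp add: Mat_def kron_def E_mat_def n One_nat_def)
  qed (simp_all add: Mat_def kron_def E_mat_def n One_nat_def)
qed

text \<open>Let \<open>M = N\<^sup>2 N^m\<close> with \<open>m = n - i - 1\<close>. The nested Kronecker product splits an index into the quotient by \<open>M\<close>, the
two-digit number \<open>x\<close> in the middle, and the remainder modulo \<open>N^m\<close>; in digits, these are the factors before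
\<open>i\<close>, the factors \<open>i\<close> and \<open>Suc i\<close>, and those after.\<close>

lemma Mat_u:
  assumes "1 \<le> i" "i < n"
  shows "Mat n (u i) = U_at s N n i"
proof -
  define h where "h = i - 1"
  define m where "m = n - i - 1"
  have i: "i = Suc h" and n: "n = Suc (Suc (h + m))" using assms by (auto simp: h_def m_def One_nat_def)
  define M where "M = N * N * N ^ m"
  have M: "M = N ^ (m + 2)" by (simp add: M_def power_add power2_eq_square)
  have dim: "N ^ n = N ^ h * M" by (simp add: n M power_add power2_eq_square)
  have pos: "0 < M" "0 < N ^ m" using N_pos by (auto simp: M_def)
  define x where "x = (\<lambda>I. I mod M div N ^ m)"
  have x_less: "x I < N * N" for I
    using pos by (simp add: x_def M_def less_mult_imp_div_less)
  have x_div: "x I div N = digits n I i" and x_mod: "x I mod N = digits n I (Suc i)" for I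
  proof -
    have "x I mod N = I div N ^ m mod N"
      unfolding x_def M by (rule mod_div_pow) (use N_pos in simp_all)
    then show "x I mod N = digits n I (Suc i)" by (simp add: digits_def i n)
    have "x I div N = (I mod N ^ (m + 2)) div N ^ Suc m"
      by (simp add: x_def M div_mult2_eq[symmetric] mult.commute)
    also have "\<dots> = (I mod N ^ (m + 2)) div N ^ Suc m mod N"
      using x_less[of I] \<open>x I div N = (I mod N ^ (m + 2)) div N ^ Suc m\<close>
      by (metis less_mult_imp_div_less mod_less)
    also have "\<dots> = I div N ^ Suc m mod N" by (rule mod_div_pow) (use N_pos in simp_all)
    finally show "x I div N = digits n I i" by (simp add: digits_def i n)
  qed
  have x_eq: "x I = b * N + l \<longleftrightarrow> digits n I i = b \<and> digits n I (Suc i) = l" if "l < N" for I b l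
    unfolding x_div[symmetric] x_mod[symmetric] using that by (auto simp: mult.commute)
  have others: "(I div M = J div M \<and> I mod N ^ m = J mod N ^ m) \<longleftrightarrow>
      (\<forall>t\<in>{1..n} - {i, Suc i}. digits n I t = digits n J t)"
    if IJ: "I < N ^ n" "J < N ^ n" for I J
  proof -
    have hi: "digits n K t = digits h (K div M) t" if "1 \<le> t" "t \<le> h" for K t
    proof -
      have "n - t = (m + 2) + (h - t)" using that by (simp add: n)
      then have "K div N ^ (n - t) = K div M div N ^ (h - t)"
        by (simp only: power_add M div_mult2_eq)
      then show ?thesis using that by (simp add: digits_def n)
    qed
    have lo: "digits n K (t + Suc i) = digits m (K mod N ^ m) t" if "1 \<le> t" for K t
      using that by (simp add: digits_def n i mod_div_pow N_pos)
    have "I div M < N ^ h" "J div M < N ^ h" using IJ by (auto simp: dim less_mult_imp_div_less)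
    then have "I div M = J div M \<longleftrightarrow> (\<forall>t\<in>{1..h}. digits h (I div M) t = digits h (J div M) t)"
      by (rule digits_inj[symmetric])
    also have "\<dots> \<longleftrightarrow> (\<forall>t\<in>{1..h}. digits n I t = digits n J t)" by (simp add: hi)
    finally have 1: "I div M = J div M \<longleftrightarrow> \<dots>" .
    have "I mod N ^ m = J mod N ^ m \<longleftrightarrow>
       (\<forall>t\<in>{1..m}. digits m (I mod N ^ m) t = digits m (J mod N ^ m) t)"
      using pos by (intro digits_inj[symmetric]) auto
    also have "\<dots> \<longleftrightarrow> (\<forall>t\<in>{1..m}. digits n I (t + Suc i) = digits n J (t + Suc i))"
      by (intro ball_cong refl) (subst (1 2) lo, auto)
    also have "\<dots> \<longleftrightarrow> (\<forall>t\<in>{Suc (Suc i)..n}. digits n I t = digits n J t)"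
    proof -
      have "{Suc (Suc i)..n} = (\<lambda>t. t + Suc i) ` {1..m}"
        unfolding image_add_atLeastAtMost' by (simp add: n i One_nat_def add.commute)
      then show ?thesis by simp
    qed
    finally have 2: "I mod N ^ m = J mod N ^ m \<longleftrightarrow> \<dots>" .
    have "{1..n} - {i, Suc i} = {1..h} \<union> {Suc (Suc i)..n}" by (auto simp: i n One_nat_def)
    then show ?thesis unfolding 1 2 by auto
  qed
  show ?thesis
  proof (rule eq_matI)
    have dims: "dim_row (U_at s N n i) = N ^ n" "dim_col (U_at s N n i) = N ^ n"
      by (simp_all add: U_at_def kron_def U_mat_def dim M_def h_def m_def)
    fix I J assume "I < dim_row (U_at s N n i)" "J < dim_col (U_at s N n i)"
    then have IJ: "I < N ^ n" "J < N ^ n" by (simp_all add: dims)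
    have bounds: "I div M < N ^ h" "J div M < N ^ h" "I mod M < M" "J mod M < M"
      using IJ pos by (auto simp: dim less_mult_imp_div_less)
    have mm: "K mod M mod N ^ m = K mod N ^ m" for K
      unfolding M_def by (simp add: mod_mod_cancel)
    have "U_at s N n i = kron (1\<^sub>m (N ^ h)) (kron (U_mat s N) (1\<^sub>m (N ^ m)))"
      by (simp add: U_at_def h_def m_def)
    moreover have dimK: "dim_row (kron (U_mat s N) (1\<^sub>m (N ^ m))) = M"
      "dim_col (kron (U_mat s N) (1\<^sub>m (N ^ m))) = M"
      and dimU: "dim_row (U_mat s N) * N ^ m = M" "dim_col (U_mat s N) * N ^ m = M"
      by (simp_all add: kron_dims U_mat_def M_def)
    ultimately have "U_at s N n i $$ (I, J) =
        1\<^sub>m (N ^ h) $$ (I div M, J div M) * kron (U_mat s N) (1\<^sub>m (N ^ m)) $$ (I mod M, J mod M)"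
      using IJ by (simp add: index_kron dim)
    also have "kron (U_mat s N) (1\<^sub>m (N ^ m)) $$ (I mod M, J mod M) =
        U_mat s N $$ (x I, x J) * 1\<^sub>m (N ^ m) $$ (I mod N ^ m, J mod N ^ m)"
      using bounds dimU by (simp add: index_kron x_def mm)
    finally have "U_at s N n i $$ (I, J) = (if I div M = J div M \<and> I mod N ^ m = J mod N ^ m
        then U_mat s N $$ (x I, x J) else 0)"
      using bounds pos by simp
    also have "U_mat s N $$ (x I, x J) = (if digits n J i = digits n J (Suc i) then 0
       else if digits n I i = digits n J i \<and> digits n I (Suc i) = digits n J (Suc i)
         then d (digits n J i) (digits n J (Suc i))
       else if digits n I i = digits n J (Suc i) \<and> digits n I (Suc i) = digits n J i then 1 else 0)"
      using x_less by (simp add: U_mat_def Let_def x_div x_mod x_eq digits_less d_def)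
    finally have U: "U_at s N n i $$ (I, J) =
       (if \<forall>t\<in>{1..n} - {i, Suc i}. digits n I t = digits n J t then \<dots> else 0)"
      unfolding others[OF IJ] .
    have split: "{1..n} = insert i (insert (Suc i) ({1..n} - {i, Suc i}))" using assms by auto
    have splitQ: "(\<forall>t\<in>{1..n}. Q t) \<longleftrightarrow> Q i \<and> Q (Suc i) \<and> (\<forall>t\<in>{1..n} - {i, Suc i}. Q t)" for Q
      by (subst split) (simp only: ball_simps)
    have b1: "basis n J (digits n I) = (if digits n I i = digits n J i \<and> digits n I (Suc i) = digits n J (Suc i) \<and>
        (\<forall>t\<in>{1..n} - {i, Suc i}. digits n I t = digits n J t) then 1 else 0)"
      using valid_digits by (simp add: basis_def splitQ)
    define a where "a = (digits n I)(i := digits n I (Suc i), Suc i := digits n I i)"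
    have va: "valid N a" unfolding a_def by (intro valid_upd valid_digits digits_less)
    have a: "a i = digits n I (Suc i)" "a (Suc i) = digits n I i" "\<And>t. t \<in> {1..n} - {i, Suc i} \<Longrightarrow> a t = digits n I t"
      by (auto simp: a_def)
    have b2: "basis n J a = (if digits n I (Suc i) = digits n J i \<and> digits n I i = digits n J (Suc i) \<and>
        (\<forall>t\<in>{1..n} - {i, Suc i}. digits n I t = digits n J t) then 1 else 0)"
    proof -
      have "(\<forall>t\<in>{1..n}. a t = digits n J t) \<longleftrightarrow> a i = digits n J i \<and> a (Suc i) = digits n J (Suc i) \<and>
        (\<forall>t\<in>{1..n} - {i, Suc i}. a t = digits n J t)"
        by (rule splitQ)
      also have "\<dots> \<longleftrightarrow> digits n I (Suc i) = digits n J i \<and> digits n I i = digits n J (Suc i) \<and>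
        (\<forall>t\<in>{1..n} - {i, Suc i}. digits n I t = digits n J t)"
        using a by simp
      finally show ?thesis using va by (simp add: basis_def)
    qed
    have "app (u i) (basis n J) (digits n I) = (if digits n I i = digits n I (Suc i) then 0 else
        d (digits n I i) (digits n I (Suc i)) * basis n J (digits n I) + basis n J a)"
      by (simp add: u_def app_U2 valid_digits a_def)
    also have "\<dots> = U_at s N n i $$ (I, J)"
    proof -
      have "(if p = q then 0 else d p q * (if p = p' \<and> q = q' \<and> Q then 1 else 0) +
            (if q = p' \<and> p = q' \<and> Q then 1 else 0)) =
          (if Q then if p' = q' then 0 else if p = p' \<and> q = q' then d p' q'
            else if p = q' \<and> q = p' then 1 else 0 else 0)" for p q p' q' :: nat and Q
        by (cases "p = p'"; cases "q = q'"; cases "p = q'"; cases "q = p'"; cases Q) simp_all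
      then show ?thesis unfolding U b1 b2 .
    qed
    finally show "Mat n (u i) $$ (I, J) = U_at s N n i $$ (I, J)" using IJ by (simp add: Mat_def)
  qed (simp_all add: Mat_def U_at_def kron_def U_mat_def dim M_def h_def m_def)
qed

end

section \<open>Free algebras\<close>

definition free_eval :: "('g \<Rightarrow> ('i, 'a::field) lin_op) \<Rightarrow> ('g, 'a) free_alg \<Rightarrow> ('i, 'a) lin_op" where
  "free_eval \<phi> p = (\<Sum>v\<in>Poly_Mapping.keys p.
     scal (Poly_Mapping.lookup p v) * prod_list (map \<phi> (letters v)))"

lemma free_eval_add: "free_eval \<phi> (p + q) = free_eval \<phi> p + free_eval \<phi> q"
  unfolding free_eval_def
  by (rule setsum_keys_plus_distrib) (simp_all add: scal_hom distrib_right)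

lemma free_eval_0: "free_eval \<phi> 0 = 0"
  by (simp add: free_eval_def)

lemma free_eval_sum: "free_eval \<phi> (\<Sum>k\<in>K. p k) = (\<Sum>k\<in>K. free_eval \<phi> (p k))"
  by (induction K rule: infinite_finite_induct) (simp_all add: free_eval_0 free_eval_add)

lemma free_eval_single:
  "free_eval \<phi> (Poly_Mapping.single v a) = scal a * prod_list (map \<phi> (letters v))"
  by (simp add: free_eval_def scal_hom)

lemma free_alg_eq_sum:
  "p = (\<Sum>v\<in>Poly_Mapping.keys p. Poly_Mapping.single v (Poly_Mapping.lookup p v))"
  by (rule poly_mapping_eqI)
     (auto simp: lookup_sum lookup_single when_def in_keys_iff)

lemma free_eval_mult: "free_eval \<phi> (p * q) = free_eval \<phi> p * free_eval \<phi> q"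
proof -
  have pq: "p * q = (\<Sum>v\<in>Poly_Mapping.keys p. \<Sum>v'\<in>Poly_Mapping.keys q.
      Poly_Mapping.single v (Poly_Mapping.lookup p v) * Poly_Mapping.single v' (Poly_Mapping.lookup q v'))"
    by (subst free_alg_eq_sum[of p], subst free_alg_eq_sum[of q])
       (simp add: sum_distrib_left sum_distrib_right sum.swap[of _ "Poly_Mapping.keys p"])
  have single: "free_eval \<phi> (Poly_Mapping.single v a * Poly_Mapping.single v' b) =
      (scal a * prod_list (map \<phi> (letters v))) * (scal b * prod_list (map \<phi> (letters v')))" for v v' a b
    by (simp add: mult_single free_eval_single plus_free_mon_def scal_hom mult.assoc
        scal_left_commute[of "prod_list _"])
  show ?thesis
    unfolding pq by (simp only: free_eval_sum single free_eval_def[of \<phi> p] free_eval_def[of \<phi> q] sum_product)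
qed

lemma free_eval_scalar: "free_eval \<phi> (scalar a) = scal a"
  by (simp add: scalar_def free_eval_single zero_free_mon_def)

lemma free_eval_1: "free_eval \<phi> 1 = 1"
  using free_eval_scalar[of \<phi> 1] by (simp add: scalar_def scal_hom)

lemma free_eval_gen: "free_eval \<phi> (gen x) = \<phi> x"
  by (simp add: gen_def free_eval_single scal_hom)

lemma free_eval_diff: "free_eval \<phi> (p - q) = free_eval \<phi> p - free_eval \<phi> q"
  using free_eval_add[of \<phi> "p - q" q] by (simp add: algebra_simps)

lemmas free_eval_simps = free_eval_add free_eval_diff free_eval_mult free_eval_scalar free_eval_1
  free_eval_gen free_eval_0

lemma free_ring_simps:
  "mult (free_ring G) = (*)" "add (free_ring G) = (+)" "one (free_ring G) = 1" "zero (free_ring G) = 0"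
  by (simp_all add: free_ring_def)

lemma free_carrier_iff:
  "p \<in> carrier (free_ring G) \<longleftrightarrow> (\<forall>v\<in>Poly_Mapping.keys p. set (letters v) \<subseteq> G)"
  by (simp add: free_ring_def)

lemma free_carrier_intros:
  "scalar a \<in> carrier (free_ring G)" "0 \<in> carrier (free_ring G)" "1 \<in> carrier (free_ring G)"
  "x \<in> G \<Longrightarrow> gen x \<in> carrier (free_ring G)"
  "p \<in> carrier (free_ring G) \<Longrightarrow> q \<in> carrier (free_ring G) \<Longrightarrow> p + q \<in> carrier (free_ring G)"
  "p \<in> carrier (free_ring G) \<Longrightarrow> - p \<in> carrier (free_ring G)"
  "p \<in> carrier (free_ring G) \<Longrightarrow> q \<in> carrier (free_ring G) \<Longrightarrow> p - q \<in> carrier (free_ring G)"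
  "p \<in> carrier (free_ring G) \<Longrightarrow> q \<in> carrier (free_ring G) \<Longrightarrow> p * q \<in> carrier (free_ring G)"
proof -
  show add: "p + q \<in> carrier (free_ring G)"
    if "p \<in> carrier (free_ring G)" "q \<in> carrier (free_ring G)" for p q
    using that keys_add[of p q] unfolding free_carrier_iff by blast
  show neg: "- p \<in> carrier (free_ring G)" if "p \<in> carrier (free_ring G)" for p
    using that by (simp add: free_carrier_iff in_keys_iff)
  show "p - q \<in> carrier (free_ring G)"
    if "p \<in> carrier (free_ring G)" "q \<in> carrier (free_ring G)" for p q
    using add[OF that(1) neg[OF that(2)]] by simp
  show "p * q \<in> carrier (free_ring G)"
    if "p \<in> carrier (free_ring G)" "q \<in> carrier (free_ring G)" for p q
    using that keys_mult[of p q] unfolding free_carrier_iff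
    by (fastforce simp: plus_free_mon_def)
qed (auto simp: free_carrier_iff scalar_def gen_def zero_free_mon_def split: if_splits)

lemma free_ring_ring: "ring (free_ring G)"
proof (rule ringI)
  show "abelian_group (free_ring G)"
  proof (rule abelian_groupI)
    fix x assume "x \<in> carrier (free_ring G)"
    then show "\<exists>y\<in>carrier (free_ring G). y \<oplus>\<^bsub>free_ring G\<^esub> x = \<zero>\<^bsub>free_ring G\<^esub>"
      by (intro bexI[of _ "- x"]) (simp_all add: free_ring_simps free_carrier_intros)
  qed (simp_all add: free_ring_simps free_carrier_intros algebra_simps)
  show "Group.monoid (free_ring G)"
    by (rule Group.monoidI) (simp_all add: free_ring_simps free_carrier_intros mult.assoc)
qed (simp_all add: free_ring_simps algebra_simps)

lemma free_ring_a_inv: "x \<in> carrier (free_ring G) \<Longrightarrow> \<ominus>\<^bsub>free_ring G\<^esub> x = - x"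
  by (rule abelian_group.minus_equality[OF ring.is_abelian_group[OF free_ring_ring]])
     (simp_all add: free_ring_simps free_carrier_intros)

text \<open>Polynomials are sums of scalar multiples of words, and words are products of generators.\<close>

lemma free_alg_induct [consumes 1, case_names scalar gen add mult]:
  fixes p :: "('g, 'a::field) free_alg"
  assumes p: "p \<in> carrier (free_ring G)"
    and "\<And>a. P (scalar a)" and gen: "\<And>x. x \<in> G \<Longrightarrow> P (gen x)"
    and add: "\<And>p q. p \<in> carrier (free_ring G) \<Longrightarrow> q \<in> carrier (free_ring G) \<Longrightarrow> P p \<Longrightarrow> P q \<Longrightarrow> P (p + q)"
    and mult: "\<And>p q. p \<in> carrier (free_ring G) \<Longrightarrow> q \<in> carrier (free_ring G) \<Longrightarrow> P p \<Longrightarrow> P q \<Longrightarrow> P (p * q)"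
  shows "P p"
proof -
  let ?C = "carrier (free_ring G) :: ('g, 'a) free_alg set"
  have 1: "Poly_Mapping.single (Word l) 1 \<in> ?C \<and> P (Poly_Mapping.single (Word l) 1)" if "set l \<subseteq> G" for l
    using that
  proof (induction l)
    case Nil
    then show ?case using assms(2)[of 1] by (simp add: scalar_def zero_free_mon_def free_carrier_iff)
  next
    case (Cons x l)
    have eq: "Poly_Mapping.single (Word (x # l)) 1 = gen x * (Poly_Mapping.single (Word l) 1 :: ('g, 'a) free_alg)"
      by (simp add: gen_def mult_single plus_free_mon_def)
    show ?case unfolding eq using Cons
      by (auto intro!: free_carrier_intros mult gen)
  qed
  have 2: "Poly_Mapping.single v a \<in> ?C \<and> P (Poly_Mapping.single v a)" if "set (letters v) \<subseteq> G" for v a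
  proof -
    have eq: "Poly_Mapping.single v a = scalar a * Poly_Mapping.single (Word (letters v)) 1"
      by (simp add: scalar_def mult_single)
    show ?thesis unfolding eq using 1[OF that]
      by (auto intro!: free_carrier_intros mult assms(2))
  qed
  have "(\<Sum>v\<in>K. Poly_Mapping.single v (c v)) \<in> ?C \<and> P (\<Sum>v\<in>K. Poly_Mapping.single v (c v))"
    if "finite K" "\<forall>v\<in>K. set (letters v) \<subseteq> G" for K and c :: "_ \<Rightarrow> 'a"
    using that
  proof (induction K)
    case empty
    then show ?case using assms(2)[of 0] by (simp add: scalar_def free_carrier_intros)
  next
    case (insert v K)
    then show ?case using 2[of v "c v"] by (auto intro!: free_carrier_intros add)
  qed
  from this[of "Poly_Mapping.keys p" "Poly_Mapping.lookup p"] show ?thesis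
    using p by (simp add: free_carrier_iff free_alg_eq_sum[symmetric])
qed

section \<open>The quotient algebras \<open>C_n\<close>\<close>

lemma C_gens_carrier:
  "1 \<le> i \<Longrightarrow> i < n \<Longrightarrow> u_el i \<in> carrier (free_ring (C_letters n))"
  "r \<le> n \<Longrightarrow> e_el r \<in> carrier (free_ring (C_letters n))"
  "1 \<le> i \<Longrightarrow> i < n \<Longrightarrow> g_el s i \<in> carrier (free_ring (C_letters n))"
  unfolding u_el_def e_el_def g_el_def C_letters_def
  by (auto intro!: free_carrier_intros)

lemma C_rels_carrier: "C_rels s N n \<subseteq> carrier (free_ring (C_letters n))"
  unfolding C_rels_def Hecke_rels_def
  by (auto intro!: free_carrier_intros C_gens_carrier)

lemma C_ideal_ideal: "ideal (C_ideal s N n) (free_ring (C_letters n))"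
  unfolding C_ideal_def by (rule ring.genideal_ideal[OF free_ring_ring C_rels_carrier])

lemma C_rels_subset_ideal: "C_rels s N n \<subseteq> C_ideal s N n"
  unfolding C_ideal_def by (rule ring.genideal_self[OF free_ring_ring C_rels_carrier])

lemma free_idealI:
  assumes "I \<subseteq> carrier (free_ring G)" "0 \<in> I"
    "\<And>a b. a \<in> I \<Longrightarrow> b \<in> I \<Longrightarrow> a + b \<in> I"
    "\<And>a x. a \<in> I \<Longrightarrow> x \<in> carrier (free_ring G) \<Longrightarrow> x * a \<in> I"
    "\<And>a x. a \<in> I \<Longrightarrow> x \<in> carrier (free_ring G) \<Longrightarrow> a * x \<in> I"
  shows "ideal I (free_ring G)"
proof (rule idealI[OF free_ring_ring])
  show "subgroup I (add_monoid (free_ring G))"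
  proof (rule subgroup.intro)
    show "inv\<^bsub>add_monoid (free_ring G)\<^esub> x \<in> I" if "x \<in> I" for x
    proof -
      have x: "x \<in> carrier (free_ring G)" using that assms(1) by auto
      have "inv\<^bsub>add_monoid (free_ring G)\<^esub> x = - x"
        using free_ring_a_inv[OF x] by (simp add: a_inv_def)
      also have "\<dots> = (- 1) * x" by simp
      also have "\<dots> \<in> I" using that by (intro assms(4) free_carrier_intros)
      finally show ?thesis .
    qed
  qed (use assms in \<open>auto simp: free_ring_simps\<close>)
qed (use assms in \<open>auto simp: free_ring_simps\<close>)

lemma free_idealD:
  assumes "ideal I (free_ring G)"
  shows "I \<subseteq> carrier (free_ring G)" "0 \<in> I" "a \<in> I \<Longrightarrow> b \<in> I \<Longrightarrow> a + b \<in> I"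
    "a \<in> I \<Longrightarrow> x \<in> carrier (free_ring G) \<Longrightarrow> x * a \<in> I"
    "a \<in> I \<Longrightarrow> x \<in> carrier (free_ring G) \<Longrightarrow> a * x \<in> I"
proof -
  interpret ideal I "free_ring G" by fact
  show "I \<subseteq> carrier (free_ring G)" by (rule a_subset)
  show "0 \<in> I" using additive_subgroup.zero_closed[OF additive_subgroup_axioms] by (simp add: free_ring_simps)
  show "a \<in> I \<Longrightarrow> b \<in> I \<Longrightarrow> a + b \<in> I" using additive_subgroup.a_closed[OF additive_subgroup_axioms, of a b] by (simp add: free_ring_simps)
  show "a \<in> I \<Longrightarrow> x \<in> carrier (free_ring G) \<Longrightarrow> x * a \<in> I"
    using I_l_closed[of a x] by (simp add: free_ring_simps)
  show "a \<in> I \<Longrightarrow> x \<in> carrier (free_ring G) \<Longrightarrow> a * x \<in> I"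
    using I_r_closed[of a x] by (simp add: free_ring_simps)
qed

lemma free_carrier_mono: "G \<subseteq> G' \<Longrightarrow> carrier (free_ring G) \<subseteq> carrier (free_ring G')"
  by (meson free_carrier_iff subset_iff)

lemma C_letters_mono: "m \<le> n \<Longrightarrow> C_letters m \<subseteq> C_letters n"
  by (auto simp: C_letters_def)

lemma C_rels_mono: "m \<le> n \<Longrightarrow> C_rels s N m \<subseteq> C_rels s N n"
  unfolding C_rels_def Hecke_rels_def
  by (intro Un_mono; force)

lemma C_ideal_mono:
  assumes "m \<le> n"
  shows "C_ideal s N m \<subseteq> C_ideal s N n"
proof -
  let ?R = "free_ring (C_letters m)"
  have R: "carrier ?R \<subseteq> carrier (free_ring (C_letters n))"
    using assms by (intro free_carrier_mono C_letters_mono)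
  have "ideal (C_ideal s N n \<inter> carrier ?R) ?R"
    by (rule free_idealI)
       (use R free_idealD[OF C_ideal_ideal[of s N n]] in \<open>auto intro: free_carrier_intros\<close>)
  then have "C_ideal s N m \<subseteq> C_ideal s N n \<inter> carrier ?R"
    unfolding C_ideal_def[of s N m]
    using C_rels_carrier C_rels_mono[OF assms] C_rels_subset_ideal
    by (intro ring.genideal_minimal[OF free_ring_ring]) blast+
  then show ?thesis by blast
qed

lemma C_class_eq: "C_class s N n p = (\<lambda>i. i + p) ` C_ideal s N n"
  by (auto simp: C_class_def a_r_coset_def' free_ring_simps)

lemma C_alg_carrier: "carrier (C_alg s N n) = C_class s N n ` carrier (free_ring (C_letters n))"
  by (auto simp: C_alg_def FactRing_def A_RCOSETS_def' C_class_def a_r_coset_def')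

lemma C_class_hom:
  assumes "p \<in> carrier (free_ring (C_letters n))" "q \<in> carrier (free_ring (C_letters n))"
  shows "C_class s N n p \<otimes>\<^bsub>C_alg s N n\<^esub> C_class s N n q = C_class s N n (p * q)"
    "C_class s N n p \<oplus>\<^bsub>C_alg s N n\<^esub> C_class s N n q = C_class s N n (p + q)"
proof -
  interpret ideal "C_ideal s N n" "free_ring (C_letters n)" by (rule C_ideal_ideal)
  have h: "C_class s N n \<in> Ring.ring_hom (free_ring (C_letters n)) (C_alg s N n)"
    using rcos_ring_hom by (simp add: C_class_def[abs_def] C_alg_def)
  show "C_class s N n p \<otimes>\<^bsub>C_alg s N n\<^esub> C_class s N n q = C_class s N n (p * q)"
    using ring_hom_mult[OF h assms] by (simp add: free_ring_simps)
  show "C_class s N n p \<oplus>\<^bsub>C_alg s N n\<^esub> C_class s N n q = C_class s N n (p + q)"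
    using ring_hom_add[OF h assms] by (simp add: free_ring_simps)
qed

lemma C_alg_one: "\<one>\<^bsub>C_alg s N n\<^esub> = C_class s N n 1"
  by (simp add: C_alg_def FactRing_def C_class_def free_ring_simps)

lemma C_class_cong:
  assumes "p - q \<in> C_ideal s N n"
  shows "C_class s N n p = C_class s N n q"
proof -
  note I = free_idealD[OF C_ideal_ideal[of s N n]]
  have neg: "- x \<in> C_ideal s N n" if "x \<in> C_ideal s N n" for x
    using I(4)[OF that free_carrier_intros(6)[OF free_carrier_intros(3)]] by simp
  have sub: "C_class s N n p \<subseteq> C_class s N n q" if "p - q \<in> C_ideal s N n" for p q
  proof
    fix x assume "x \<in> C_class s N n p"
    then obtain i where i: "i \<in> C_ideal s N n" "x = i + p" by (auto simp: C_class_eq)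
    have "x = (i + (p - q)) + q" by (simp add: i)
    then show "x \<in> C_class s N n q" using I(3)[OF i(1) that] unfolding C_class_eq by (rule image_eqI)
  qed
  have "q - p \<in> C_ideal s N n" using neg[OF assms] by simp
  then show ?thesis using sub[OF assms] sub by blast
qed

text \<open>The ideal for \<open>m\<close> is contained in the ideal for \<open>n\<close>, so adding the latter to a class yields a class.\<close>

lemma C_incl_class:
  assumes "m \<le> n"
  shows "C_incl s N n (C_class s N m p) = C_class s N n p"
proof -
  note I = free_idealD[OF C_ideal_ideal]
  have "C_incl s N n (C_class s N m p) =
      {i + (j + p) | i j. i \<in> C_ideal s N n \<and> j \<in> C_ideal s N m}"
    by (auto simp: C_incl_def set_add_def' C_class_eq free_ring_simps)
  also have "\<dots> = C_class s N n p"
  proof (intro equalityI subsetI)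
    fix x assume "x \<in> {i + (j + p) | i j. i \<in> C_ideal s N n \<and> j \<in> C_ideal s N m}"
    then obtain i j where ij: "x = i + (j + p)" "i \<in> C_ideal s N n" "j \<in> C_ideal s N m" by blast
    then have "x = (i + j) + p" by (simp add: add.assoc)
    moreover have "i + j \<in> C_ideal s N n"
      using ij(2,3) C_ideal_mono[OF assms] by (intro I(3)) auto
    ultimately show "x \<in> C_class s N n p" by (auto simp: C_class_eq)
  next
    fix x assume "x \<in> C_class s N n p"
    then obtain i where "x = i + (0 + p)" "i \<in> C_ideal s N n" by (auto simp: C_class_eq)
    then show "x \<in> {i + (j + p) | i j. i \<in> C_ideal s N n \<and> j \<in> C_ideal s N m}"
      using I(2) by blast
  qed
  finally show ?thesis .
qed

lemma power2_powi: "((x::'a::field)\<^sup>2) powi m = x powi (2 * m)"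
  by (metis of_nat_numeral power_int_mult power_int_of_nat)

context N_state begin

section \<open>The representation and its trace\<close>

fun letter_op :: "C_letter \<Rightarrow> (nat \<Rightarrow> nat, 'a) lin_op" where
  "letter_op (ULetter i) = u i" | "letter_op (ELetter r) = e r"

definition \<rho> :: "(C_letter, 'a) free_alg \<Rightarrow> (nat \<Rightarrow> nat, 'a) lin_op" where
  "\<rho> = free_eval letter_op"

lemma \<rho>_simps:
  "\<rho> (p + q) = \<rho> p + \<rho> q" "\<rho> (p - q) = \<rho> p - \<rho> q" "\<rho> (p * q) = \<rho> p * \<rho> q"
  "\<rho> (scalar x) = scal x" "\<rho> 1 = 1" "\<rho> 0 = 0" "\<rho> (u_el i) = u i" "\<rho> (e_el r) = e r"
  "\<rho> (g_el s i) = scal (s\<^sup>2) - u i"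
  by (simp_all add: \<rho>_def free_eval_simps u_el_def e_el_def g_el_def)

lemma \<rho>_A: "p \<in> carrier (free_ring (C_letters n)) \<Longrightarrow> \<rho> p \<in> A n"
proof (induction rule: free_alg_induct)
  case (gen x)
  then show ?case
    by (auto simp: C_letters_def \<rho>_def free_eval_simps intro: A_intros)
qed (auto simp: \<rho>_simps intro: A_intros)

lemma Hecke_g_quad:
  fixes i :: nat
  defines "g \<equiv> scal (s\<^sup>2) - u i"
  assumes "1 \<le> i"
  shows "g * g = scal (s\<^sup>2 - inverse (s\<^sup>2)) * g + 1"
proof -
  have "scal (s\<^sup>2) * scal (inverse (s\<^sup>2)) = (1 :: (nat \<Rightarrow> nat, 'a) lin_op)"
    using s_0 by (simp add: scal_hom(2)[symmetric] scal_hom(4))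
  then show ?thesis
    using quad[OF assms(2)]
    by (simp add: g_def algebra_simps scal_hom(1,6) scal_commute[of "u i"] scal_commute[of "scal (s\<^sup>2)" "inverse (s\<^sup>2)"])
qed

lemma Hecke_g_braid:
  fixes i :: nat
  assumes "1 \<le> i"
  shows "(scal (s\<^sup>2) - u i) * (scal (s\<^sup>2) - u (Suc i)) * (scal (s\<^sup>2) - u i) =
    (scal (s\<^sup>2) - u (Suc i)) * (scal (s\<^sup>2) - u i) * (scal (s\<^sup>2) - u (Suc i))"
proof -
  define a b where "a = u i" and "b = u (Suc i)"
  define x y :: "(nat \<Rightarrow> nat, 'a) lin_op" where "x = scal (s\<^sup>2)" and "y = scal (inverse (s\<^sup>2))"
  have xy: "x * y = 1"
    using s_0 by (simp add: x_def y_def scal_hom(2)[symmetric] scal_hom(4))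
  have aa: "a * a = x * a + y * a" and bb: "b * b = x * b + y * b"
    using quad[OF assms] quad[of "Suc i"] by (simp_all add: a_def b_def x_def y_def scal_hom distrib_right)
  have aba: "a * (b * a) = b * (a * b) - b + a"
    using braid[OF assms] by (simp add: a_def b_def algebra_simps)
  have com: "a * x = x * a" "b * x = x * b" "a * (x * z) = x * (a * z)" "b * (x * z) = x * (b * z)" for z
    by (simp_all add: x_def scal_commute[of a] scal_commute[of b] scal_left_commute[of a] scal_left_commute[of b])
  have xyz: "x * (y * z) = z" for z using xy by (simp add: mult.assoc[symmetric])
  show ?thesis
    unfolding a_def[symmetric] b_def[symmetric] x_def[symmetric]
    by (simp add: algebra_simps com aba) (simp add: aa bb algebra_simps xyz)
qed

text \<open>Both sums telescope after multiplication by \<open>s - 1/s\<close>.\<close>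

lemma c_eq:
  assumes gen: "\<And>m. 0 < m \<Longrightarrow> s ^ m \<noteq> 1"
  shows "(s powi (int N - 2) - s powi - (int N - 2)) / (s powi int N - s powi - int N) = c"
proof -
  define \<delta> where "\<delta> = s - inverse s"
  have tel: "s powi (2 * int k - 2 * int i) * \<delta> = s powi (2 * int k + 1 - 2 * int i) - s powi (2 * int k + 1 - 2 * int (Suc i))" for i
  proof -
    have "s powi (2 * int k - 2 * int i) * s powi 1 = s powi (2 * int k + 1 - 2 * int i)"
      "s powi (2 * int k - 2 * int i) * s powi (- 1) = s powi (2 * int k + 1 - 2 * int (Suc i))"
      unfolding s_powi by (simp_all add: algebra_simps)
    then show ?thesis using s_0 by (simp add: \<delta>_def right_diff_distrib power_int_minus)
  qed
  have 1: "w\<^sup>2 * \<delta> = s powi int N - s powi - int N"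
  proof -
    have "w\<^sup>2 * \<delta> = (\<Sum>i<N. s powi (2 * int k + 1 - 2 * int i) - s powi (2 * int k + 1 - 2 * int (Suc i)))"
      unfolding w_sq sum_distrib_right tel ..
    also have "\<dots> = s powi (2 * int k + 1 - 2 * int 0) - s powi (2 * int k + 1 - 2 * int N)"
      by (rule sum_lessThan_telescope')
    finally show ?thesis by (simp add: N algebra_simps)
  qed
  have 2: "c * w\<^sup>2 * \<delta> = s powi (int N - 2) - s powi - (int N - 2)"
  proof -
    have "c * w\<^sup>2 = (\<Sum>i=1..<N-1. s powi (2 * int k - 2 * int i))"
      unfolding c_def sum_distrib_right using w_0 by (simp add: \<alpha>_sq)
    then have "c * w\<^sup>2 * \<delta> = (\<Sum>i=1..<N-1. s powi (2 * int k + 1 - 2 * int i) - s powi (2 * int k + 1 - 2 * int (Suc i)))"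
      by (simp only: sum_distrib_right tel)
    also have "\<dots> = s powi (2 * int k + 1 - 2 * int 1) - s powi (2 * int k + 1 - 2 * int (N - 1))"
      using sum_Suc_diff'[of 1 "N - 1" "\<lambda>i. - (s powi (2 * int k + 1 - 2 * int i))"] N k_pos
      by simp
    finally show ?thesis using N k_pos by (simp add: of_nat_diff algebra_simps)
  qed
  have "s powi int N \<noteq> s powi - int N"
  proof
    assume "s powi int N = s powi - int N"
    then have "s powi (int N + int N) = s powi (- int N + int N)"
      by (simp only: s_powi[symmetric])
    then have "s powi int (N + N) = 1" by simp
    then have "s ^ (N + N) = 1" by (simp only: power_int_of_nat)
    then show False using gen[of "N + N"] N by simp
  qed
  then have nz: "s powi int N - s powi - int N \<noteq> 0" by (simp only: right_minus_eq not_False_eq_True)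
  have "c * (s powi int N - s powi - int N) = s powi (int N - 2) - s powi - (int N - 2)"
    unfolding 1[symmetric] 2[symmetric] by (simp only: mult.assoc)
  then show ?thesis by (rule nonzero_divide_eq_eq[OF nz, THEN iffD2, OF sym])
qed

lemma \<rho>_rels:
  assumes gen: "\<And>m. 0 < m \<Longrightarrow> s ^ m \<noteq> 1" and "p \<in> C_rels s N n"
  shows "\<rho> p = 0"
  using assms(2) unfolding C_rels_def Hecke_rels_def
proof (elim UnE CollectE exE conjE)
  fix i assume "p = g_el s i * g_el s (i + 1) * g_el s i - g_el s (i + 1) * g_el s i * g_el s (i + 1)"
    "1 \<le> i" "i + 1 < n"
  then show "\<rho> p = 0" using Hecke_g_braid[of i] by (simp add: \<rho>_simps One_nat_def)
next
  fix i j assume p: "p = g_el s i * g_el s j - g_el s j * g_el s i"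
    and ij: "i \<in> {1..<n}" "j \<in> {1..<n}" "i \<noteq> j + 1" "j \<noteq> i + 1"
  have "u i * u j = u j * u i"
  proof (cases i j rule: linorder_cases)
    case less
    then show ?thesis using far[of i j] ij by auto
  next
    case greater
    then show ?thesis using far[of j i] ij by auto
  qed simp
  then show "\<rho> p = 0"
    by (simp add: p \<rho>_simps left_diff_distrib right_diff_distrib scal_commute[of "u i"] scal_commute[of "u j"])
next
  fix i assume "p = g_el s i * g_el s i - (scalar (s\<^sup>2 - inverse (s\<^sup>2)) * g_el s i + 1)" "i \<in> {1..<n}"
  then show "\<rho> p = 0" using Hecke_g_quad[of i] by (simp add: \<rho>_simps)
next
  fix i assume "p = e_el 1 * u_el i - u_el i * e_el 1" "2 \<le> i" "i < n"
  then show "\<rho> p = 0" using e_commute[of 1 i] by (simp add: \<rho>_simps)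
next
  fix r assume "p = e_el r * e_el r - e_el r" "1 \<le> r" "r \<le> n"
  then show "\<rho> p = 0" using e_absorb(1)[of r r] by (simp add: \<rho>_simps)
next
  fix r assume "p = e_el (r + 1) - (e_el r * u_el r * e_el r -
     scalar ((s powi (int N - 2) - s powi - (int N - 2)) / (s powi int N - s powi - int N)) * e_el r)"
    "1 \<le> r" "r < n"
  then show "\<rho> p = 0" using e_Suc[of r] c_eq[OF gen] by (simp add: \<rho>_simps Suc_eq_plus1[symmetric] del: e.simps)
next
  fix j r assume p: "p = (u_el (j - 1) * u_el j - u_el (j - 1)) * e_el r - (u_el j * u_el (j - 1) - u_el j) * e_el r"
    and j: "2 \<le> j" "j < r" "r \<le> n"
  obtain i where "j = Suc i" "1 \<le> i" using j by (cases j) (auto simp: One_nat_def)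
  then show "\<rho> p = 0" using slide_left[of i r] j by (simp add: p \<rho>_simps One_nat_def)
next
  fix j r assume p: "p = e_el r * (u_el j * u_el (j - 1) - u_el (j - 1)) - e_el r * (u_el (j - 1) * u_el j - u_el j)"
    and j: "2 \<le> j" "j < r" "r \<le> n"
  obtain i where "j = Suc i" "1 \<le> i" using j by (cases j) (auto simp: One_nat_def)
  then show "\<rho> p = 0" using slide_right[of i r] j by (simp add: p \<rho>_simps One_nat_def)
qed

end

text \<open>If \<open>s\<close> is not a root of unity, the quantum integers and the denominators in the relations are nonzero.\<close>

locale generic_N_state = N_state +
  assumes generic: "0 < m \<Longrightarrow> s ^ m \<noteq> 1"
begin

lemma \<rho>_ideal:
  assumes "p \<in> C_ideal s N n"
  shows "\<rho> p = 0"
proof -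
  let ?R = "free_ring (C_letters n)"
  have "ideal {p \<in> carrier ?R. \<rho> p = 0} ?R"
    by (rule free_idealI) (auto simp: \<rho>_simps intro: free_carrier_intros)
  then have "C_ideal s N n \<subseteq> {p \<in> carrier ?R. \<rho> p = 0}"
    unfolding C_ideal_def using C_rels_carrier \<rho>_rels[OF generic]
    by (intro ring.genideal_minimal[OF free_ring_ring]) blast+
  then show ?thesis using assms by blast
qed

text \<open>Every representative of a class evaluates to the same operator.\<close>

definition Phi_op :: "nat \<Rightarrow> (C_letter, 'a) free_alg set \<Rightarrow> 'a mat" where
  "Phi_op n = restrict (\<lambda>X. Mat n (\<rho> (SOME p. p \<in> X))) (carrier (C_alg s N n))"

lemma Phi_op_class:
  assumes "p \<in> carrier (free_ring (C_letters n))"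
  shows "Phi_op n (C_class s N n p) = Mat n (\<rho> p)"
proof -
  have "p \<in> C_class s N n p"
    using free_idealD(2)[OF C_ideal_ideal[of s N n]] by (force simp: C_class_eq)
  then have "(SOME p'. p' \<in> C_class s N n p) \<in> C_class s N n p" by (rule someI)
  then have "\<rho> (SOME p'. p' \<in> C_class s N n p) = \<rho> p"
    by (auto simp: C_class_eq \<rho>_simps \<rho>_ideal)
  then show ?thesis using assms by (simp add: Phi_op_def C_alg_carrier)
qed

lemma preserves_\<rho>: "p \<in> carrier (free_ring (C_letters n)) \<Longrightarrow> preserves n (\<rho> p)"
  by (intro preserves_A \<rho>_A)

lemma is_Phi_Phi_op:
  assumes "1 \<le> n"
  shows "is_Phi s w k N n (Phi_op n)"
  unfolding is_Phi_def
proof (intro conjI ballI allI)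
  show "Phi_op n \<in> Ring.ring_hom (C_alg s N n) (ring_mat TYPE('a) (N ^ n) ())"
  proof (rule ring_hom_memI)
    fix X Y assume "X \<in> carrier (C_alg s N n)" "Y \<in> carrier (C_alg s N n)"
    then obtain p q where pq: "X = C_class s N n p" "Y = C_class s N n q"
      "p \<in> carrier (free_ring (C_letters n))" "q \<in> carrier (free_ring (C_letters n))"
      by (auto simp: C_alg_carrier)
    then show "Phi_op n X \<in> carrier (ring_mat TYPE('a) (N ^ n) ())"
      by (simp add: Phi_op_class ring_mat_simps Mat_carrier)
    show "Phi_op n (X \<otimes>\<^bsub>C_alg s N n\<^esub> Y) = Phi_op n X \<otimes>\<^bsub>ring_mat TYPE('a) (N ^ n) ()\<^esub> Phi_op n Y"
      "Phi_op n (X \<oplus>\<^bsub>C_alg s N n\<^esub> Y) = Phi_op n X \<oplus>\<^bsub>ring_mat TYPE('a) (N ^ n) ()\<^esub> Phi_op n Y"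
      using pq by (simp_all add: C_class_hom Phi_op_class ring_mat_simps free_carrier_intros \<rho>_simps
          Mat_mult Mat_add preserves_\<rho>)
  next
    show "Phi_op n \<one>\<^bsub>C_alg s N n\<^esub> = \<one>\<^bsub>ring_mat TYPE('a) (N ^ n) ()\<^esub>"
      by (simp add: C_alg_one Phi_op_class free_carrier_intros \<rho>_simps Mat_1 ring_mat_simps)
  qed
  show "Phi_op n (C_class s N n (scalar x)) = x \<cdot>\<^sub>m 1\<^sub>m (N ^ n)" for x
    by (simp add: Phi_op_class free_carrier_intros \<rho>_simps Mat_scal)
  show "Phi_op n (C_class s N n (e_el 1)) = kron (E_mat s w k N) (1\<^sub>m (N ^ (n - 1)))"
    using assms by (simp add: Phi_op_class C_gens_carrier \<rho>_simps Mat_e1 del: e.simps)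
  show "Phi_op n (C_class s N n (u_el i)) = U_at s N n i" if "i \<in> {1..<n}" for i
    using that by (simp add: Phi_op_class C_gens_carrier \<rho>_simps Mat_u)
qed

text \<open>The recursion for the \<open>e_(r)\<close> determines their images from those of \<open>e\<close> and the \<open>u_i\<close>.\<close>

lemma is_Phi_unique:
  assumes f: "is_Phi s w k N n f" and n: "1 \<le> n" and p: "p \<in> carrier (free_ring (C_letters n))"
  shows "f (C_class s N n p) = Mat n (\<rho> p)"
proof -
  let ?C = "carrier (free_ring (C_letters n))"
  have h: "f \<in> Ring.ring_hom (C_alg s N n) (ring_mat TYPE('a) (N ^ n) ())"
    using f by (simp add: is_Phi_def)
  have cl: "C_class s N n p \<in> carrier (C_alg s N n)" if "p \<in> ?C" for p
    using that by (auto simp: C_alg_carrier)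
  have add: "f (C_class s N n (p + q)) = Mat n (\<rho> (p + q))"
    and mult: "f (C_class s N n (p * q)) = Mat n (\<rho> (p * q))"
    if "p \<in> ?C" "q \<in> ?C" "f (C_class s N n p) = Mat n (\<rho> p)" "f (C_class s N n q) = Mat n (\<rho> q)" for p q
  proof -
    show "f (C_class s N n (p + q)) = Mat n (\<rho> (p + q))"
      using ring_hom_add[OF h cl[OF that(1)] cl[OF that(2)]] that
      by (simp add: C_class_hom ring_mat_simps \<rho>_simps Mat_add)
    show "f (C_class s N n (p * q)) = Mat n (\<rho> (p * q))"
      using ring_hom_mult[OF h cl[OF that(1)] cl[OF that(2)]] that
      by (simp add: C_class_hom ring_mat_simps \<rho>_simps Mat_mult preserves_\<rho>)
  qed
  have scalar: "f (C_class s N n (scalar x)) = Mat n (\<rho> (scalar x))" for x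
    using f by (simp add: is_Phi_def \<rho>_simps Mat_scal)
  have u: "f (C_class s N n (u_el i)) = Mat n (\<rho> (u_el i))" if "1 \<le> i" "i < n" for i
    using f that by (simp add: is_Phi_def \<rho>_simps Mat_u)
  have e: "f (C_class s N n (e_el r)) = Mat n (\<rho> (e_el r))" if "1 \<le> r" "r \<le> n" for r
    using that
  proof (induction r rule: dec_induct)
    case base
    then show ?case using f n by (simp add: is_Phi_def \<rho>_simps Mat_e1 del: e.simps)
  next
    case (step r)
    define x where "x = (s powi (int N - 2) - s powi - (int N - 2)) / (s powi int N - s powi - int N)"
    define p where "p = e_el r * u_el r * e_el r + scalar (- x) * e_el r"
    have carr: "e_el r \<in> ?C" "u_el r \<in> ?C" using step by (auto intro: C_gens_carrier)
    have IH: "f (C_class s N n (e_el r)) = Mat n (\<rho> (e_el r))" using step by auto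
    have sc: "scalar (- x) * (q :: (C_letter, 'a) free_alg) = - (scalar x * q)" for q
      by (simp add: scalar_def single_uminus)
    have rel: "e_el (r + 1) - p \<in> C_rels s N n"
    proof -
      have "e_el (r + 1) - p = e_el (r + 1) - (e_el r * u_el r * e_el r - scalar x * e_el r)"
        by (simp add: p_def sc)
      moreover have "1 \<le> r" "r < n" using step by auto
      ultimately show ?thesis unfolding C_rels_def x_def
        by (intro UnI1[OF UnI1[OF UnI2]]) blast
    qed
    then have "C_class s N n (e_el (r + 1)) = C_class s N n p"
      using C_rels_subset_ideal by (intro C_class_cong) auto
    moreover have "f (C_class s N n p) = Mat n (\<rho> p)"
      unfolding p_def using step carr
      by (intro add mult IH u scalar free_carrier_intros) auto
    moreover have "\<rho> (e_el (r + 1)) = \<rho> p"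
      using \<rho>_rels[OF generic rel] by (simp add: \<rho>_simps)
    ultimately show ?case by (simp only: Suc_eq_plus1)
  qed
  show ?thesis using p
  proof (induction rule: free_alg_induct)
    case (gen x)
    then show ?case using u e by (auto simp: C_letters_def u_el_def e_el_def)
  qed (auto intro: scalar add mult)
qed

lemma Phi_eq: "1 \<le> n \<Longrightarrow> Phi s w k N n = Phi_op n"
  unfolding Phi_def
proof (rule the_equality)
  assume n: "1 \<le> n"
  show "Phi_op n \<in> extensional (carrier (C_alg s N n)) \<and> is_Phi s w k N n (Phi_op n)"
    using is_Phi_Phi_op[OF n] by (simp add: Phi_op_def)
  fix f assume f: "f \<in> extensional (carrier (C_alg s N n)) \<and> is_Phi s w k N n f"
  show "f = Phi_op n"
  proof (rule extensionalityI)
    show "f \<in> extensional (carrier (C_alg s N n))" "Phi_op n \<in> extensional (carrier (C_alg s N n))"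
      using f by (auto simp: Phi_op_def)
    fix X assume "X \<in> carrier (C_alg s N n)"
    then show "f X = Phi_op n X"
      using is_Phi_unique[OF conjunct2[OF f] n] by (auto simp: C_alg_carrier Phi_op_class)
  qed
qed

lemma q_diff_nonzero: "s\<^sup>2 - inverse (s\<^sup>2) \<noteq> 0"
proof
  assume "s\<^sup>2 - inverse (s\<^sup>2) = 0"
  then have "s\<^sup>2 * s\<^sup>2 = inverse (s\<^sup>2) * s\<^sup>2" by simp
  then have "s ^ 4 = 1" using s_0 by (simp add: power_add[symmetric])
  then show False using generic[of 4] by simp
qed

lemma qint_eq: "qint (s\<^sup>2) (int N) = d0"
proof -
  define \<delta> where "\<delta> = s\<^sup>2 - inverse (s\<^sup>2)"
  have \<delta>: "\<delta> \<noteq> 0" unfolding \<delta>_def by (rule q_diff_nonzero)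
  have tel: "D b * \<delta> = s powi (4 * int (Suc b) - 4 * int k - 2) - s powi (4 * int b - 4 * int k - 2)" for b
  proof -
    have "s powi (4 * int (Suc b) - 4 * int k - 2) = s powi (4 * int b - 4 * int k + 2)"
      by (rule arg_cong[of _ _ "\<lambda>m. s powi m"]) simp
    moreover have "s powi (4 * int b - 4 * int k) = s powi (4 * int b - 4 * int k - 2 + 2)"
      by (rule arg_cong[of _ _ "\<lambda>m. s powi m"]) simp
    ultimately show ?thesis
      unfolding D_def \<delta>_def powi_add_2 using s_0 by (simp add: right_diff_distrib powi_add_2)
  qed
  have "d0 * \<delta> = s powi (4 * int N - 4 * int k - 2) - s powi (4 * int 0 - 4 * int k - 2)"
    unfolding d0_def sum_distrib_right tel by (rule sum_lessThan_telescope)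
  also have "s powi (4 * int N - 4 * int k - 2) = (s\<^sup>2) powi int N"
  proof -
    have "(s\<^sup>2) powi int N = s powi (2 * int N)" by (rule power2_powi)
    then show ?thesis by (simp add: N algebra_simps)
  qed
  also have "s powi (4 * int 0 - 4 * int k - 2) = (s\<^sup>2) powi (- int N)"
  proof -
    have "(s\<^sup>2) powi (- int N) = s powi (2 * (- int N))" by (rule power2_powi)
    also have "2 * (- int N) = 4 * int 0 - 4 * int k - 2" by (simp add: N)
    finally show ?thesis ..
  qed
  finally show ?thesis
    using \<delta> unfolding qint_def \<delta>_def[symmetric] by (metis nonzero_mult_div_cancel_right)
qed

lemma d0_nonzero: "d0 \<noteq> 0"
proof
  assume "d0 = 0"
  then have "((s\<^sup>2) powi int N - (s\<^sup>2) powi (- int N)) / (s\<^sup>2 - inverse (s\<^sup>2)) = 0"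
    using qint_eq by (simp add: qint_def)
  with q_diff_nonzero have "(s\<^sup>2) powi int N - (s\<^sup>2) powi (- int N) = 0" by simp
  then have "(s\<^sup>2) ^ N = inverse ((s\<^sup>2) ^ N)" by (simp add: power_int_minus)
  then have "(s\<^sup>2) ^ N * (s\<^sup>2) ^ N = inverse ((s\<^sup>2) ^ N) * (s\<^sup>2) ^ N" by simp
  then have "(s\<^sup>2) ^ N * (s\<^sup>2) ^ N = 1" using s_0 by simp
  then have "s ^ (2 * N + 2 * N) = 1" by (simp only: power_add power_mult)
  then show False using generic[of "2 * N + 2 * N"] N by simp
qed

lemma phi_class:
  assumes "1 \<le> n" "p \<in> carrier (free_ring (C_letters n))"
  shows "phi s w k N n (C_class s N n p) = Tr n (\<rho> p) / d0 ^ n"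
  using assms by (simp add: phi_def Phi_eq Phi_op_class mat_trace_Mat qint_eq power_one_over field_simps)

lemma Tr_Suc_A: "x \<in> A m \<Longrightarrow> Tr (Suc m) x = d0 * Tr m x"
  using F_right[of "Suc m" x 1] F_left[of "Suc m" x 1]
proof -
  assume x: "x \<in> A m"
  have "F (Suc m) x = x * F (Suc m) 1"
    using F_left[of "Suc m" x 1] E_A[OF x] by simp
  then show ?thesis by (simp add: F_1 d0_def[symmetric] scal_left_commute[of x] Tr_scal Tr_\<pi>)
qed

lemma Tr_Suc_u: "x \<in> A m \<Longrightarrow> 1 \<le> m \<Longrightarrow> Tr (Suc m) (x * u m) = d1 * Tr m x"
proof -
  assume x: "x \<in> A m" and m: "1 \<le> m"
  have "F (Suc m) (x * u m) = x * F (Suc m) (u m)"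
    using F_left[of "Suc m" x "u m"] E_A[OF x] by simp
  then show ?thesis using m by (simp add: F_u scal_left_commute[of x] Tr_scal Tr_\<pi>)
qed

lemma Tr_1: "Tr n 1 = d0 ^ n"
proof (induction n)
  case 0
  then show ?case using N_pos by (simp add: app_simps valid_def)
next
  case (Suc n)
  then show ?case using Tr_Suc_A[of 1 n] by (simp add: A_intros)
qed

text \<open>The value on \<open>g_el s m\<close> is a constant because its partial trace over the last factor is.\<close>

lemma phi_Markov:
  assumes "1 \<le> m" "X \<in> carrier (C_alg s N m)"
  shows "phi s w k N (Suc m) (C_incl s N (Suc m) X \<otimes>\<^bsub>C_alg s N (Suc m)\<^esub> C_class s N (Suc m) (g_el s m)) =
    phi s w k N m X * phi s w k N (Suc m) (C_class s N (Suc m) (g_el s m))"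
    and "phi s w k N (Suc m) (C_incl s N (Suc m) X) = phi s w k N m X"
proof -
  obtain p where p: "p \<in> carrier (free_ring (C_letters m))" "X = C_class s N m p"
    using assms(2) by (auto simp: C_alg_carrier)
  have p': "p \<in> carrier (free_ring (C_letters (Suc m)))"
    using p(1) free_carrier_mono[OF C_letters_mono[of m "Suc m"]] by auto
  have g: "g_el s m \<in> carrier (free_ring (C_letters (Suc m)))" using assms by (intro C_gens_carrier) auto
  have incl: "C_incl s N (Suc m) X = C_class s N (Suc m) p" unfolding p(2) by (rule C_incl_class) simp
  have A: "\<rho> p \<in> A m" using p(1) by (rule \<rho>_A)
  have Trg: "Tr (Suc m) (x * (scal (s\<^sup>2) - u m)) = (s\<^sup>2 * d0 - d1) * Tr m x" if "x \<in> A m" for x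
    using that assms(1)
    by (simp add: right_diff_distrib Tr_diff scal_commute[of x] Tr_scal Tr_Suc_A Tr_Suc_u left_diff_distrib del: Tr.simps)
  have 1: "phi s w k N (Suc m) (C_class s N (Suc m) (g_el s m)) = (s\<^sup>2 * d0 - d1) / d0"
    using Trg[of 1] g d0_nonzero by (simp add: phi_class \<rho>_simps A_intros Tr_1 del: Tr.simps)
  show "phi s w k N (Suc m) (C_incl s N (Suc m) X \<otimes>\<^bsub>C_alg s N (Suc m)\<^esub> C_class s N (Suc m) (g_el s m)) =
    phi s w k N m X * phi s w k N (Suc m) (C_class s N (Suc m) (g_el s m))"
    unfolding 1 incl unfolding p(2) using p(1) p' g assms(1)
    by (simp add: C_class_hom phi_class free_carrier_intros \<rho>_simps Trg[OF A] mult.commute del: Tr.simps)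
  show "phi s w k N (Suc m) (C_incl s N (Suc m) X) = phi s w k N m X"
    unfolding incl unfolding p(2) using p(1) p' assms(1) d0_nonzero
    by (simp add: phi_class Tr_Suc_A[OF A] del: Tr.simps)
qed

lemma phi_trace:
  assumes "1 \<le> n" "X \<in> carrier (C_alg s N n)" "Y \<in> carrier (C_alg s N n)"
  shows "phi s w k N n (X \<otimes>\<^bsub>C_alg s N n\<^esub> Y) = phi s w k N n (Y \<otimes>\<^bsub>C_alg s N n\<^esub> X)"
  using assms
  by (auto simp: C_alg_carrier C_class_hom phi_class free_carrier_intros \<rho>_simps
      intro!: arg_cong[of _ _ "\<lambda>x. x / _"] trace_property \<rho>_A)

lemma phi_linear:
  assumes "1 \<le> n"
  shows "linear_functional s N n (phi s w k N n)"
  unfolding linear_functional_def using assms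
  by (auto simp: C_alg_carrier C_class_hom phi_class free_carrier_intros \<rho>_simps Tr_add Tr_scal add_divide_distrib)

lemma phi_1: "1 \<le> n \<Longrightarrow> phi s w k N n \<one>\<^bsub>C_alg s N n\<^esub> = 1"
  using d0_nonzero by (simp add: C_alg_one phi_class free_carrier_intros \<rho>_simps Tr_1)

lemma phi_tower: "is_trace_on_tower s N (phi s w k N)"
  unfolding is_trace_on_tower_def Suc_eq_plus1[symmetric]
  using phi_linear phi_1 phi_trace phi_Markov(2) by auto

end

lemma generic_of_transcendental:
  fixes \<iota> :: "complex \<Rightarrow> 'a::field" and s :: 'a
  assumes "extends_C_sqrt_q \<iota> s"
  shows "s \<noteq> 0" "0 < m \<Longrightarrow> s ^ m \<noteq> 1"
proof -
  interpret field_hom \<iota> using assms by (simp add: extends_C_sqrt_q_def)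
  have nz: "poly (map_poly \<iota> p) s \<noteq> 0" if "p \<noteq> 0" for p :: "complex poly"
    using assms that by (simp add: extends_C_sqrt_q_def)
  have "map_poly \<iota> (monom 1 1) = monom 1 1" by (simp add: map_poly_monom)
  then show "s \<noteq> 0" using nz[of "monom 1 1"] by (simp add: poly_monom)
  assume m: "0 < m"
  have "map_poly \<iota> (monom 1 m - 1) = monom 1 m - 1"
    by (rule poly_eqI) (simp add: coeff_map_poly hom_distribs)
  moreover have "monom (1::complex) m - 1 \<noteq> 0"
  proof
    assume "monom (1::complex) m - 1 = 0"
    then have "coeff (monom (1::complex) m - 1) m = 0" by simp
    then show False using m by simp
  qed
  ultimately show "s ^ m \<noteq> 1" using nz[of "monom 1 m - 1"] by (simp add: poly_monom)
qed

lemma generic_N_state_of_transcendental: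
  fixes \<iota> :: "complex \<Rightarrow> 'a::field" and s w :: 'a
  assumes "extends_C_sqrt_q \<iota> s"
    and w: "w\<^sup>2 = (\<Sum>j = 1..N. (s\<^sup>2) powi (int k + 1 - int j))"
    and N: "N = 2 * k + 1" and "N \<ge> 3"
  shows "generic_N_state s w k N"
proof -
  note s = generic_of_transcendental[OF assms(1)]
  have w': "w\<^sup>2 = (\<Sum>i<N. s powi (2 * int k - 2 * int i))"
  proof -
    have "(\<Sum>j = 1..N. (s\<^sup>2) powi (int k + 1 - int j)) = (\<Sum>i<N. (s\<^sup>2) powi (int k + 1 - int (Suc i)))"
      by (rule sum.reindex_bij_witness[of _ Suc "\<lambda>j. j - 1"]) (auto simp: One_nat_def)
    also have "\<dots> = (\<Sum>i<N. s powi (2 * int k - 2 * int i))"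
    proof (intro sum.cong refl)
      fix i
      have "(s\<^sup>2) powi (int k + 1 - int (Suc i)) = s powi (2 * (int k + 1 - int (Suc i)))"
        by (rule power2_powi)
      then show "(s\<^sup>2) powi (int k + 1 - int (Suc i)) = s powi (2 * int k - 2 * int i)"
        by (simp add: algebra_simps)
    qed
    finally show ?thesis using w by simp
  qed
  have "w \<noteq> 0"
  proof
    assume "w = 0"
    then have 0: "(\<Sum>i<N. s powi (2 * int k - 2 * int i)) = 0" using w' by simp
    have eq: "s powi (2 * int k) * s powi (2 * int k - 2 * int i) = (s\<^sup>2) ^ (2 * k - i)" if "i < N" for i
    proof -
      have "s powi (2 * int k) * s powi (2 * int k - 2 * int i) = s powi int (2 * (2 * k - i))"
        using s(1) that N by (simp add: power_int_add[symmetric] of_nat_diff algebra_simps)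
      then show ?thesis by (simp only: power_int_of_nat power_mult)
    qed
    have "(\<Sum>i<N. (s\<^sup>2) ^ (2 * k - i)) = s powi (2 * int k) * (\<Sum>i<N. s powi (2 * int k - 2 * int i))"
      unfolding sum_distrib_left by (intro sum.cong refl eq[symmetric]) simp
    then have "(\<Sum>i<N. (s\<^sup>2) ^ (2 * k - i)) = 0" unfolding 0 by simp
    moreover have "(\<Sum>i<N. (s\<^sup>2) ^ (2 * k - i)) = (\<Sum>i<N. (s\<^sup>2) ^ i)"
      by (rule sum.reindex_bij_witness[of _ "\<lambda>i. 2 * k - i" "\<lambda>i. 2 * k - i"]) (use N in auto)
    ultimately have "(s\<^sup>2) ^ N - 1 = 0" by (simp add: power_diff_1_eq)
    then have "s ^ (2 * N) = 1" by (simp add: power_mult)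
    then show False using s(2)[of "2 * N"] N by simp
  qed
  then show ?thesis
    using s w' N \<open>N \<ge> 3\<close> by unfold_locales auto
qed

theorem theorem4p4:
  fixes \<iota> :: "complex \<Rightarrow> 'a::field" and s w :: 'a and k N :: nat
  assumes "extends_C_sqrt_q \<iota> s"
    and "w\<^sup>2 = (\<Sum>j = 1..N. (s\<^sup>2) powi (int k + 1 - int j))"
    and "N = 2 * k + 1" and "N \<ge> 3"
  shows "(\<forall>n \<ge> 2. \<forall>c \<in> carrier (C_alg s N (n - 1)).
            phi s w k N n (C_incl s N n c \<otimes>\<^bsub>C_alg s N n\<^esub> C_class s N n (g_el s (n - 1))) =
            phi s w k N n (C_incl s N n c) * phi s w k N n (C_class s N n (g_el s (n - 1)))) \<and>
         (\<forall>n \<ge> 1. \<forall>c \<in> carrier (C_alg s N n). \<forall>d \<in> carrier (C_alg s N n).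
            phi s w k N n (c \<otimes>\<^bsub>C_alg s N n\<^esub> d) = phi s w k N n (d \<otimes>\<^bsub>C_alg s N n\<^esub> c)) \<and>
         (\<exists>tr. is_trace_on_tower s N tr \<and>
            (\<forall>n \<ge> 1. \<forall>c \<in> carrier (C_alg s N n).
               tr (n + 1) (C_incl s N (n + 1) c \<otimes>\<^bsub>C_alg s N (n + 1)\<^esub> C_class s N (n + 1) (g_el s n)) =
               tr n c * tr (n + 1) (C_class s N (n + 1) (g_el s n))))"
proof -
  interpret R: generic_N_state s w k N
    using assms by (rule generic_N_state_of_transcendental)
  show ?thesis
    unfolding Suc_eq_plus1[symmetric]
  proof (intro conjI allI impI ballI exI[of _ "phi s w k N"])
    fix n c assume n: "2 \<le> n" and c: "c \<in> carrier (C_alg s N (n - 1))"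
    obtain m where m: "n = Suc m" "1 \<le> m" using n by (cases n) (auto simp: One_nat_def)
    show "phi s w k N n (C_incl s N n c \<otimes>\<^bsub>C_alg s N n\<^esub> C_class s N n (g_el s (n - 1))) =
        phi s w k N n (C_incl s N n c) * phi s w k N n (C_class s N n (g_el s (n - 1)))"
      using R.phi_Markov[of m c] m c by (simp add: One_nat_def)
  qed (use R.phi_trace R.phi_tower R.phi_Markov(1) in auto)
qed

end
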